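(* Let $K$ be a field, let $n,m\ge 0$ be integers, let $L=D_{2^n\cdot 3^m}$ be the divisor lattice and let $I$ be a dual order ideal of $L$. Then the following conditions are equivalent: (i) $L\setminus I$ is a subposet of $L$ of the form $D_{2^{n'}\cdot 3^{m'}}\setminus I'$, where $0\le n'\le n$, $0\le m'\le m$ and $I'$ is a rank-fixed dual order ideal of $D_{2^{n'}\cdot 3^{m'}}$; (ii) $L\setminus I$ is vertex decomposable; (iii) $L\setminus I$ is shellable; (iv) $L\setminus I$ is Cohen--Macaulay (over $K$).
   Context: $D_N$ denotes the set of positive divisors of $N$ ordered by divisibility. A dual order ideal of a poset $Q$ is a subset $I\subset Q$ such that $t\in I$ and $s\ge t$ imply $s\in I$. The rank of $x$ in a poset is the largest $r$ for which there is a chain $x_0<x_1<\cdots<x_r=x$. A dual order ideal $I$ of a finite distributive lattice $L$ is rank-fixed if the set of minimal elements of $I$ is the set of all elements of $L$ of some fixed rank $r\ge 0$ (with $I=\emptyset$ allowed as rank-fixed, corresponding to $r>\mathrm{rank}(L)$). The order complex $\Delta(Q)$ of a finite poset $Q$ is the simplicial complex on $Q$ whose faces are the chains of $Q$. A poset $Q$ is called vertex decomposable, shellable or Cohen--Macaulay if $\Delta(Q)$ is so. For the empty poset, $\Delta(\emptyset)=\{\emptyset\}$, which is regarded as a simplex. A simplicial complex is pure if all its facets (maximal faces) have the same cardinality. The link of a face $F$ is $\mathrm{link}_\Delta F=\{F'\in\Delta: F\cap F'=\emptyset, F\cup F'\in\Delta\}$. A pure simplicial complex $\Delta$ is vertex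 decomposable if either $\Delta$ is a simplex or there is a vertex $x$ of $\Delta$ such that (1) $\Delta-x:=\{\sigma\in\Delta: x\notin\sigma\}$ and $\mathrm{link}_\Delta\{x\}$ are vertex decomposable, and (2) no face of $\mathrm{link}_\Delta\{x\}$ is a facet of $\Delta-x$. A pure simplicial complex $\Delta$ of dimension $d-1$ is shellable if its facets can be ordered $F_1,\dots,F_s$ so that $(\bigcup_{j=1}^{i-1}\langle F_j\rangle)\cap\langle F_i\rangle$ is pure of dimension $d-2$ for each $1<i\le s$, where $\langle F\rangle=\{\sigma: \sigma\subset F\}$. $\Delta$ is Cohen--Macaulay (over $K$) if its Stanley--Reisner ring $K[\Delta]$ is Cohen--Macaulay. *)

theory Defs
  imports
    "HOL-Algebra.Ring_Divisibility"
    "HOL-Algebra.Algebraic_Closure_Type"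
    "HOL-Library.Poly_Mapping"
    "HOL-Library.Extended_Nat"
begin

section \<open>Posets\<close>

text \<open>A poset is given by an order relation \<open>leq\<close> on a type together with a carrier set \<open>Q\<close>;
  a subposet is a subset of the carrier with the same \<open>leq\<close>.\<close>

definition divisor_lattice :: "nat \<Rightarrow> nat set" where
  "divisor_lattice N = {d. d dvd N}"

definition dual_order_ideal :: "('a \<Rightarrow> 'a \<Rightarrow> bool) \<Rightarrow> 'a set \<Rightarrow> 'a set \<Rightarrow> bool" where
  "dual_order_ideal leq Q I \<longleftrightarrow> I \<subseteq> Q \<and> (\<forall>t\<in>I. \<forall>s\<in>Q. leq t s \<longrightarrow> s \<in> I)"

definition minimal_elements :: "('a \<Rightarrow> 'a \<Rightarrow> bool) \<Rightarrow> 'a set \<Rightarrow> 'a set" where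
  "minimal_elements leq I = {x \<in> I. \<forall>y\<in>I. leq y x \<longrightarrow> y = x}"

text \<open>The list \<open>xs\<close> below is the chain \<open>x\<^sub>0 < \<dots> < x\<^sub>r = x\<close>.\<close>

definition poset_rank :: "('a \<Rightarrow> 'a \<Rightarrow> bool) \<Rightarrow> 'a set \<Rightarrow> 'a \<Rightarrow> nat" where
  "poset_rank leq Q x = (GREATEST r. \<exists>xs. length xs = Suc r \<and> set xs \<subseteq> Q \<and>
     sorted_wrt (\<lambda>a b. leq a b \<and> a \<noteq> b) xs \<and> last xs = x)"

text \<open>Since \<open>r\<close> may exceed the rank of the (finite) poset \<open>L\<close>, the empty ideal is rank-fixed.\<close>

definition rank_fixed :: "('a \<Rightarrow> 'a \<Rightarrow> bool) \<Rightarrow> 'a set \<Rightarrow> 'a set \<Rightarrow> bool" where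
  "rank_fixed leq L I \<longleftrightarrow> (\<exists>r. minimal_elements leq I = {x \<in> L. poset_rank leq L x = r})"


section \<open>Simplicial complexes\<close>

text \<open>Complexes are finite and contain the empty face; the smallest one is \<open>{{}}\<close>.\<close>

definition abstract_simplicial_complex :: "'a set set \<Rightarrow> bool" where
  "abstract_simplicial_complex \<Delta> \<longleftrightarrow>
     finite \<Delta> \<and> {} \<in> \<Delta> \<and> (\<forall>F\<in>\<Delta>. finite F \<and> (\<forall>G. G \<subseteq> F \<longrightarrow> G \<in> \<Delta>))"

definition order_complex :: "('a \<Rightarrow> 'a \<Rightarrow> bool) \<Rightarrow> 'a set \<Rightarrow> 'a set set" where
  "order_complex leq Q = {F. F \<subseteq> Q \<and> Complete_Partial_Order.chain leq F}"

definition facets :: "'a set set \<Rightarrow> 'a set set" where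
  "facets \<Delta> = {F \<in> \<Delta>. \<forall>G\<in>\<Delta>. F \<subseteq> G \<longrightarrow> G = F}"

definition pure_complex :: "'a set set \<Rightarrow> bool" where
  "pure_complex \<Delta> \<longleftrightarrow> (\<forall>F\<in>facets \<Delta>. \<forall>G\<in>facets \<Delta>. card F = card G)"

definition complex_dim :: "'a set set \<Rightarrow> int" where
  "complex_dim \<Delta> = int (Max (card ` \<Delta>)) - 1"

definition link :: "'a set set \<Rightarrow> 'a set \<Rightarrow> 'a set set" where
  "link \<Delta> F = {G \<in> \<Delta>. F \<inter> G = {} \<and> F \<union> G \<in> \<Delta>}"

definition deletion :: "'a set set \<Rightarrow> 'a \<Rightarrow> 'a set set" where
  "deletion \<Delta> x = {G \<in> \<Delta>. x \<notin> G}"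

inductive vertex_decomposable :: "'a set set \<Rightarrow> bool" where
  simplex: "finite F \<Longrightarrow> vertex_decomposable (Pow F)"
| shedding: "\<lbrakk>abstract_simplicial_complex \<Delta>; pure_complex \<Delta>; {x} \<in> \<Delta>;
     vertex_decomposable (deletion \<Delta> x); vertex_decomposable (link \<Delta> {x});
     \<forall>G\<in>link \<Delta> {x}. G \<notin> facets (deletion \<Delta> x)\<rbrakk> \<Longrightarrow> vertex_decomposable \<Delta>"

definition shellable :: "'a set set \<Rightarrow> bool" where
  "shellable \<Delta> \<longleftrightarrow> abstract_simplicial_complex \<Delta> \<and> pure_complex \<Delta> \<and>
     (\<exists>Fs. distinct Fs \<and> set Fs = facets \<Delta> \<and>
        (\<forall>i. 0 < i \<and> i < length Fs \<longrightarrow>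
           (let \<Gamma> = (\<Union>j<i. Pow (Fs ! j)) \<inter> Pow (Fs ! i)
            in pure_complex \<Gamma> \<and> complex_dim \<Gamma> = complex_dim \<Delta> - 1)))"


section \<open>Cohen--Macaulay rings\<close>

text \<open>\<open>xs\<close> is an \<open>R\<close>-sequence: each \<open>x\<^sub>i\<close> is a nonzerodivisor modulo its predecessors, and
  \<open>R\<close> is not generated by \<open>xs\<close>.\<close>

definition regular_sequence :: "('a, 'b) ring_scheme \<Rightarrow> 'a list \<Rightarrow> bool" where
  "regular_sequence R xs \<longleftrightarrow> set xs \<subseteq> carrier R \<and>
     (\<forall>i<length xs. \<forall>a\<in>carrier R.
        a \<otimes>\<^bsub>R\<^esub> (xs ! i) \<in> Idl\<^bsub>R\<^esub> (set (take i xs)) \<longrightarrow> a \<in> Idl\<^bsub>R\<^esub> (set (take i xs))) \<and>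
     Idl\<^bsub>R\<^esub> (set xs) \<noteq> carrier R"

text \<open>The depth (grade) of a proper ideal \<open>P\<close> on \<open>R\<close>.\<close>

definition ideal_depth :: "('a, 'b) ring_scheme \<Rightarrow> 'a set \<Rightarrow> enat" where
  "ideal_depth R P = Sup {enat (length xs) |xs. regular_sequence R xs \<and> set xs \<subseteq> P}"

text \<open>The height (codimension) of a prime ideal \<open>P\<close>: \<open>Ps\<close> is a chain of primes
  \<open>P\<^sub>0 \<subset> \<dots> \<subset> P\<^sub>r = P\<close>.\<close>

definition prime_height :: "('a, 'b) ring_scheme \<Rightarrow> 'a set \<Rightarrow> enat" where
  "prime_height R P = Sup {enat r |r. \<exists>Ps. length Ps = Suc r \<and>
     (\<forall>J\<in>set Ps. primeideal J R) \<and> sorted_wrt (\<subset>) Ps \<and> last Ps = P}"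

text \<open>A Noetherian commutative ring is Cohen--Macaulay if depth equals height at every
  maximal ideal; this is the definition of Eisenbud (\<open>Commutative Algebra\<close>, Section 18.2)
  and of Kaplansky (\<open>Commutative Rings\<close>, Section 3-1), which avoids localization.\<close>

definition Cohen_Macaulay_ring :: "('a, 'b) ring_scheme \<Rightarrow> bool" where
  "Cohen_Macaulay_ring R \<longleftrightarrow> cring R \<and> noetherian_ring R \<and>
     (\<forall>M. maximalideal M R \<longrightarrow> ideal_depth R M = prime_height R M)"


section \<open>Stanley--Reisner rings\<close>

text \<open>A polynomial in variables of type \<open>'v\<close> is a finitely supported function from
  exponent vectors \<open>'v \<Rightarrow>\<^sub>0 nat\<close> to coefficients; the product is convolution.
  \<open>poly_ring_on V\<close> is \<open>K[x\<^sub>v : v \<in> V]\<close> for the field \<open>K = 'k\<close>.\<close>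

type_synonym ('v, 'k) mpoly = "('v \<Rightarrow>\<^sub>0 nat) \<Rightarrow>\<^sub>0 'k"

definition variable :: "'v \<Rightarrow> ('v, 'k::field) mpoly" where
  "variable v = Poly_Mapping.single (Poly_Mapping.single v 1) 1"

definition poly_ring_on :: "'v set \<Rightarrow> ('v, 'k::field) mpoly ring" where
  "poly_ring_on V = ring_of_type_algebra
     \<lparr>carrier := {p. \<forall>e\<in>Poly_Mapping.keys p. Poly_Mapping.keys e \<subseteq> V}\<rparr>"

definition stanley_reisner_ideal :: "'v set set \<Rightarrow> ('v, 'k::field) mpoly set" where
  "stanley_reisner_ideal \<Delta> =
     Idl\<^bsub>poly_ring_on (\<Union>\<Delta>)\<^esub> {\<Prod>v\<in>F. variable v |F. F \<subseteq> \<Union>\<Delta> \<and> F \<notin> \<Delta>}"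

definition stanley_reisner_ring ::
    "'k::field itself \<Rightarrow> 'v set set \<Rightarrow> ('v, 'k) mpoly set ring" where
  "stanley_reisner_ring _ \<Delta> = poly_ring_on (\<Union>\<Delta>) Quot stanley_reisner_ideal \<Delta>"

definition Cohen_Macaulay_complex :: "'k::field itself \<Rightarrow> 'v set set \<Rightarrow> bool" where
  "Cohen_Macaulay_complex k \<Delta> \<longleftrightarrow> Cohen_Macaulay_ring (stanley_reisner_ring k \<Delta>)"

end

theory Submission
  imports Defs
begin

text \<open>An order ideal \<open>Q\<close> of \<open>L\<close> is a staircase in the plane. If it is a rectangle truncated at a rank,
  shedding the elements of the first column from the top down shows that it is vertex decomposable.
  A vertex decomposable complex is shellable, and facets of the order complex of \<open>Q\<close> meet every rank
  once. For a maximal ideal \<open>M\<close> of \<open>K[\<Delta>]\<close>, Zariski's lemma gives monic polynomials \<open>g\<^sub>i\<close> with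
  \<open>g\<^sub>i(\<theta>\<^sub>i) \<in> M\<close>, where \<open>\<theta>\<^sub>i\<close> is the sum of the variables of rank \<open>i\<close>; a shelling filters \<open>K[\<Delta>]\<close> with
  subquotients \<open>K[F]\<close>, on each of which \<open>g\<^sub>i(\<theta>\<^sub>i)\<close> is a regular sequence, so \<open>M\<close> has depth at least
  \<open>dim K[\<Delta>]\<close>.

  Conversely, a staircase that is not a truncated rectangle has two consecutive corners that differ
  by more than one step. The hook leading to the meet of these corners is a face whose link consists
  of two disjoint simplices, not both of them points. At the maximal ideal where the variables of that
  face are \<open>1\<close> and all others vanish, depth and height differ.\<close>

section \<open>Ideals and regular sequences in a subring\<close>

text \<open>The Cohen--Macaulay condition ranges over all maximal ideals \<open>M\<close>, not only
  the graded one, and \<open>K\<close> need not be algebraically closed. The sums of variables of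
  one rank need not lie in \<open>M\<close>, which is why monic polynomials in them take their
  place. Modulo the ideal of a facet such a sum becomes the single variable of that rank, so these
  polynomials live in different variables and their regularity is a degree argument. Depth and
  height agree because \<open>d \<le> depth \<le> height \<le> d\<close>: the middle inequality
  turns a regular sequence into a chain of primes, the last one counts monomials. In the converse
  direction, setting the variables of a face to \<open>1\<close> plays the part of localizing at
  that face, and a socle element shows that no regular sequence in the maximal ideal is longer than
  the one exhibited. Ideals of a quotient are represented by the ideals of the polynomial ring that
  contain the relations, so regularity modulo \<open>J\<close> is a condition on \<open>J\<close>,
  and the quotient rings themselves enter only in the translation to the definitions.\<close>

locale comm_subring =
  fixes C :: "'a::comm_ring_1 set"
  assumes one_mem: "1 \<in> C"
    and diff_mem: "a \<in> C \<Longrightarrow> b \<in> C \<Longrightarrow> a - b \<in> C"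
    and mult_mem: "a \<in> C \<Longrightarrow> b \<in> C \<Longrightarrow> a * b \<in> C"
begin

lemma zero_mem: "0 \<in> C"
  using diff_mem[OF one_mem one_mem] by simp

lemma uminus_mem: "a \<in> C \<Longrightarrow> - a \<in> C"
  using diff_mem[OF zero_mem] by simp

lemma add_mem: "a \<in> C \<Longrightarrow> b \<in> C \<Longrightarrow> a + b \<in> C"
  using diff_mem[OF _ uminus_mem, of a b] by simp

lemmas mem = zero_mem one_mem add_mem diff_mem uminus_mem mult_mem

definition is_ideal :: "'a set \<Rightarrow> bool" where
  "is_ideal J \<longleftrightarrow> J \<subseteq> C \<and> 0 \<in> J \<and> (\<forall>a\<in>J. \<forall>b\<in>J. a + b \<in> J) \<and> (\<forall>c\<in>C. \<forall>a\<in>J. c * a \<in> J)"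

lemma is_idealD:
  assumes "is_ideal J"
  shows is_ideal_subset: "J \<subseteq> C" and is_ideal_mem: "a \<in> J \<Longrightarrow> a \<in> C"
    and is_ideal_zero: "0 \<in> J" and is_ideal_add: "a \<in> J \<Longrightarrow> b \<in> J \<Longrightarrow> a + b \<in> J"
    and is_ideal_mult: "c \<in> C \<Longrightarrow> a \<in> J \<Longrightarrow> c * a \<in> J"
    and is_ideal_mult_right: "c \<in> C \<Longrightarrow> a \<in> J \<Longrightarrow> a * c \<in> J"
  using assms by (auto simp: is_ideal_def mult.commute)

lemma is_ideal_uminus: "is_ideal J \<Longrightarrow> a \<in> J \<Longrightarrow> - a \<in> J"
  using is_ideal_mult[of J "- 1" a] by (simp add: mem)

lemma is_ideal_diff: "is_ideal J \<Longrightarrow> a \<in> J \<Longrightarrow> b \<in> J \<Longrightarrow> a - b \<in> J"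
  using is_ideal_add[of J a "- b"] is_ideal_uminus[of J b] by simp

lemma is_ideal_sum: "is_ideal J \<Longrightarrow> (\<And>i. i \<in> A \<Longrightarrow> f i \<in> J) \<Longrightarrow> sum f A \<in> J"
  by (induction A rule: infinite_finite_induct) (auto simp: is_ideal_zero is_ideal_add)

lemma is_ideal_add_iff: "is_ideal J \<Longrightarrow> b \<in> J \<Longrightarrow> a + b \<in> J \<longleftrightarrow> a \<in> J"
  using is_ideal_diff[of J "a + b" b] by (auto simp: is_ideal_add)

lemma is_ideal_one: "is_ideal J \<Longrightarrow> 1 \<in> J \<longleftrightarrow> J = C"
  using is_ideal_mult[of J _ 1] by (auto simp: is_ideal_subset mem dest: is_ideal_mem)

lemma is_ideal_carrier: "is_ideal C"
  by (auto simp: is_ideal_def mem)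

lemma is_ideal_zero_ideal: "is_ideal {0}"
  by (auto simp: is_ideal_def mem)

definition adj :: "'a set \<Rightarrow> 'a \<Rightarrow> 'a set" where
  "adj J f = {j + c * f |j c. j \<in> J \<and> c \<in> C}"

lemma adjI: "j \<in> J \<Longrightarrow> c \<in> C \<Longrightarrow> j + c * f \<in> adj J f"
  by (auto simp: adj_def)

lemma adjE:
  assumes "x \<in> adj J f" obtains j c where "j \<in> J" "c \<in> C" "x = j + c * f"
  using assms by (auto simp: adj_def)

lemma adj_superset: "J \<subseteq> adj J f"
  using adjI[OF _ zero_mem] by fastforce

lemma adj_self: "is_ideal J \<Longrightarrow> f \<in> adj J f"
  using adjI[OF _ one_mem, of 0 J f] by (simp add: is_ideal_zero)

lemma is_ideal_adj:
  assumes "is_ideal J" "f \<in> C" shows "is_ideal (adj J f)"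
  unfolding is_ideal_def
proof (intro conjI ballI)
  show "adj J f \<subseteq> C" using assms by (auto simp: adj_def mem dest: is_ideal_mem)
  show "0 \<in> adj J f" using adj_superset is_ideal_zero[OF assms(1)] by blast
next
  fix a b assume "a \<in> adj J f" "b \<in> adj J f"
  then obtain j c j' c' where "j \<in> J" "c \<in> C" "a = j + c * f" "j' \<in> J" "c' \<in> C" "b = j' + c' * f"
    by (meson adjE)
  then show "a + b \<in> adj J f"
    using adjI[of "j + j'" J "c + c'" f] assms by (auto simp: mem is_ideal_add algebra_simps)
next
  fix c a assume "c \<in> C" "a \<in> adj J f"
  then obtain j d where "j \<in> J" "d \<in> C" "a = j + d * f" by (meson adjE)
  then show "c * a \<in> adj J f"
    using adjI[of "c * j" J "c * d" f] assms \<open>c \<in> C\<close> by (auto simp: mem is_ideal_mult algebra_simps)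
qed

lemma adj_least: "is_ideal K \<Longrightarrow> J \<subseteq> K \<Longrightarrow> f \<in> K \<Longrightarrow> adj J f \<subseteq> K"
  by (auto simp: adj_def intro!: is_ideal_add is_ideal_mult)

lemma adj_mono: "J \<subseteq> K \<Longrightarrow> adj J f \<subseteq> adj K f"
  by (auto simp: adj_def)

lemma adj_commute: "adj (adj J f) g = adj (adj J g) f"
proof -
  have "adj (adj J f) g \<subseteq> adj (adj J g) f" for f g
  proof
    fix x assume "x \<in> adj (adj J f) g"
    then obtain y d where "y \<in> adj J f" "d \<in> C" and xy: "x = y + d * g" by (rule adjE)
    then obtain j c where "j \<in> J" "c \<in> C" and y: "y = j + c * f" by (meson adjE)
    have x: "x = j + c * f + d * g" by (simp add: xy y)
    have "(j + d * g) + c * f \<in> adj (adj J g) f" by (intro adjI) fact+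
    then show "x \<in> adj (adj J g) f" by (simp add: x algebra_simps)
  qed
  then show ?thesis by blast
qed

primrec adjs :: "'a set \<Rightarrow> 'a list \<Rightarrow> 'a set" where
  "adjs J [] = J"
| "adjs J (f # fs) = adjs (adj J f) fs"

lemma adjs_append: "adjs J (fs @ gs) = adjs (adjs J fs) gs"
  by (induction fs arbitrary: J) auto

lemma adjs_adj: "adjs (adj J f) fs = adj (adjs J fs) f"
  by (induction fs arbitrary: J) (auto simp: adj_commute)

lemma is_ideal_adjs: "is_ideal J \<Longrightarrow> set fs \<subseteq> C \<Longrightarrow> is_ideal (adjs J fs)"
  by (induction fs arbitrary: J) (auto simp: is_ideal_adj)

lemma adjs_superset: "J \<subseteq> adjs J fs"
  using adj_superset by (induction fs arbitrary: J) fastforce+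

lemma adjs_set: "is_ideal J \<Longrightarrow> set fs \<subseteq> C \<Longrightarrow> set fs \<subseteq> adjs J fs"
proof (induction fs arbitrary: J)
  case (Cons f fs)
  then have "set fs \<subseteq> adjs (adj J f) fs" "f \<in> adj J f"
    by (auto simp: is_ideal_adj adj_self)
  then show ?case using adjs_superset[of "adj J f" fs] by auto
qed simp

lemma adjs_least: "is_ideal K \<Longrightarrow> J \<subseteq> K \<Longrightarrow> set fs \<subseteq> K \<Longrightarrow> adjs J fs \<subseteq> K"
  by (induction fs arbitrary: J) (auto simp: adj_least)

lemma adjs_mono: "J \<subseteq> K \<Longrightarrow> adjs J fs \<subseteq> adjs K fs"
  by (induction fs arbitrary: J K) (auto simp: adj_mono)

lemma adjs_annihilated:
  assumes "is_ideal K" "c \<in> C" "\<And>j. j \<in> J \<Longrightarrow> c * j \<in> K" "\<And>f. f \<in> set fs \<Longrightarrow> c * f \<in> K" "x \<in> adjs J fs"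
  shows "c * x \<in> K"
  using assms(3-)
proof (induction fs arbitrary: J)
  case (Cons f fs)
  show ?case
  proof (rule Cons.IH)
    fix j assume "j \<in> adj J f"
    then obtain i d where id: "i \<in> J" "d \<in> C" "j = i + d * f" by (rule adjE)
    have "c * i + d * (c * f) \<in> K"
      using id Cons.prems assms(1) by (auto intro: is_ideal_add is_ideal_mult)
    then show "c * j \<in> K" by (simp add: id algebra_simps)
  qed (use Cons.prems in auto)
qed simp

text \<open>\<open>f\<close> acts injectively on \<open>C/J\<close>. Working with representatives
  lets \<open>J\<close> vary while the ring stays fixed.\<close>

definition nzd :: "'a set \<Rightarrow> 'a \<Rightarrow> bool" where
  "nzd J f \<longleftrightarrow> (\<forall>a\<in>C. a * f \<in> J \<longrightarrow> a \<in> J)"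

text \<open>Regularity on \<open>C/J\<close> without the demand that the last quotient be nonzero.
  The induction over a shelling can thus start from \<open>J = C\<close>; properness is added in
  \<open>regular_sequence_Q_iff\<close>.\<close>

primrec rseq :: "'a set \<Rightarrow> 'a list \<Rightarrow> bool" where
  "rseq J [] \<longleftrightarrow> True"
| "rseq J (f # fs) \<longleftrightarrow> nzd J f \<and> rseq (adj J f) fs"

lemma rseq_append: "rseq J (fs @ gs) \<longleftrightarrow> rseq J fs \<and> rseq (adjs J fs) gs"
  by (induction fs arbitrary: J) auto

text \<open>The indexed form, in which \<open>regular_sequence\<close> is stated.\<close>

lemma rseq_iff_nth: "rseq J fs \<longleftrightarrow> (\<forall>i<length fs. nzd (adjs J (take i fs)) (fs ! i))"
proof (induction fs rule: rev_induct)
  case (snoc f fs)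
  then show ?case by (auto simp: rseq_append less_Suc_eq nth_append)
qed simp

lemma nzd_cong:
  assumes "is_ideal J" "f - g \<in> J" shows "nzd J f \<longleftrightarrow> nzd J g"
proof -
  have "a * f \<in> J \<longleftrightarrow> a * g \<in> J" if "a \<in> C" for a
    using is_ideal_add_iff[OF assms(1) is_ideal_mult[OF assms(1) that assms(2)], of "a * g"]
    by (simp add: algebra_simps)
  then show ?thesis by (auto simp: nzd_def)
qed

lemma adj_cong:
  assumes "is_ideal J" "f - g \<in> J" shows "adj J f = adj J g"
proof -
  have "adj J f \<subseteq> adj J g" if "f - g \<in> J" for f g
  proof
    fix x assume "x \<in> adj J f"
    then obtain j c where "j \<in> J" "c \<in> C" "x = j + c * f" by (rule adjE)
    then show "x \<in> adj J g"
      using adjI[of "j + c * (f - g)" J c g] is_ideal_add[OF assms(1) _ is_ideal_mult[OF assms(1) _ that], of j c]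
      by (simp add: algebra_simps)
  qed
  moreover have "g - f \<in> J" using is_ideal_uminus[OF assms] by simp
  ultimately show ?thesis using assms(2) by blast
qed

text \<open>The module-theoretic content is the exact sequence
  \<open>0 \<rightarrow> C/P \<rightarrow> C/J \<rightarrow> C/J' \<rightarrow> 0\<close> whose first map is multiplication by \<open>m\<close>.\<close>

lemma rseq_extension:
  assumes "is_ideal J" "m \<in> C" "J' = adj J m" "\<And>b. b \<in> C \<Longrightarrow> b * m \<in> J \<longleftrightarrow> b \<in> P"
    and "is_ideal P" "set fs \<subseteq> C" "rseq J' fs" "rseq P fs"
  shows "rseq J fs"
  using assms
proof (induction fs arbitrary: J J' P)
  case (Cons f fs)
  note J = Cons.prems(1) and m = Cons.prems(2) and J' = Cons.prems(3) and P = Cons.prems(4)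
  have f: "f \<in> C" using Cons.prems(6) by simp
  have idJ': "is_ideal J'" using J m J' is_ideal_adj by blast
  have nzdJ': "nzd J' f" and nzdP: "nzd P f" using Cons.prems(7,8) by auto
  have "nzd J f" unfolding nzd_def
  proof (intro ballI impI)
    fix a assume a: "a \<in> C" "a * f \<in> J"
    then have "a \<in> J'" using nzdJ' adj_superset[of J m] J' by (auto simp: nzd_def)
    then obtain j b where jb: "j \<in> J" "b \<in> C" "a = j + b * m" using J' adjE by metis
    have "a * f - f * j \<in> J" using is_ideal_diff[OF J a(2) is_ideal_mult[OF J f jb(1)]] .
    then have "b * f * m \<in> J" by (simp add: jb algebra_simps)
    then have "b * f \<in> P" using P[of "b * f"] jb f mem by auto
    then have "b \<in> P" using nzdP jb by (auto simp: nzd_def)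
    then show "a \<in> J" using P[of b] jb J by (auto simp: is_ideal_add)
  qed
  moreover have "rseq (adj J f) fs"
  proof (rule Cons.IH)
    show "is_ideal (adj J f)" "is_ideal (adj P f)" using J f Cons.prems(5) by (auto simp: is_ideal_adj)
    show "adj J' f = adj (adj J f) m" by (simp add: J' adj_commute)
    show "rseq (adj J' f) fs" "rseq (adj P f) fs" using Cons.prems(7,8) by auto
    \<comment> \<open>The sequence stays exact modulo \<open>f\<close>, because \<open>f\<close> is
      a nonzerodivisor on the cokernel \<open>C/J'\<close>.\<close>
    fix b assume b: "b \<in> C"
    show "b * m \<in> adj J f \<longleftrightarrow> b \<in> adj P f"
    proof
      assume "b * m \<in> adj J f"
      then obtain j c where jc: "j \<in> J" "c \<in> C" "b * m = j + c * f" by (rule adjE)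
      have "b * m - j \<in> J'" using J' jc b J adjI[of "- j" J b m] by (simp add: is_ideal_uminus)
      then have "c * f \<in> J'" using jc by simp
      then have "c \<in> J'" using nzdJ' jc by (auto simp: nzd_def)
      then obtain j' e where je: "j' \<in> J" "e \<in> C" "c = j' + e * m" using J' adjE by metis
      have "j + f * j' \<in> J" using J jc je f by (intro is_ideal_add is_ideal_mult) auto
      then have "(b - e * f) * m \<in> J" using jc je by (simp add: algebra_simps)
      then have "b - e * f \<in> P" using P[of "b - e * f"] b je f mem by auto
      then show "b \<in> adj P f" using adjI[of "b - e * f" P e f] je by simp
    next
      assume "b \<in> adj P f"
      then obtain p c where pc: "p \<in> P" "c \<in> C" "b = p + c * f" by (rule adjE)
      then have "p * m \<in> J" using P[of p] Cons.prems(5) is_ideal_mem by blast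
      then have "p * m + (c * m) * f \<in> adj J f" using pc m by (intro adjI mem)
      then show "b * m \<in> adj J f" by (simp add: pc algebra_simps)
    qed
  qed (use Cons.prems in auto)
  ultimately show ?case by simp
qed simp

section \<open>Prime ideals and prime avoidance\<close>

definition prime_idl :: "'a set \<Rightarrow> bool" where
  "prime_idl P \<longleftrightarrow> is_ideal P \<and> 1 \<notin> P \<and> (\<forall>a\<in>C. \<forall>b\<in>C. a * b \<in> P \<longrightarrow> a \<in> P \<or> b \<in> P)"

lemma prime_idlD:
  assumes "prime_idl P"
  shows prime_idl_ideal: "is_ideal P" and prime_idl_one: "1 \<notin> P"
    and prime_idl_mult: "a \<in> C \<Longrightarrow> b \<in> C \<Longrightarrow> a * b \<in> P \<Longrightarrow> a \<in> P \<or> b \<in> P"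
  using assms by (auto simp: prime_idl_def)

text \<open>Multiply one element of each \<open>Q b\<close> outside \<open>P\<close>; primality
  keeps the product outside \<open>P\<close>.\<close>

lemma prime_idl_intersection:
  assumes "prime_idl P" "finite B" "\<And>b. b \<in> B \<Longrightarrow> is_ideal (Q b)" "\<And>b. b \<in> B \<Longrightarrow> \<not> Q b \<subseteq> P"
  shows "\<exists>c\<in>C. c \<notin> P \<and> (\<forall>b\<in>B. c \<in> Q b)"
  using assms(2-)
proof (induction B rule: finite_induct)
  case empty
  then show ?case using prime_idl_one[OF assms(1)] mem by auto
next
  case (insert x B)
  then obtain c where c: "c \<in> C" "c \<notin> P" "\<forall>b\<in>B. c \<in> Q b" by auto
  obtain d where d: "d \<in> Q x" "d \<notin> P" using insert.prems(2)[of x] by auto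
  have dC: "d \<in> C" using d insert.prems(1)[of x] is_ideal_mem by auto
  have "c * d \<notin> P" using prime_idl_mult[OF assms(1)] c d dC by blast
  moreover have "\<forall>b\<in>insert x B. c * d \<in> Q b"
    using c d dC insert.prems(1) by (auto simp: is_ideal_mult is_ideal_mult_right)
  moreover have "c * d \<in> C" using c(1) dC by (rule mult_mem)
  ultimately show ?case by blast
qed

lemma prime_avoidance:
  assumes "is_ideal I" "finite \<P>" "\<And>P. P \<in> \<P> \<Longrightarrow> prime_idl P" "\<And>P. P \<in> \<P> \<Longrightarrow> \<not> I \<subseteq> P"
  shows "\<exists>z\<in>I. \<forall>P\<in>\<P>. z \<notin> P"
  using assms(2-)
proof (induction "card \<P>" arbitrary: \<P>)
  case 0
  then show ?case using is_ideal_zero[OF assms(1)] by auto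
next
  case (Suc n)
  then obtain P \<R> where \<P>: "\<P> = insert P \<R>" "P \<notin> \<R>" "card \<R> = n" by (metis card_Suc_eq)
  have fin: "finite \<R>" using Suc.prems \<P> by auto
  have pP: "prime_idl P" using Suc.prems \<P> by auto
  obtain z where z: "z \<in> I" "\<forall>Q\<in>\<R>. z \<notin> Q"
    using Suc.hyps(1)[OF \<P>(3)[symmetric]] Suc.prems \<P> fin by auto
  show ?case
  proof (cases "\<exists>Q\<in>\<R>. Q \<subseteq> P")
    case True
    then obtain Q where Q: "Q \<in> \<R>" "Q \<subseteq> P" by auto
    have "n = card (insert P (\<R> - {Q}))" using \<P> Q fin card_Suc_Diff1[of \<R> Q] by simp
    then obtain w where w: "w \<in> I" "\<forall>R\<in>insert P (\<R> - {Q}). w \<notin> R"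
      using Suc.hyps(1)[of "insert P (\<R> - {Q})"] Suc.prems \<P> fin by auto
    then have "\<forall>R\<in>\<P>. w \<notin> R" using Q \<P> by auto
    then show ?thesis using w by blast
  next
    case False
    show ?thesis
    proof (cases "z \<in> P")
      case zP: True
      have "\<exists>c\<in>C. c \<notin> P \<and> (\<forall>b\<in>insert I \<R>. c \<in> id b)"
        using pP fin assms(1) False Suc.prems \<P> by (intro prime_idl_intersection) (auto dest: prime_idl_ideal)
      then obtain w where w: "w \<in> C" "w \<notin> P" "w \<in> I" "\<forall>Q\<in>\<R>. w \<in> Q" by auto
      have "w + z \<notin> P" using is_ideal_add_iff[OF prime_idl_ideal[OF pP] zP] w by auto
      moreover have "z + w \<notin> Q" if "Q \<in> \<R>" for Q
        using is_ideal_add_iff[of Q w z] that z w Suc.prems \<P> by (auto dest: prime_idl_ideal)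
      ultimately have "\<forall>Q\<in>\<P>. z + w \<notin> Q" using \<P> by (auto simp: add.commute)
      then show ?thesis using is_ideal_add[OF assms(1) z(1) w(3)] by blast
    qed (use z \<P> in auto)
  qed
qed

end

section \<open>Noetherian rings: associated primes, comparison of regular sequences, chains of
  primes\<close>

locale noetherian_subring = comm_subring +
  assumes finitely_generated: "is_ideal J \<Longrightarrow> \<exists>fs. set fs \<subseteq> J \<and> J = adjs {0} fs"
begin

text \<open>The union of a chain of ideals is generated by finitely many elements, and these already
  lie in one member of the chain.\<close>

lemma maximal_ideal_in_family:
  assumes "\<And>J. J \<in> \<S> \<Longrightarrow> is_ideal J" "\<S> \<noteq> {}"
  shows "\<exists>J\<in>\<S>. \<forall>K\<in>\<S>. J \<subseteq> K \<longrightarrow> K = J"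
proof (rule subset_Zorn_nonempty[OF assms(2)])
  fix \<C> assume \<C>: "\<C> \<noteq> {}" "subset.chain \<S> \<C>"
  have sub: "\<C> \<subseteq> \<S>" and tot: "\<And>B Y. B \<in> \<C> \<Longrightarrow> Y \<in> \<C> \<Longrightarrow> B \<subseteq> Y \<or> Y \<subseteq> B"
    using \<C>(2) by (auto simp: subset.chain_def)
  have "is_ideal (\<Union>\<C>)" unfolding is_ideal_def
  proof (intro conjI ballI)
    show "\<Union>\<C> \<subseteq> C" "0 \<in> \<Union>\<C>" using sub assms \<C>(1) is_ideal_zero is_ideal_mem by blast+
    show "a + b \<in> \<Union>\<C>" if ab: "a \<in> \<Union>\<C>" "b \<in> \<Union>\<C>" for a b
    proof -
      obtain B D where BD: "B \<in> \<C>" "a \<in> B" "D \<in> \<C>" "b \<in> D" using ab by blast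
      then have "is_ideal B" "is_ideal D" using sub assms by auto
      then show ?thesis using tot[OF BD(1,3)] BD is_ideal_add by blast
    qed
    show "c * a \<in> \<Union>\<C>" if "c \<in> C" "a \<in> \<Union>\<C>" for c a
      using that sub assms is_ideal_mult by blast
  qed
  then obtain fs where fs: "set fs \<subseteq> \<Union>\<C>" "\<Union>\<C> = adjs {0} fs" using finitely_generated by blast
  have "\<exists>B\<in>\<C>. set fs \<subseteq> B"
    using finite_subset_Union_chain[OF finite_set fs(1) \<C>(1,2)] by metis
  then obtain B where B: "B \<in> \<C>" "set fs \<subseteq> B" by auto
  then have "is_ideal B" using sub assms by auto
  then have "\<Union>\<C> \<subseteq> B" unfolding fs(2) using B by (intro adjs_least) (auto simp: is_ideal_zero)
  then have "\<Union>\<C> = B" using B by auto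
  then show "\<Union>\<C> \<in> \<S>" using B sub by auto
qed

text \<open>The primes are the maximal ones among the annihilators \<open>J : a\<close> with
  \<open>a \<notin> J\<close>. A zero divisor on \<open>C/J\<close> lies in some such annihilator
  and hence in a maximal one.\<close>

lemma associated_primes:
  assumes J: "is_ideal J"
  shows "\<exists>\<P>. finite \<P> \<and> (\<forall>P\<in>\<P>. prime_idl P) \<and> (\<forall>f\<in>C. nzd J f \<longleftrightarrow> (\<forall>P\<in>\<P>. f \<notin> P))"
proof -
  define col where "col a = {c \<in> C. c * a \<in> J}" for a
  have col_ideal: "is_ideal (col a)" if "a \<in> C" for a
    using J unfolding is_ideal_def col_def by (auto simp: mem distrib_right mult.assoc)
  have col_mono: "col a \<subseteq> col (c * a)" if "c \<in> C" for a c
  proof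
    fix b assume "b \<in> col a"
    then show "b \<in> col (c * a)" using is_ideal_mult[OF J that, of "b * a"] by (simp add: col_def mult_ac)
  qed
  define \<A> where "\<A> = col ` (C - J)"
  define \<P> where "\<P> = {P \<in> \<A>. \<forall>Q\<in>\<A>. P \<subseteq> Q \<longrightarrow> Q = P}"
  have prime: "prime_idl P" if P: "P \<in> \<P>" for P
  proof -
    obtain a where a: "a \<in> C" "a \<notin> J" "P = col a" using P by (auto simp: \<P>_def \<A>_def)
    have "b \<in> P" if bc: "b \<in> C" "c \<in> C" "b * c \<in> P" "c \<notin> P" for b c
    proof -
      have "c * a \<in> C - J" using bc a by (auto simp: col_def mem)
      \<comment> \<open>Passing from \<open>a\<close> to \<open>c * a\<close> can only enlarge the
        annihilator, so maximality gives equality.\<close>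
      then have "col (c * a) = P" using P col_mono[OF bc(2), of a] a by (auto simp: \<P>_def \<A>_def)
      moreover have "b \<in> col (c * a)" using bc a by (auto simp: col_def mult.assoc)
      ultimately show ?thesis by simp
    qed
    then show ?thesis using a col_ideal by (auto simp: prime_idl_def col_def)
  qed
  have nzd: "nzd J f \<longleftrightarrow> (\<forall>P\<in>\<P>. f \<notin> P)" if f: "f \<in> C" for f
  proof
    assume "nzd J f"
    then show "\<forall>P\<in>\<P>. f \<notin> P" by (auto simp: \<P>_def \<A>_def col_def nzd_def mult.commute)
  next
    assume *: "\<forall>P\<in>\<P>. f \<notin> P"
    show "nzd J f" unfolding nzd_def
    proof (intro ballI impI, rule ccontr)
      fix a assume a: "a \<in> C" "a * f \<in> J" "a \<notin> J"
      have "\<exists>B\<in>{B \<in> \<A>. col a \<subseteq> B}. \<forall>K\<in>{B \<in> \<A>. col a \<subseteq> B}. B \<subseteq> K \<longrightarrow> K = B"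
        by (rule maximal_ideal_in_family) (use a col_ideal in \<open>auto simp: \<A>_def\<close>)
      then obtain B where "B \<in> \<A>" "col a \<subseteq> B" "\<forall>K\<in>\<A>. col a \<subseteq> K \<longrightarrow> B \<subseteq> K \<longrightarrow> K = B" by auto
      then have "B \<in> \<P>" "f \<in> B" using a f by (auto simp: \<P>_def col_def mult.commute)
      then show False using * by auto
    qed
  qed
  \<comment> \<open>Finiteness: let the \<open>as\<close> generate, over \<open>J\<close>, a largest
    ideal among those generated by elements with annihilator in \<open>\<P>\<close>. If
    \<open>P = J : a\<close>, then \<open>a\<close> lies in this ideal, so whatever annihilates all
    the \<open>as\<close> lies in \<open>P\<close>; hence \<open>P\<close> contains one of their
    annihilators and equals it by maximality.\<close>
  define G where "G = {a \<in> C - J. col a \<in> \<P>}"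
  have "\<exists>B\<in>{adjs J as |as. set as \<subseteq> G}. \<forall>K\<in>{adjs J as |as. set as \<subseteq> G}. B \<subseteq> K \<longrightarrow> K = B"
    by (rule maximal_ideal_in_family)
      (use J in \<open>auto simp: G_def intro!: is_ideal_adjs exI[of _ "[]"]\<close>)
  then obtain as where as: "set as \<subseteq> G"
    and max': "\<forall>K\<in>{adjs J as |as. set as \<subseteq> G}. adjs J as \<subseteq> K \<longrightarrow> K = adjs J as" by blast
  have max: "adjs J bs = adjs J as" if "set bs \<subseteq> G" "adjs J as \<subseteq> adjs J bs" for bs
    using max' that by blast
  have "\<P> \<subseteq> col ` set as"
  proof
    fix P assume P: "P \<in> \<P>"
    then obtain a where a: "a \<in> C" "a \<notin> J" "P = col a" by (auto simp: \<P>_def \<A>_def)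
    have "adjs J (as @ [a]) = adjs J as"
      using as a P adj_superset by (intro max) (auto simp: G_def adjs_append)
    then have mem_a: "a \<in> adjs J as"
      using adj_self[OF is_ideal_adjs[OF J], of as a] as by (auto simp: adjs_append G_def)
    have "\<exists>b\<in>set as. col b \<subseteq> P"
    proof (rule ccontr)
      assume "\<not> ?thesis"
      then have "\<exists>c\<in>C. c \<notin> P \<and> (\<forall>b\<in>set as. c \<in> col b)"
        using as prime[OF P] by (intro prime_idl_intersection) (auto simp: G_def col_ideal)
      then obtain c where c: "c \<in> C" "c \<notin> P" "\<forall>b\<in>set as. c * b \<in> J" by (auto simp: col_def)
      have "c * a \<in> J" by (rule adjs_annihilated[OF J c(1) _ _ mem_a]) (use c J in \<open>auto simp: is_ideal_mult\<close>)
      then show False using c a by (auto simp: col_def)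
    qed
    then obtain b where b: "b \<in> set as" "col b \<subseteq> P" by auto
    then have "col b \<in> \<P>" using as by (auto simp: G_def)
    then have "P = col b" using b P by (auto simp: \<P>_def)
    then show "P \<in> col ` set as" using b by auto
  qed
  then have "finite \<P>" by (rule finite_subset) auto
  then show ?thesis using prime nzd by blast
qed

text \<open>Prime avoidance for all the finite sets of primes that detect zero divisors modulo the
  members of \<open>\<J>\<close>; a nonzerodivisor in \<open>I\<close> shows that \<open>I\<close>
  lies in none of these primes.\<close>

lemma common_nzd:
  assumes "is_ideal I" "finite \<J>" "\<And>J. J \<in> \<J> \<Longrightarrow> is_ideal J \<and> (\<exists>f\<in>I. nzd J f)"
  shows "\<exists>z\<in>I. \<forall>J\<in>\<J>. nzd J z"
proof -
  have "\<forall>J\<in>\<J>. \<exists>\<P>. finite \<P> \<and> (\<forall>P\<in>\<P>. prime_idl P) \<and> (\<forall>f\<in>C. nzd J f \<longleftrightarrow> (\<forall>P\<in>\<P>. f \<notin> P))"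
    using associated_primes assms(3) by blast
  then obtain \<P> where \<P>: "\<And>J. J \<in> \<J> \<Longrightarrow> finite (\<P> J)" "\<And>J P. J \<in> \<J> \<Longrightarrow> P \<in> \<P> J \<Longrightarrow> prime_idl P"
    "\<And>J f. J \<in> \<J> \<Longrightarrow> f \<in> C \<Longrightarrow> nzd J f \<longleftrightarrow> (\<forall>P\<in>\<P> J. f \<notin> P)" by metis
  have "\<exists>z\<in>I. \<forall>P\<in>\<Union>(\<P> ` \<J>). z \<notin> P"
  proof (rule prime_avoidance[OF assms(1)])
    fix P assume "P \<in> \<Union>(\<P> ` \<J>)"
    then obtain J where J: "J \<in> \<J>" "P \<in> \<P> J" by auto
    obtain f where "f \<in> I" "nzd J f" using assms(3)[OF J(1)] by auto
    then show "\<not> I \<subseteq> P" using \<P>(3)[OF J(1)] J assms(1) is_ideal_mem by blast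
  qed (use \<P> assms in auto)
  then show ?thesis using \<P> assms(1) is_ideal_mem by (metis UN_iff)
qed

text \<open>The half of the exchange of \<open>x\<close> and \<open>z\<close> that holds in any
  ring. The other half, that \<open>z\<close> is a nonzerodivisor modulo \<open>J\<close>, may fail
  outside local rings; \<open>rseq_adj_front\<close> therefore assumes it at every stage.\<close>

lemma nzd_adj_swap:
  assumes "is_ideal J" "x \<in> C" "z \<in> C" "nzd J x" "nzd (adj J x) z"
  shows "nzd (adj J z) x"
  unfolding nzd_def
proof (intro ballI impI)
  fix a assume a: "a \<in> C" "a * x \<in> adj J z"
  then obtain j b where jb: "j \<in> J" "b \<in> C" "a * x = j + b * z" by (meson adjE)
  then have "b * z = - j + a * x" by simp
  then have "b * z \<in> adj J x" using adjI[of "- j" J a x] a jb assms(1) by (simp add: is_ideal_uminus)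
  then have "b \<in> adj J x" using assms(5) jb by (auto simp: nzd_def)
  then obtain j' c where jc: "j' \<in> J" "c \<in> C" "b = j' + c * x" by (meson adjE)
  have "j + z * j' \<in> J" using assms jb jc by (intro is_ideal_add is_ideal_mult) auto
  then have "(a - c * z) * x \<in> J" using jb jc by (simp add: algebra_simps)
  then have "a - c * z \<in> J" using assms(4) a jc assms(3) mem by (auto simp: nzd_def)
  then show "a \<in> adj J z" using adjI[of "a - c * z" J c z] jc by simp
qed

lemma rseq_adj_front:
  assumes "is_ideal J" "set xs \<subseteq> C" "z \<in> C" "rseq J xs"
    and "\<And>i. i \<le> length xs \<Longrightarrow> nzd (adjs J (take i xs)) z"
  shows "rseq (adj J z) xs"
  using assms
proof (induction xs arbitrary: J)
  case (Cons x xs)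
  have "nzd (adj J x) z" using Cons.prems(5)[of 1] by simp
  then have "nzd (adj J z) x" using Cons.prems(1-4) by (intro nzd_adj_swap[of J x z]) simp_all
  moreover have "rseq (adj (adj J x) z) xs"
  proof (rule Cons.IH)
    show "nzd (adjs (adj J x) (take i xs)) z" if "i \<le> length xs" for i
      using Cons.prems(5)[of "Suc i"] that by simp
  qed (use Cons.prems in \<open>auto simp: is_ideal_adj\<close>)
  ultimately show ?case by (simp add: adj_commute)
qed simp

text \<open>In homological terms \<open>Hom(C/I, C/(J + xs))\<close> is \<open>Ext^n(C/I, C/J)\<close>, which vanishes when
  \<open>I\<close> contains a longer regular sequence. A common nonzerodivisor \<open>z\<close> for all the intermediate
  quotients is moved to the front of both sequences.\<close>

theorem rseq_length_le_socle:
  assumes "is_ideal I" "is_ideal J" "set xs \<subseteq> I" "set ys \<subseteq> I" "rseq J xs" "rseq J ys"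
    and "u \<in> C" "u \<notin> adjs J xs" "\<And>i. i \<in> I \<Longrightarrow> i * u \<in> adjs J xs"
  shows "length ys \<le> length xs"
  using assms(2-)
proof (induction xs arbitrary: J ys u rule: rev_induct)
  case Nil
  show ?case
  proof (cases ys)
    case (Cons y ys')
    then have "u * y \<in> J" using Nil.prems(8)[of y] Nil.prems(3) by (simp add: mult.commute)
    then show ?thesis using Nil Cons by (auto simp: nzd_def)
  qed simp
next
  case (snoc x xs)
  show ?case
  proof (cases ys rule: rev_cases)
    case (snoc ys' y)
    note J = snoc.prems(1)
    have IC: "I \<subseteq> C" using assms(1) is_ideal_subset by auto
    have sub: "set xs \<subseteq> C" "set ys' \<subseteq> C" "x \<in> I" "y \<in> I" "x \<in> C" "y \<in> C" "set xs \<subseteq> I" "set ys' \<subseteq> I"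
      using snoc.prems snoc IC by auto
    \<comment> \<open>The quotients that the two sequences pass through before their last entries.
      Each has a nonzerodivisor in \<open>I\<close>, namely the next entry of its sequence.\<close>
    define \<J> where "\<J> = (\<lambda>i. adjs J (take i xs)) ` {..length xs} \<union> (\<lambda>i. adjs J (take i ys')) ` {..length ys'}"
    have nth: "nzd (adjs J (take i zs)) ((zs @ [w]) ! i)" if "rseq J (zs @ [w])" "i \<le> length zs" for i zs w
      using that unfolding rseq_iff_nth by (auto simp: less_Suc_eq_le)
    have "\<exists>z\<in>I. \<forall>K\<in>\<J>. nzd K z"
    proof (rule common_nzd[OF assms(1)])
      show "finite \<J>" by (auto simp: \<J>_def)
      fix K assume "K \<in> \<J>"
      then consider i where "i \<le> length xs" "K = adjs J (take i xs)"
        | i where "i \<le> length ys'" "K = adjs J (take i ys')" by (auto simp: \<J>_def)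
      then show "is_ideal K \<and> (\<exists>f\<in>I. nzd K f)"
      proof cases
        case 1
        have "(xs @ [x]) ! i \<in> I" using 1 sub by (auto simp: nth_append dest: nth_mem)
        moreover have "is_ideal K" unfolding 1 using J sub set_take_subset[of i xs] by (intro is_ideal_adjs) auto
        ultimately show ?thesis using nth[OF snoc.prems(4) 1(1)] 1 by auto
      next
        case 2
        have "(ys' @ [y]) ! i \<in> I" using 2 sub by (auto simp: nth_append dest: nth_mem)
        moreover have "is_ideal K" unfolding 2 using J sub set_take_subset[of i ys'] by (intro is_ideal_adjs) auto
        ultimately show ?thesis using nth[of ys' y i] snoc.prems(5) snoc 2 by auto
      qed
    qed
    then obtain z where z: "z \<in> I" "\<And>i. i \<le> length xs \<Longrightarrow> nzd (adjs J (take i xs)) z"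
      "\<And>i. i \<le> length ys' \<Longrightarrow> nzd (adjs J (take i ys')) z" by (auto simp: \<J>_def)
    have zC: "z \<in> C" using z IC by auto
    define K where "K = adjs J xs"
    have K: "is_ideal K" using J sub by (simp add: K_def is_ideal_adjs)
    have nz: "nzd K z" using z(2)[of "length xs"] by (simp add: K_def)
    have nx: "nzd K x" using snoc.prems(4) by (simp add: rseq_append K_def)
    have u: "u \<in> C" "u \<notin> adj K x" "\<And>i. i \<in> I \<Longrightarrow> i * u \<in> adj K x"
      using snoc.prems by (auto simp: adjs_append K_def)
    \<comment> \<open>Passing from \<open>u\<close> to \<open>w\<close> realizes the isomorphism
      between the elements killed by \<open>I\<close> in \<open>C/(K + x)\<close> and in
      \<open>C/(K + z)\<close>, so the socle element survives the exchange of \<open>x\<close> for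
      \<open>z\<close>.\<close>
    obtain j w where jw: "j \<in> K" "w \<in> C" "z * u = j + w * x" using u(3)[OF z(1)] by (rule adjE)
    have w1: "w \<notin> adj K z"
    proof
      assume "w \<in> adj K z"
      then obtain j' c where jc: "j' \<in> K" "c \<in> C" "w = j' + c * z" by (rule adjE)
      have "j + x * j' \<in> K" using K jw jc sub by (intro is_ideal_add is_ideal_mult) auto
      then have "(u - c * x) * z \<in> K" using jw jc by (simp add: algebra_simps)
      then have "u - c * x \<in> K" using nz u jc sub mem by (auto simp: nzd_def)
      then show False using adjI[of "u - c * x" K c x] jc u by simp
    qed
    have w2: "i * w \<in> adj K z" if i: "i \<in> I" for i
    proof -
      have iC: "i \<in> C" using i IC by auto
      obtain k c where kc: "k \<in> K" "c \<in> C" "i * u = k + c * x" using u(3)[OF i] by (rule adjE)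
      have "z * k - i * j \<in> K" using K jw kc iC zC by (intro is_ideal_diff is_ideal_mult) auto
      moreover have "z * (k + c * x) = i * (j + w * x)"
        using jw kc by (metis mult.left_commute)
      then have "(i * w - c * z) * x = z * k - i * j" by (simp add: algebra_simps)
      ultimately have "(i * w - c * z) * x \<in> K" by simp
      then have "i * w - c * z \<in> K" using nx iC jw kc zC mem by (auto simp: nzd_def)
      then show ?thesis using adjI[of "i * w - c * z" K c z] kc by simp
    qed
    have "length ys' \<le> length xs"
    proof (rule snoc.IH)
      show "is_ideal (adj J z)" using J zC by (rule is_ideal_adj)
      show "rseq (adj J z) xs" "rseq (adj J z) ys'"
        using J sub zC z snoc.prems snoc by (auto simp: rseq_append intro!: rseq_adj_front)
      show "w \<in> C" "w \<notin> adjs (adj J z) xs" "\<And>i. i \<in> I \<Longrightarrow> i * w \<in> adjs (adj J z) xs"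
        using jw w1 w2 by (auto simp: adjs_adj K_def)
    qed (use sub in auto)
    then show ?thesis using snoc by simp
  qed simp
qed

text \<open>An ideal maximal among those that contain \<open>J\<close> and avoid the multiplicative
  set \<open>S\<close> is prime.\<close>

lemma prime_disjoint:
  assumes "is_ideal J" "1 \<in> S" "S \<subseteq> C" "\<And>s t. s \<in> S \<Longrightarrow> t \<in> S \<Longrightarrow> s * t \<in> S" "J \<inter> S = {}"
  shows "\<exists>P. prime_idl P \<and> J \<subseteq> P \<and> P \<inter> S = {}"
proof -
  define \<S> where "\<S> = {K. is_ideal K \<and> J \<subseteq> K \<and> K \<inter> S = {}}"
  have "\<exists>P\<in>\<S>. \<forall>K\<in>\<S>. P \<subseteq> K \<longrightarrow> K = P"
    by (rule maximal_ideal_in_family) (use assms in \<open>auto simp: \<S>_def\<close>)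
  then obtain P where "P \<in> \<S>" and max': "\<forall>K\<in>\<S>. P \<subseteq> K \<longrightarrow> K = P" by auto
  then have P: "is_ideal P" "J \<subseteq> P" "P \<inter> S = {}" by (auto simp: \<S>_def)
  have max: "K = P" if "is_ideal K" "P \<subseteq> K" "K \<inter> S = {}" for K
    using max' that P(2) by (simp add: \<S>_def)
  have meets: "\<exists>s\<in>S. \<exists>p\<in>P. \<exists>c\<in>C. s = p + c * a" if a: "a \<in> C" "a \<notin> P" for a
  proof -
    have "adj P a \<inter> S \<noteq> {}"
      using max[OF is_ideal_adj[OF P(1) a(1)] adj_superset] adj_self[OF P(1), of a] a by auto
    then show ?thesis by (auto simp: adj_def)
  qed
  have "a \<in> P \<or> b \<in> P" if ab: "a \<in> C" "b \<in> C" "a * b \<in> P" for a b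
  proof (rule ccontr)
    assume "\<not> ?thesis"
    then obtain s p c t q d where st: "s \<in> S" "p \<in> P" "c \<in> C" "s = p + c * a"
      "t \<in> S" "q \<in> P" "d \<in> C" "t = q + d * b" using meets ab by metis
    have "t * p + (c * a) * q + (c * d) * (a * b) \<in> P"
      using P(1) st ab assms(3) by (auto simp: mem intro!: is_ideal_add[OF P(1)] is_ideal_mult[OF P(1)])
    then have "s * t \<in> P" by (simp add: st algebra_simps)
    then show False using assms(4)[OF st(1) st(5)] P by auto
  qed
  then have "prime_idl P" using P assms(2) by (auto simp: prime_idl_def)
  then show ?thesis using P by auto
qed

text \<open>The products \<open>s * f ^ k\<close> with \<open>s \<notin> P\<close> form a
  multiplicative set that avoids \<open>J\<close>, since \<open>f\<close> can be cancelled modulo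
  \<open>J\<close> and \<open>J \<subseteq> P\<close>. A prime over \<open>J\<close> avoiding this
  set is contained in \<open>P\<close> and misses \<open>f\<close>.\<close>

lemma prime_below_nzd:
  assumes J: "is_ideal J" and P: "prime_idl P" "J \<subseteq> P" "f \<in> P" and nz: "nzd J f"
  shows "\<exists>Q. prime_idl Q \<and> J \<subseteq> Q \<and> Q \<subset> P"
proof -
  note idP = prime_idl_ideal[OF P(1)]
  have fC: "f \<in> C" using P(3) idP is_ideal_mem by auto
  have powC: "f ^ k \<in> C" for k by (induction k) (auto simp: mem fC)
  have nzk: "a \<in> J" if "a \<in> C" "a * f ^ k \<in> J" for a k
    using that
  proof (induction k)
    case (Suc k)
    then have "(a * f ^ k) * f \<in> J" by (simp add: mult_ac)
    then show ?case using Suc nz powC by (auto simp: nzd_def mem)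
  qed simp
  define S where "S = {s * f ^ k |s k. s \<in> C \<and> s \<notin> P}"
  have 1: "1 \<in> S" unfolding S_def using prime_idl_one[OF P(1)] one_mem by (auto intro!: exI[of _ "1 :: 'a"] exI[of _ "0 :: nat"])
  have "\<exists>Q. prime_idl Q \<and> J \<subseteq> Q \<and> Q \<inter> S = {}"
  proof (rule prime_disjoint[OF J 1])
    show "S \<subseteq> C" using powC by (auto simp: S_def mem)
    show "J \<inter> S = {}" using nzk P by (auto simp: S_def)
    fix s t assume "s \<in> S" "t \<in> S"
    then obtain a k b l where "s = a * f ^ k" "t = b * f ^ l" "a \<in> C" "a \<notin> P" "b \<in> C" "b \<notin> P"
      by (auto simp: S_def)
    then have "s * t = (a * b) * f ^ (k + l)" "a * b \<in> C" "a * b \<notin> P"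
      using prime_idl_mult[OF P(1)] by (auto simp: power_add mult_ac mem)
    then show "s * t \<in> S" unfolding S_def by blast
  qed
  then obtain Q where Q: "prime_idl Q" "J \<subseteq> Q" "Q \<inter> S = {}" by auto
  have "Q \<subseteq> P"
  proof
    fix a assume a: "a \<in> Q"
    then have "a \<in> C" using Q prime_idl_ideal is_ideal_mem by blast
    moreover have "a * f ^ 0 \<notin> S" using a Q by auto
    ultimately show "a \<in> P" unfolding S_def by blast
  qed
  moreover have "1 * f ^ 1 \<in> S" unfolding S_def using prime_idl_one[OF P(1)] mem by blast
  then have "f \<notin> Q" using Q by auto
  ultimately show ?thesis using Q P by blast
qed

text \<open>The last entry is a nonzerodivisor modulo the others, so \<open>prime_below_nzd\<close>
  gives a smaller prime that still contains the others. This yields depth \<le> height.\<close>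

lemma prime_chain_of_rseq:
  assumes "is_ideal J" "prime_idl P" "J \<subseteq> P" "set fs \<subseteq> P" "rseq J fs"
  shows "\<exists>Ps. length Ps = Suc (length fs) \<and> (\<forall>Q\<in>set Ps. prime_idl Q \<and> J \<subseteq> Q)
    \<and> sorted_wrt (\<subset>) Ps \<and> last Ps = P"
  using assms(2-)
proof (induction fs arbitrary: P rule: rev_induct)
  case Nil
  then show ?case by (auto intro!: exI[of _ "[P]"])
next
  case (snoc f fs)
  note idP = prime_idl_ideal[OF snoc.prems(1)]
  have sub: "set fs \<subseteq> C" using snoc.prems(3) is_ideal_subset[OF idP] by auto
  have "\<exists>Q. prime_idl Q \<and> adjs J fs \<subseteq> Q \<and> Q \<subset> P"
  proof (rule prime_below_nzd)
    show "is_ideal (adjs J fs)" using assms(1) sub by (rule is_ideal_adjs)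
    show "adjs J fs \<subseteq> P" using idP snoc.prems by (intro adjs_least) auto
  qed (use snoc.prems in \<open>auto simp: rseq_append\<close>)
  then obtain Q where Q: "prime_idl Q" "adjs J fs \<subseteq> Q" "Q \<subset> P" by auto
  have "J \<subseteq> Q" using Q adjs_superset by blast
  moreover have "set fs \<subseteq> Q" using Q adjs_set[OF assms(1) sub] by blast
  ultimately obtain Ps where Ps: "length Ps = Suc (length fs)" "\<forall>Q\<in>set Ps. prime_idl Q \<and> J \<subseteq> Q"
    "sorted_wrt (\<subset>) Ps" "last Ps = Q" using snoc.IH[OF Q(1)] snoc.prems by (auto simp: rseq_append)
  have "B \<subset> P" if "B \<in> set Ps" for B
  proof -
    have "Ps \<noteq> []" using Ps(1) by auto
    then have "B = Q \<or> B \<subset> Q"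
      using Ps(3,4) that by (induction Ps rule: rev_induct) (auto simp: sorted_wrt_append)
    then show ?thesis using Q(3) by auto
  qed
  then show ?case using Ps snoc.prems by (intro exI[of _ "Ps @ [P]"]) (auto simp: sorted_wrt_append)
qed

end

section \<open>Cohen--Macaulay quotients\<close>

context comm_subring
begin

definition as_ring :: "'a ring" where
  "as_ring = ring_of_type_algebra\<lparr>carrier := C\<rparr>"

lemma as_ring_simps [simp]:
  "carrier as_ring = C" "a \<otimes>\<^bsub>as_ring\<^esub> b = a * b" "a \<oplus>\<^bsub>as_ring\<^esub> b = a + b"
  "\<one>\<^bsub>as_ring\<^esub> = 1" "\<zero>\<^bsub>as_ring\<^esub> = 0"
  by (simp_all add: as_ring_def ring_of_type_algebra_def)

lemma cring_as_ring: "cring as_ring"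
proof (rule cringI)
  show "abelian_group as_ring"
    by (rule abelian_groupI) (auto simp: mem algebra_simps intro!: bexI[of _ "- _"])
  show "comm_monoid as_ring"
    by (rule comm_monoidI) (auto simp: mem algebra_simps)
qed (auto simp: algebra_simps)

lemma ideal_as_ring_iff: "ideal K as_ring \<longleftrightarrow> is_ideal K"
proof
  interpret cring as_ring by (rule cring_as_ring)
  assume "ideal K as_ring"
  then interpret ideal K as_ring .
  show "is_ideal K" unfolding is_ideal_def
    using a_closed zero_closed I_l_closed a_subset by auto
next
  interpret cring as_ring by (rule cring_as_ring)
  assume K: "is_ideal K"
  have "a_inv as_ring a = - a" if "a \<in> C" for a
    using that by (intro minus_equality) (auto simp: mem)
  then have "inv\<^bsub>add_monoid as_ring\<^esub> a \<in> K" if "a \<in> K" for a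
    using that K unfolding a_inv_def[symmetric] by (simp add: is_ideal_uminus is_ideal_mem)
  then have "subgroup K (add_monoid as_ring)"
    using K by (intro subgroup.intro) (simp_all add: is_ideal_subset is_ideal_add is_ideal_zero)
  then show "ideal K as_ring"
    using K ring_axioms
    by (intro idealI) (simp_all add: is_ideal_mult is_ideal_mult_right)
qed

end

locale quotient_subring = comm_subring +
  fixes J
  assumes J: "is_ideal J"
begin

definition cls :: "'a \<Rightarrow> 'a set" where
  "cls a = J +>\<^bsub>as_ring\<^esub> a"

definition Q :: "'a set ring" where
  "Q = as_ring Quot J"

sublocale S: cring as_ring by (rule cring_as_ring)

sublocale J: ideal J as_ring using J by (simp add: ideal_as_ring_iff)

sublocale cls: ring_hom_cring as_ring Q cls
  unfolding Q_def cls_def using J.rcos_ring_hom_cring[OF cring_as_ring] .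

lemma cls_simps:
  assumes "a \<in> C" "b \<in> C"
  shows "cls (a + b) = cls a \<oplus>\<^bsub>Q\<^esub> cls b" "cls (a * b) = cls a \<otimes>\<^bsub>Q\<^esub> cls b"
  using cls.hom_add[of a b] cls.hom_mult[of a b] assms by auto

lemma cls_zero_one: "cls 0 = \<zero>\<^bsub>Q\<^esub>" "cls 1 = \<one>\<^bsub>Q\<^esub>"
  using cls.hom_zero cls.hom_one by auto

lemma cls_closed: "a \<in> C \<Longrightarrow> cls a \<in> carrier Q"
  using cls.hom_closed by auto

lemma carrier_Q: "carrier Q = cls ` C"
  unfolding Q_def cls_def FactRing_def A_RCOSETS_defs a_r_coset_def by auto

lemma cls_eq_iff: "a \<in> C \<Longrightarrow> b \<in> C \<Longrightarrow> cls a = cls b \<longleftrightarrow> a - b \<in> J"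
proof -
  have cls: "cls a = {j + a |j. j \<in> J}" for a
    by (auto simp: cls_def a_r_coset_def')
  assume ab: "a \<in> C" "b \<in> C"
  show ?thesis
  proof
    assume "cls a = cls b"
    then have "a \<in> cls b" using is_ideal_zero[OF J] unfolding cls by force
    then show "a - b \<in> J" by (auto simp: cls)
  next
    assume *: "a - b \<in> J"
    have "j + a \<in> cls b" if "j \<in> J" for j
      using is_ideal_add[OF J that *] unfolding cls by (auto intro!: exI[of _ "j + (a - b)"])
    moreover have "j + b \<in> cls a" if "j \<in> J" for j
      using is_ideal_diff[OF J that *] unfolding cls by (auto intro!: exI[of _ "j - (a - b)"])
    ultimately show "cls a = cls b" unfolding cls by auto
  qed
qed

lemma cls_mem_image_iff:
  assumes "is_ideal K" "J \<subseteq> K" "a \<in> C"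
  shows "cls a \<in> cls ` K \<longleftrightarrow> a \<in> K"
proof
  assume "cls a \<in> cls ` K"
  then obtain b where b: "b \<in> K" "cls a = cls b" by auto
  then have "a - b \<in> J" using cls_eq_iff assms is_ideal_mem by auto
  then show "a \<in> K" using is_ideal_add[OF assms(1) b(1), of "a - b"] assms(2) by auto
qed auto

lemma cls_image_subset_iff:
  assumes "is_ideal K" "J \<subseteq> K" "is_ideal L" "J \<subseteq> L"
  shows "cls ` K \<subseteq> cls ` L \<longleftrightarrow> K \<subseteq> L"
  using cls_mem_image_iff[OF assms(3,4)] is_ideal_mem[OF assms(1)] by blast

lemma cls_image_psubset_iff:
  assumes "is_ideal K" "J \<subseteq> K" "is_ideal L" "J \<subseteq> L"
  shows "cls ` K \<subset> cls ` L \<longleftrightarrow> K \<subset> L"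
  using cls_image_subset_iff[OF assms] cls_image_subset_iff[OF assms(3,4,1,2)]
  by (auto simp: psubset_eq)

text \<open>Ideals of \<open>Q\<close> are studied through their preimages, the ideals of the
  subring that contain \<open>J\<close>.\<close>

definition pre :: "'a set set \<Rightarrow> 'a set" where
  "pre N = {a \<in> C. cls a \<in> N}"

lemma pre_ideal:
  assumes "ideal N Q"
  shows "is_ideal (pre N)" "J \<subseteq> pre N" "N = cls ` pre N"
proof -
  interpret N: ideal N Q by fact
  show "is_ideal (pre N)"
    unfolding is_ideal_def pre_def
    by (auto simp: mem cls_simps cls_zero_one N.a_closed N.zero_closed N.I_l_closed cls_closed)
  show "J \<subseteq> pre N"
  proof
    fix j assume "j \<in> J"
    then have "cls j = cls 0" "j \<in> C"
      using J mem by (auto simp: cls_eq_iff is_ideal_mem)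
    then show "j \<in> pre N" by (auto simp: pre_def cls_zero_one N.zero_closed)
  qed
  show "N = cls ` pre N"
    using N.a_subset carrier_Q by (auto simp: pre_def)
qed

lemma cls_ideal:
  assumes "is_ideal K" shows "ideal (cls ` K) Q"
proof -
  show ?thesis
  proof (rule idealI)
    show "ring Q" by (rule cls.S.ring_axioms)
    have inv: "a_inv Q (cls a) = cls (- a)" if "a \<in> C" for a
      using that by (intro cls.S.minus_equality)
        (auto simp: cls_closed mem cls_zero_one simp flip: cls_simps)
    show "subgroup (cls ` K) (add_monoid Q)"
    proof (rule subgroup.intro)
      show "cls ` K \<subseteq> carrier (add_monoid Q)"
        using assms by (auto simp: cls_closed dest: is_ideal_mem)
      show "\<one>\<^bsub>add_monoid Q\<^esub> \<in> cls ` K"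
        using is_ideal_zero[OF assms] cls_zero_one by force
      show "x \<otimes>\<^bsub>add_monoid Q\<^esub> y \<in> cls ` K" if xy: "x \<in> cls ` K" "y \<in> cls ` K" for x y
      proof -
        obtain a b where ab: "a \<in> K" "b \<in> K" "x = cls a" "y = cls b" using xy by blast
        then have "cls (a + b) \<in> cls ` K" using is_ideal_add[OF assms] by blast
        then show ?thesis using ab assms by (simp add: cls_simps is_ideal_mem)
      qed
      show "inv\<^bsub>add_monoid Q\<^esub> x \<in> cls ` K" if x: "x \<in> cls ` K" for x
      proof -
        obtain b where b: "b \<in> K" "x = cls b" using x by blast
        then have "cls (- b) \<in> cls ` K" using is_ideal_uminus[OF assms] by blast
        then show ?thesis
          unfolding a_inv_def[symmetric] b(2) using inv[of b] b(1) assms by (simp add: is_ideal_mem)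
      qed
    qed
    show "x \<otimes>\<^bsub>Q\<^esub> a \<in> cls ` K" if xy: "a \<in> cls ` K" "x \<in> carrier Q" for a x
    proof -
      obtain b c where bc: "b \<in> K" "c \<in> C" "a = cls b" "x = cls c" using xy carrier_Q by auto
      then have "cls (c * b) \<in> cls ` K" using is_ideal_mult[OF assms] by blast
      then show ?thesis using bc assms by (simp add: cls_simps is_ideal_mem)
    qed
    then show "a \<otimes>\<^bsub>Q\<^esub> x \<in> cls ` K" if xy: "a \<in> cls ` K" "x \<in> carrier Q" for a x
      using xy assms by (metis cls.S.m_comm carrier_Q image_mono is_ideal_subset subsetD)
  qed
qed

lemma ideal_Q_eq_carrier_iff:
  assumes "is_ideal K" "J \<subseteq> K" shows "cls ` K = carrier Q \<longleftrightarrow> 1 \<in> K"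
proof
  assume "cls ` K = carrier Q"
  then have "cls 1 \<in> cls ` K" using cls_closed one_mem by auto
  then show "1 \<in> K" using cls_mem_image_iff[OF assms] one_mem by auto
next
  assume "1 \<in> K"
  then show "cls ` K = carrier Q" using is_ideal_one[OF assms(1)] carrier_Q by auto
qed

lemma primeideal_Q_iff:
  assumes "is_ideal K" "J \<subseteq> K"
  shows "primeideal (cls ` K) Q \<longleftrightarrow> prime_idl K"
proof
  assume "primeideal (cls ` K) Q"
  then interpret P: primeideal "cls ` K" Q .
  show "prime_idl K" unfolding prime_idl_def
  proof (intro conjI ballI impI)
    show "1 \<notin> K" using P.I_notcarr ideal_Q_eq_carrier_iff[OF assms] by auto
    fix a b assume ab: "a \<in> C" "b \<in> C" "a * b \<in> K"
    then have "cls a \<otimes>\<^bsub>Q\<^esub> cls b \<in> cls ` K" by (auto simp flip: cls_simps)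
    then have "cls a \<in> cls ` K \<or> cls b \<in> cls ` K" using ab by (intro P.I_prime cls_closed)
    then show "a \<in> K \<or> b \<in> K" using ab assms cls_mem_image_iff by auto
  qed fact
next
  assume K: "prime_idl K"
  show "primeideal (cls ` K) Q"
  proof (rule primeidealI)
    show "ideal (cls ` K) Q" using assms(1) by (rule cls_ideal)
    show "cring Q" by (rule cls.S.cring_axioms)
    show "carrier Q \<noteq> cls ` K" using ideal_Q_eq_carrier_iff[OF assms] K by (auto simp: prime_idl_def)
    fix x y assume xy: "x \<in> carrier Q" "y \<in> carrier Q" "x \<otimes>\<^bsub>Q\<^esub> y \<in> cls ` K"
    then obtain a b where ab: "a \<in> C" "b \<in> C" "x = cls a" "y = cls b" using carrier_Q by auto
    then have "a * b \<in> K" using xy cls_mem_image_iff[OF assms, of "a * b"] by (auto simp: cls_simps mem)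
    then show "x \<in> cls ` K \<or> y \<in> cls ` K" using prime_idl_mult[OF K] ab by auto
  qed
qed

text \<open>An ideal strictly above \<open>K\<close> contains an element invertible modulo
  \<open>K\<close>, hence \<open>1\<close>. Maximality is used in this elementwise form
  throughout.\<close>

lemma maximalideal_Q:
  assumes "is_ideal K" "J \<subseteq> K" "1 \<notin> K" "\<And>a. a \<in> C \<Longrightarrow> a \<notin> K \<Longrightarrow> \<exists>b\<in>C. 1 - a * b \<in> K"
  shows "maximalideal (cls ` K) Q"
proof (rule maximalidealI)
  show "ideal (cls ` K) Q" using assms(1) by (rule cls_ideal)
  show "carrier Q \<noteq> cls ` K" using ideal_Q_eq_carrier_iff[OF assms(1,2)] assms(3) by auto
  fix N assume N: "ideal N Q" "cls ` K \<subseteq> N"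
  note pre = pre_ideal[OF N(1)]
  have "K \<subseteq> pre N"
    using N(2) pre cls_image_subset_iff[OF assms(1,2) pre(1,2)] by metis
  show "N = cls ` K \<or> N = carrier Q"
  proof (cases "pre N \<subseteq> K")
    case True
    then show ?thesis using \<open>K \<subseteq> pre N\<close> pre(3) by auto
  next
    case False
    then obtain a where a: "a \<in> pre N" "a \<notin> K" by auto
    have aC: "a \<in> C" using a pre(1) is_ideal_mem by auto
    obtain b where b: "b \<in> C" "1 - a * b \<in> K" using assms(4) a aC by auto
    have "(1 - a * b) + b * a \<in> pre N"
      using b a \<open>K \<subseteq> pre N\<close> by (intro is_ideal_add[OF pre(1)] is_ideal_mult[OF pre(1)]) auto
    then have "1 \<in> pre N" by (simp add: mult.commute)
    then show ?thesis using ideal_Q_eq_carrier_iff[OF pre(1,2)] pre(3) by auto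
  qed
qed

lemma maximalideal_QD:
  assumes "maximalideal N Q"
  shows "prime_idl (pre N)" "a \<in> C \<Longrightarrow> a \<notin> pre N \<Longrightarrow> \<exists>b\<in>C. 1 - a * b \<in> pre N"
proof -
  interpret N: maximalideal N Q by fact
  note pre = pre_ideal[OF N.ideal_axioms]
  show pr: "prime_idl (pre N)"
    using cls.S.maximalideal_prime[OF assms] primeideal_Q_iff[OF pre(1,2)] pre(3) by simp
  assume a: "a \<in> C" "a \<notin> pre N"
  define K where "K = adj (pre N) a"
  have K: "is_ideal K" "pre N \<subseteq> K" "a \<in> K"
    using is_ideal_adj[OF pre(1) a(1)] adj_superset adj_self[OF pre(1)] by (auto simp: K_def)
  then have JK: "J \<subseteq> K" using pre(2) by auto
  have "cls ` K = N \<or> cls ` K = carrier Q"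
    using cls_ideal[OF K(1)] image_mono[OF K(2), of cls] pre(3) is_ideal_mem[OF K(1)] cls_closed
    by (intro N.I_maximal) auto
  moreover have "cls ` K \<noteq> N"
    using K(3) a cls_mem_image_iff[OF pre(1,2)] pre(3) by auto
  ultimately have "1 \<in> K" using ideal_Q_eq_carrier_iff[OF K(1) JK] by auto
  then obtain j c where jc: "j \<in> pre N" "c \<in> C" "1 = j + c * a" unfolding K_def by (rule adjE)
  then have "1 - a * c = j" by (simp add: algebra_simps)
  then show "\<exists>b\<in>C. 1 - a * b \<in> pre N" using jc by auto
qed

lemma Idl_Q: 
  assumes "set fs \<subseteq> C" shows "Idl\<^bsub>Q\<^esub> (cls ` set fs) = cls ` adjs J fs"
proof
  note K = is_ideal_adjs[OF J assms]
  have sub: "cls ` set fs \<subseteq> carrier Q" using assms cls_closed by auto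
  show "Idl\<^bsub>Q\<^esub> (cls ` set fs) \<subseteq> cls ` adjs J fs"
    using cls_ideal[OF K] adjs_set[OF J assms] by (intro cls.S.genideal_minimal) auto
  note pre = pre_ideal[OF cls.S.genideal_ideal[OF sub]]
  have "set fs \<subseteq> pre (Idl\<^bsub>Q\<^esub> (cls ` set fs))"
    using cls.S.genideal_self[OF sub] assms by (auto simp: pre_def)
  then have "adjs J fs \<subseteq> pre (Idl\<^bsub>Q\<^esub> (cls ` set fs))"
    using pre(1,2) by (intro adjs_least)
  then show "cls ` adjs J fs \<subseteq> Idl\<^bsub>Q\<^esub> (cls ` set fs)" using pre(3) by auto
qed

lemma nzd_Q_iff:
  assumes "is_ideal K" "J \<subseteq> K" "f \<in> C"
  shows "(\<forall>a\<in>carrier Q. a \<otimes>\<^bsub>Q\<^esub> cls f \<in> cls ` K \<longrightarrow> a \<in> cls ` K) \<longleftrightarrow> nzd K f"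
  using assms cls_mem_image_iff[OF assms(1,2)]
  by (simp add: carrier_Q nzd_def mem flip: cls_simps)

text \<open>\<open>rseq\<close> does not ask for a proper ideal, so properness appears as
  \<open>1 \<notin> adjs J fs\<close>. For sequences inside a prime it is automatic, see
  \<open>ideal_depth_ge\<close>.\<close>

lemma regular_sequence_Q_iff:
  assumes "set fs \<subseteq> C"
  shows "regular_sequence Q (map cls fs) \<longleftrightarrow> rseq J fs \<and> 1 \<notin> adjs J fs"
proof -
  have "(\<forall>a\<in>carrier Q. a \<otimes>\<^bsub>Q\<^esub> (map cls fs ! i) \<in> Idl\<^bsub>Q\<^esub> (set (take i (map cls fs)))
      \<longrightarrow> a \<in> Idl\<^bsub>Q\<^esub> (set (take i (map cls fs)))) \<longleftrightarrow> nzd (adjs J (take i fs)) (fs ! i)"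
    if i: "i < length fs" for i
  proof -
    have sub: "set (take i fs) \<subseteq> C" using assms set_take_subset[of i fs] by auto
    have "Idl\<^bsub>Q\<^esub> (set (take i (map cls fs))) = cls ` adjs J (take i fs)"
      using Idl_Q[OF sub] by (simp add: take_map)
    then show ?thesis
      using nzd_Q_iff[OF is_ideal_adjs[OF J sub] adjs_superset, of "fs ! i"] i assms nth_mem[OF i]
      by (simp add: subset_iff)
  qed
  moreover have "Idl\<^bsub>Q\<^esub> (set (map cls fs)) \<noteq> carrier Q \<longleftrightarrow> 1 \<notin> adjs J fs"
    using Idl_Q[OF assms] ideal_Q_eq_carrier_iff[OF is_ideal_adjs[OF J assms] adjs_superset] by simp
  moreover have "set (map cls fs) \<subseteq> carrier Q" using assms cls_closed by auto
  ultimately show ?thesis unfolding regular_sequence_def rseq_iff_nth by simp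
qed

end

locale noetherian_quotient = quotient_subring + noetherian_subring
begin

lemma noetherian_Q: "noetherian_ring Q"
proof (rule cls.S.noetherian_ringI)
  fix N assume N: "ideal N Q"
  note pre = pre_ideal[OF N]
  obtain fs where fs: "set fs \<subseteq> pre N" "pre N = adjs {0} fs" using finitely_generated[OF pre(1)] by auto
  have sub: "set fs \<subseteq> C" using fs pre(1) is_ideal_subset by auto
  have "adjs J fs \<subseteq> pre N" using pre fs by (intro adjs_least)
  moreover have "pre N \<subseteq> adjs J fs"
    using adjs_mono[of "{0}" J fs] is_ideal_zero[OF J] fs by auto
  ultimately have "N = Idl\<^bsub>Q\<^esub> (cls ` set fs)" using Idl_Q[OF sub] pre(3) by simp
  then show "\<exists>A\<subseteq>carrier Q. finite A \<and> N = Idl\<^bsub>Q\<^esub> A"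
    using sub cls_closed by (intro exI[of _ "cls ` set fs"]) auto
qed

lemma prime_height_ge:
  assumes "length Ps = Suc r" "\<And>P. P \<in> set Ps \<Longrightarrow> prime_idl P \<and> J \<subseteq> P" "sorted_wrt (\<subset>) Ps"
  shows "enat r \<le> prime_height Q (cls ` last Ps)"
  unfolding prime_height_def
proof (intro Sup_upper CollectI exI conjI)
  show "length (map ((`) cls) Ps) = Suc r" using assms by simp
  show "\<forall>P\<in>set (map ((`) cls) Ps). primeideal P Q"
    using assms(2) primeideal_Q_iff prime_idl_ideal by auto
  have "Ps \<noteq> []" using assms(1) by auto
  then show "last (map ((`) cls) Ps) = cls ` last Ps" by (simp add: last_map)
  show "sorted_wrt (\<subset>) (map ((`) cls) Ps)"
    using assms(3) assms(2) prime_idl_ideal cls_image_psubset_iff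
    unfolding sorted_wrt_map by (rule_tac sorted_wrt_mono_rel[rotated]) auto
qed simp

lemma prime_height_le:
  assumes "\<And>Ps r. length Ps = Suc r \<Longrightarrow> (\<And>P. P \<in> set Ps \<Longrightarrow> prime_idl P \<and> J \<subseteq> P)
    \<Longrightarrow> sorted_wrt (\<subset>) Ps \<Longrightarrow> r \<le> d"
  shows "prime_height Q N \<le> enat d"
  unfolding prime_height_def
proof (rule Sup_least)
  fix x assume "x \<in> {enat r |r. \<exists>Ps. length Ps = Suc r \<and> (\<forall>J\<in>set Ps. primeideal J Q) \<and>
    sorted_wrt (\<subset>) Ps \<and> last Ps = N}"
  then obtain r Ps where Ps: "x = enat r" "length Ps = Suc r" "\<forall>J\<in>set Ps. primeideal J Q"
    "sorted_wrt (\<subset>) Ps" by auto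
  have pr: "prime_idl (pre P)" "J \<subseteq> pre P" "is_ideal (pre P)" "P = cls ` pre P" if "P \<in> set Ps" for P
  proof -
    have P: "primeideal P Q" using Ps that by auto
    note * = pre_ideal[OF primeideal.axioms(1)[OF P]]
    then show "J \<subseteq> pre P" "is_ideal (pre P)" "P = cls ` pre P" by auto
    show "prime_idl (pre P)" using primeideal_Q_iff[OF *(1,2)] *(3) P by simp
  qed
  have "r \<le> d"
  proof (rule assms)
    show "length (map pre Ps) = Suc r" using Ps by simp
    show "\<And>P. P \<in> set (map pre Ps) \<Longrightarrow> prime_idl P \<and> J \<subseteq> P" using pr by auto
    show "sorted_wrt (\<subset>) (map pre Ps)"
      unfolding sorted_wrt_map using Ps(4)
    proof (rule sorted_wrt_mono_rel[rotated])
      fix x y assume xy: "x \<in> set Ps" "y \<in> set Ps" "x \<subset> y"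
      have "cls ` pre x \<subset> cls ` pre y" using xy pr(4)[of x] pr(4)[of y] by simp
      then show "pre x \<subset> pre y" using cls_image_psubset_iff[of "pre x" "pre y"] pr xy by simp
    qed
  qed
  then show "x \<le> enat d" using Ps by simp
qed

lemma ideal_depth_ge:
  assumes "set fs \<subseteq> P" "prime_idl P" "J \<subseteq> P" "rseq J fs"
  shows "enat (length fs) \<le> ideal_depth Q (cls ` P)"
  unfolding ideal_depth_def
proof (intro Sup_upper CollectI exI conjI)
  note idP = prime_idl_ideal[OF assms(2)]
  show "enat (length fs) = enat (length (map cls fs))" by simp
  have "adjs J fs \<subseteq> P" using assms idP by (intro adjs_least)
  then show "regular_sequence Q (map cls fs)"
    using assms is_ideal_subset[OF idP] prime_idl_one[OF assms(2)]
    by (subst regular_sequence_Q_iff) auto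
  show "set (map cls fs) \<subseteq> cls ` P" using assms by auto
qed

lemma ideal_depth_le:
  assumes "is_ideal K" "J \<subseteq> K" "\<And>fs. set fs \<subseteq> K \<Longrightarrow> rseq J fs \<Longrightarrow> enat (length fs) \<le> d"
  shows "ideal_depth Q (cls ` K) \<le> d"
  unfolding ideal_depth_def
proof (rule Sup_least)
  fix x assume "x \<in> {enat (length xs) |xs. regular_sequence Q xs \<and> set xs \<subseteq> cls ` K}"
  then obtain xs where xs: "x = enat (length xs)" "regular_sequence Q xs" "set xs \<subseteq> cls ` K" by auto
  have "\<exists>fs. set fs \<subseteq> K \<and> xs = map cls fs"
    using xs(3)
  proof (induction xs)
    case (Cons y ys)
    then obtain fs f where "set fs \<subseteq> K" "ys = map cls fs" "f \<in> K" "y = cls f" by auto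
    then show ?case by (intro exI[of _ "f # fs"]) auto
  qed simp
  then obtain fs where fs: "set fs \<subseteq> K" "xs = map cls fs" by auto
  then have "rseq J fs" using xs(2) regular_sequence_Q_iff assms(1) is_ideal_subset by blast
  then show "x \<le> d" using assms(3) fs xs(1) by auto
qed

text \<open>The cycle \<open>d \<le> depth \<le> height \<le> d\<close>, with
  \<open>prime_chain_of_rseq\<close> for the middle inequality.\<close>

theorem Cohen_Macaulay_ring_Q:
  assumes dim: "\<And>Ps r. length Ps = Suc r \<Longrightarrow> (\<And>P. P \<in> set Ps \<Longrightarrow> prime_idl P \<and> J \<subseteq> P)
      \<Longrightarrow> sorted_wrt (\<subset>) Ps \<Longrightarrow> r \<le> d"
    and depth: "\<And>P. prime_idl P \<Longrightarrow> J \<subseteq> P \<Longrightarrow> (\<And>a. a \<in> C \<Longrightarrow> a \<notin> P \<Longrightarrow> \<exists>b\<in>C. 1 - a * b \<in> P)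
      \<Longrightarrow> \<exists>fs. length fs = d \<and> set fs \<subseteq> P \<and> rseq J fs"
  shows "Cohen_Macaulay_ring Q"
  unfolding Cohen_Macaulay_ring_def
proof (intro conjI allI impI)
  show "cring Q" by (rule cls.S.cring_axioms)
  show "noetherian_ring Q" by (rule noetherian_Q)
  fix N assume N: "maximalideal N Q"
  note pre = pre_ideal[OF maximalideal.axioms(1)[OF N]]
  note pr = maximalideal_QD(1)[OF N]
  obtain fs where fs: "length fs = d" "set fs \<subseteq> pre N" "rseq J fs"
    using depth[OF pr pre(2)] maximalideal_QD(2)[OF N] by auto
  have 1: "enat d \<le> ideal_depth Q N"
    using ideal_depth_ge[OF fs(2) pr pre(2) fs(3)] pre(3) fs(1) by simp
  have 2: "prime_height Q N \<le> enat d" by (rule prime_height_le) (use dim in blast)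
  have 3: "ideal_depth Q (cls ` pre N) \<le> prime_height Q N"
  proof (rule ideal_depth_le[OF pre(1,2)])
    fix gs assume gs: "set gs \<subseteq> pre N" "rseq J gs"
    obtain Ps where Ps: "length Ps = Suc (length gs)" "\<forall>P\<in>set Ps. prime_idl P \<and> J \<subseteq> P"
      "sorted_wrt (\<subset>) Ps" "last Ps = pre N"
      using prime_chain_of_rseq[OF J pr pre(2) gs] by auto
    show "enat (length gs) \<le> prime_height Q N"
      using prime_height_ge[OF Ps(1) _ Ps(3)] Ps pre(3) by simp
  qed
  then show "ideal_depth Q N = prime_height Q N"
    using 1 2 pre(3) by auto
qed

text \<open>The form that refutes the property at one maximal ideal: an explicit chain of primes
  bounds the height from below, and \<open>d\<close> bounds the depth from above.\<close>

theorem Cohen_Macaulay_ring_QD: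
  assumes "Cohen_Macaulay_ring Q" and P: "prime_idl P" "J \<subseteq> P"
    and max: "\<And>a. a \<in> C \<Longrightarrow> a \<notin> P \<Longrightarrow> \<exists>b\<in>C. 1 - a * b \<in> P"
    and "length Ps = Suc r" "\<And>P. P \<in> set Ps \<Longrightarrow> prime_idl P \<and> J \<subseteq> P" "sorted_wrt (\<subset>) Ps" "last Ps = P"
    and depth: "\<And>fs. set fs \<subseteq> P \<Longrightarrow> rseq J fs \<Longrightarrow> length fs \<le> d"
  shows "r \<le> d"
proof -
  note idP = prime_idl_ideal[OF P(1)]
  have "maximalideal (cls ` P) Q"
    using idP P max by (intro maximalideal_Q) (auto simp: prime_idl_one)
  then have "ideal_depth Q (cls ` P) = prime_height Q (cls ` P)"
    using assms(1) by (auto simp: Cohen_Macaulay_ring_def)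
  moreover have "enat r \<le> prime_height Q (cls ` P)"
    using prime_height_ge[OF assms(5,6,7)] assms(8) by simp
  moreover have "ideal_depth Q (cls ` P) \<le> enat d"
    using depth by (intro ideal_depth_le[OF idP P(2)]) auto
  ultimately have "enat r \<le> enat d" by (metis order_trans)
  then show ?thesis by simp
qed

end

section \<open>Leading exponents\<close>

abbreviation lookup :: "('a \<Rightarrow>\<^sub>0 'b::zero) \<Rightarrow> 'a \<Rightarrow> 'b" where
  "lookup \<equiv> Poly_Mapping.lookup"

abbreviation keys :: "('a \<Rightarrow>\<^sub>0 'b::zero) \<Rightarrow> 'a set" where
  "keys \<equiv> Poly_Mapping.keys"

abbreviation single :: "'a \<Rightarrow> 'b \<Rightarrow> 'a \<Rightarrow>\<^sub>0 'b::zero" where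
  "single \<equiv> Poly_Mapping.single"

lemma mono_subseq_nat:
  fixes s :: "nat \<Rightarrow> nat"
  shows "\<exists>\<phi> :: nat \<Rightarrow> nat. strict_mono \<phi> \<and> mono (\<lambda>i. s (\<phi> i))"
proof -
  obtain f where f: "strict_mono f" "monoseq (\<lambda>n. s (f n))" using seq_monosub by blast
  show ?thesis
  proof (cases "incseq (\<lambda>n. s (f n))")
    case False
    then have dec: "decseq (\<lambda>n. s (f n))" using f(2) by (auto simp: monoseq_iff)
    \<comment> \<open>\<open>N\<close> is an index where the least value is attained, so a
      decreasing sequence is constant from \<open>N\<close> on.\<close>
    define N where "N = (ARG_MIN (\<lambda>n. s (f n)) n. True)"
    have N: "s (f N) \<le> s (f n)" for n
      using arg_min_nat_le[of "\<lambda>_. True" n "\<lambda>n. s (f n)"] by (simp add: N_def)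
    have "s (f (i + N)) = s (f N)" for i
      using N[of "i + N"] decseqD[OF dec, of N "i + N"] by simp
    moreover have "strict_mono (\<lambda>i. f (i + N))" using f(1) by (simp add: strict_mono_def)
    ultimately show ?thesis by (intro exI[of _ "\<lambda>i. f (i + N)"]) (simp add: mono_def)
  qed (use f in blast)
qed

text \<open>Refine the subsequence once for each variable; monotonicity already achieved is
  inherited.\<close>

lemma dickson_subseq:
  fixes e :: "nat \<Rightarrow> ('v \<Rightarrow> nat)"
  assumes "finite V"
  shows "\<exists>\<phi> :: nat \<Rightarrow> nat. strict_mono \<phi> \<and> (\<forall>v\<in>V. mono (\<lambda>i. e (\<phi> i) v))"
  using assms
proof (induction V rule: finite_induct)
  case empty
  show ?case by (rule exI[of _ id]) (simp add: strict_mono_def)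
next
  case (insert v V)
  then obtain \<phi> :: "nat \<Rightarrow> nat" where \<phi>: "strict_mono \<phi>" "\<forall>v\<in>V. mono (\<lambda>i. e (\<phi> i) v)" by auto
  obtain \<psi> :: "nat \<Rightarrow> nat" where \<psi>: "strict_mono \<psi>" "mono (\<lambda>i. e (\<phi> (\<psi> i)) v)"
    using mono_subseq_nat[of "\<lambda>i. e (\<phi> i) v"] by auto
  have "mono (\<lambda>i. e (\<phi> (\<psi> i)) u)" if "u \<in> V" for u
    using \<phi>(2) that strict_mono_mono[OF \<psi>(1)] by (auto simp: mono_def)
  then show ?case
    using \<phi> \<psi> by (intro exI[of _ "\<lambda>i. \<phi> (\<psi> i)"]) (auto simp: strict_mono_def)
qed

text \<open>Dickson's lemma for sequences. It yields both the finite bases of exponent sets and the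
  well-foundedness of the monomial order.\<close>

lemma dickson_seq:
  fixes e :: "nat \<Rightarrow> ('v \<Rightarrow>\<^sub>0 nat)"
  assumes "finite V" "\<And>i. keys (e i) \<subseteq> V"
  shows "\<exists>i j d. i < j \<and> e j = e i + d"
proof -
  obtain \<phi> :: "nat \<Rightarrow> nat" where \<phi>: "strict_mono \<phi>" "\<forall>v\<in>V. mono (\<lambda>i. lookup (e (\<phi> i)) v)"
    using dickson_subseq[OF assms(1), of "\<lambda>i. lookup (e i)"] by auto
  have "e (\<phi> 1) = e (\<phi> 0) + (e (\<phi> 1) - e (\<phi> 0))"
  proof (rule poly_mapping_eqI)
    fix v
    have "lookup (e (\<phi> 0)) v \<le> lookup (e (\<phi> 1)) v"
    proof (cases "v \<in> V")
      case True
      then show ?thesis using \<phi>(2) by (simp add: mono_def)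
    next
      case False
      then have "v \<notin> keys (e (\<phi> 0))" using assms(2) by blast
      then show ?thesis by (simp add: in_keys_iff)
    qed
    then show "lookup (e (\<phi> 1)) v = lookup (e (\<phi> 0) + (e (\<phi> 1) - e (\<phi> 0))) v"
      by (simp add: lookup_add lookup_minus)
  qed
  moreover have "\<phi> 0 < \<phi> 1" using \<phi>(1) by (simp add: strict_mono_def)
  ultimately show ?thesis by blast
qed

text \<open>Without a finite basis one could choose, one after the other, exponents that are not
  multiples of any earlier one, against \<open>dickson_seq\<close>.\<close>

lemma dickson_basis:
  fixes E :: "('v \<Rightarrow>\<^sub>0 nat) set"
  assumes "finite V" "\<And>e. e \<in> E \<Longrightarrow> keys e \<subseteq> V"
  shows "\<exists>F\<subseteq>E. finite F \<and> (\<forall>e\<in>E. \<exists>f\<in>F. \<exists>d. e = f + d)"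
proof (rule ccontr)
  assume neg: "\<not> ?thesis"
  have ex: "\<exists>e. e \<in> E \<and> (\<forall>f\<in>F. \<forall>d. e \<noteq> f + d)" if "F \<subseteq> E" "finite F" for F
  proof -
    have "\<not> (\<forall>e\<in>E. \<exists>f\<in>F. \<exists>d. e = f + d)" using neg that by simp
    then show ?thesis by auto
  qed
  define g where "g F = (SOME e. e \<in> E \<and> (\<forall>f\<in>F. \<forall>d. e \<noteq> f + d))" for F
  have g: "g F \<in> E \<and> (\<forall>f\<in>F. \<forall>d. g F \<noteq> f + d)" if "F \<subseteq> E" "finite F" for F
    unfolding g_def by (rule someI_ex) (rule ex[OF that])
  define L where "L = rec_nat [] (\<lambda>_ l. g (set l) # l)"
  define e where "e n = g (set (L n))" for n
  have L: "L 0 = []" "L (Suc n) = e n # L n" for n by (simp_all add: L_def e_def)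
  have sub: "set (L n) \<subseteq> E" for n
    by (induction n) (simp_all add: L e_def g)
  have mem: "i < n \<Longrightarrow> e i \<in> set (L n)" for i n
    by (induction n) (auto simp: L less_Suc_eq)
  have "keys (e i) \<subseteq> V" for i using g[OF sub finite_set, of i] assms(2) by (simp add: e_def)
  then obtain i j d where "i < j" "e j = e i + d" using dickson_seq[OF assms(1), of e] by auto
  then show False using g[OF sub finite_set, of j] mem[of i j] by (auto simp: e_def)
qed

text \<open>The order is lexicographic, decided at the least variable where two exponents differ;
  against \<open>0\<close> this is the least key of \<open>d\<close>.\<close>

lemma zero_le_exponent: "(0 :: 'v::linorder \<Rightarrow>\<^sub>0 nat) \<le> d"
proof (cases "d = 0")
  case False
  then have ne: "keys d \<noteq> {}" by simp
  define k where "k = Min (keys d)"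
  have "k \<in> keys d" unfolding k_def by (rule Min_in) (use ne in auto)
  moreover have "k' \<notin> keys d" if "k' < k" for k'
    
  proof
    assume "k' \<in> keys d"
    then have "k \<le> k'" unfolding k_def by (intro Min_le) auto
    then show False using that by simp
  qed
  ultimately have "less_fun (lookup 0) (lookup d)"
    by (auto simp: less_fun_def in_keys_iff intro!: exI[of _ k])
  then show ?thesis by (simp add: less_eq_poly_mapping.rep_eq)
qed simp

text \<open>In a descending sequence some later term would have the form \<open>f i + d\<close>,
  which is at least \<open>f i\<close> because \<open>0\<close> is the least exponent.\<close>

lemma wf_exponents:
  assumes "finite V"
  shows "wf {(a, b :: 'v::linorder \<Rightarrow>\<^sub>0 nat). a < b \<and> keys a \<subseteq> V \<and> keys b \<subseteq> V}"
  unfolding wf_iff_no_infinite_down_chain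
proof
  assume "\<exists>f. \<forall>i. (f (Suc i), f i) \<in> {(a, b :: 'v \<Rightarrow>\<^sub>0 nat). a < b \<and> keys a \<subseteq> V \<and> keys b \<subseteq> V}"
  then obtain f :: "nat \<Rightarrow> 'v \<Rightarrow>\<^sub>0 nat" where f: "\<And>i. f (Suc i) < f i" "\<And>i. keys (f i) \<subseteq> V" by auto
  obtain i j d where ij: "i < j" "f j = f i + d" using dickson_seq[OF assms, of f] f(2) by auto
  have "f j < f i" using ij(1) f(1) by (induction j) (auto simp: less_Suc_eq intro: less_trans)
  moreover have "f i \<le> f j" using add_left_mono[OF zero_le_exponent[of d], of "f i"] ij(2) by (simp add: add.commute)
  ultimately show False by simp
qed

section \<open>Polynomials in finitely many variables and division by leading terms\<close>

definition poly_on :: "'v set \<Rightarrow> (('v \<Rightarrow>\<^sub>0 nat) \<Rightarrow>\<^sub>0 'a::zero) set" where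
  "poly_on V = {p. \<forall>e\<in>keys p. keys e \<subseteq> V}"

lemma keys_plus_exponent: "keys (a + b :: 'v \<Rightarrow>\<^sub>0 nat) = keys a \<union> keys b"
  by (auto simp: in_keys_iff lookup_add)

lemma lookup_sum_single_one:
  "finite F \<Longrightarrow> lookup (\<Sum>v\<in>F. single v (Suc 0)) u = (if u \<in> F then 1 else 0)"
  by (auto simp: lookup_sum lookup_single when_def)

lemma keys_sum_single_one: "finite F \<Longrightarrow> keys (\<Sum>v\<in>F. single v (Suc 0)) = F"
  by (auto simp: in_keys_iff lookup_sum_single_one split: if_splits)

lemma keys_minus_exponent: "keys (a - b :: 'v \<Rightarrow>\<^sub>0 nat) \<subseteq> keys a"
  by (auto simp: in_keys_iff lookup_minus)

lemma keys_mult_subset: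
  assumes "\<And>a b. a \<in> keys p \<Longrightarrow> b \<in> keys q \<Longrightarrow> a + b \<in> S"
  shows "keys (p * q) \<subseteq> S"
  using keys_mult[of p q] assms by blast

lemma comm_subring_poly_on: "comm_subring (poly_on V :: (('v \<Rightarrow>\<^sub>0 nat) \<Rightarrow>\<^sub>0 'a::comm_ring_1) set)"
proof
  fix p q :: "('v, 'a) mpoly" assume pq: "p \<in> poly_on V" "q \<in> poly_on V"
  show "p - q \<in> poly_on V" using pq keys_diff[of p q] by (auto simp: poly_on_def)
  show "p * q \<in> poly_on V" using pq keys_mult[of p q]
    by (fastforce simp: poly_on_def keys_plus_exponent)
qed (auto simp: poly_on_def)

lemma single_poly_on: "keys e \<subseteq> V \<Longrightarrow> single e c \<in> poly_on V"
  by (auto simp: poly_on_def)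

text \<open>The leading exponent for the lexicographic order. At \<open>0\<close> the maximum is
  taken over the empty set, so statements about \<open>lead\<close> guard against
  \<open>p = 0\<close>.\<close>

definition lead :: "(('v::linorder \<Rightarrow>\<^sub>0 nat) \<Rightarrow>\<^sub>0 'a::zero) \<Rightarrow> ('v \<Rightarrow>\<^sub>0 nat)" where
  "lead p = Max (keys p)"

lemma lead_in_keys: "p \<noteq> 0 \<Longrightarrow> lead p \<in> keys p"
  unfolding lead_def by (rule Max_in) auto

lemma lead_max: "k \<in> keys p \<Longrightarrow> k \<le> lead p"
  unfolding lead_def by simp

text \<open>Induction for division algorithms, founded on \<open>wf_exponents\<close>. Comparing all
  keys of \<open>q\<close> with \<open>lead p\<close>, rather than \<open>lead q\<close>, also
  covers \<open>q = 0\<close>; the inner \<open>p \<noteq> 0\<close> guards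
  \<open>lead p\<close>.\<close>

lemma poly_on_lead_induct [consumes 2, case_names less]:
  fixes p :: "('v::linorder \<Rightarrow>\<^sub>0 nat) \<Rightarrow>\<^sub>0 'a::zero"
  assumes "finite V" "p \<in> poly_on V"
    and step: "\<And>p. p \<in> poly_on V \<Longrightarrow>
      (\<And>q. q \<in> poly_on V \<Longrightarrow> p \<noteq> 0 \<Longrightarrow> (\<And>k. k \<in> keys q \<Longrightarrow> k < lead p) \<Longrightarrow> Pr q) \<Longrightarrow> Pr p"
  shows "Pr p"
proof (cases "p = 0")
  case False
  have "\<forall>p\<in>poly_on V. p \<noteq> 0 \<longrightarrow> lead p = e \<longrightarrow> Pr p" for e
    using wf_exponents[OF assms(1)]
  proof (induction e rule: wf_induct_rule)
    case (less e)
    have lead_on: "keys (lead q) \<subseteq> V" if "q \<in> poly_on V" "q \<noteq> 0" for q :: "('v, 'a) mpoly"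
      using that lead_in_keys by (auto simp: poly_on_def)
    have "Pr 0" by (rule step) (auto simp: poly_on_def)
    then show ?case
      using less.IH step lead_in_keys lead_on
      by (metis (mono_tags, lifting) case_prodI mem_Collect_eq)
  qed
  then show ?thesis using assms(2) False by blast
qed (use step[of 0] in \<open>auto simp: poly_on_def\<close>)

lemma lookup_single_mult: "lookup (single d c * p) (d + e) = c * lookup (p :: ('v \<Rightarrow>\<^sub>0 nat) \<Rightarrow>\<^sub>0 'a::comm_ring_1) e"
proof -
  have "lookup (single d c * p) (d + e) = (\<Sum>l. (c when d = l) * (\<Sum>q. lookup p q when d + e = l + q))"
    by (simp only: lookup_mult lookup_single)
  also have "\<dots> = (\<Sum>l. (c * (\<Sum>q. lookup p q when d + e = l + q)) when l = d)"
    by (intro Sum_any.cong) (auto simp: when_def)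
  also have "\<dots> = c * lookup p e"
    by (simp add: eq_commute[of e])
  finally show ?thesis .
qed

lemma keys_single_mult: "keys (single d c * p) \<subseteq> (+) d ` keys (p :: ('v \<Rightarrow>\<^sub>0 nat) \<Rightarrow>\<^sub>0 'a::comm_ring_1)"
  using keys_mult[of "single d c" p] by (fastforce split: if_splits)

text \<open>The division step with cross-multiplied leading coefficients. With \<open>b = 1\<close>
  it serves over a field; a general \<open>b\<close> is for coefficients that cannot be
  inverted.\<close>

lemma cancel_lead:
  fixes p q :: "('v::linorder \<Rightarrow>\<^sub>0 nat) \<Rightarrow>\<^sub>0 'a::comm_ring_1"
  assumes "lead p = d + lead q" "b * lookup p (lead p) = c * lookup q (lead q)"
    "k \<in> keys (single 0 b * p - single d c * q)"
  shows "k < lead p"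
proof -
  have "k \<in> keys p \<or> k \<in> (+) d ` keys q"
    using assms(3) keys_diff[of "single 0 b * p" "single d c * q"]
      keys_single_mult[of 0 b p] keys_single_mult[of d c q] by auto
  then have "k \<le> lead p" using lead_max[of _ p] lead_max[of _ q] assms(1) by (fastforce intro: add_left_mono)
  moreover have "k \<noteq> lead p"
    using assms lookup_single_mult[of 0 b p "lead p"] lookup_single_mult[of d c q "lead q"]
    by (auto simp: in_keys_iff lookup_minus)
  ultimately show ?thesis by simp
qed

text \<open>Hilbert's basis theorem by Groebner bases: polynomials whose leading exponents form a
  Dickson basis for those of \<open>J\<close> reduce every element of \<open>J\<close> to
  \<open>0\<close>.\<close>

lemma noetherian_poly_on:
  assumes "finite V"
  shows "noetherian_subring (poly_on V :: (('v::linorder \<Rightarrow>\<^sub>0 nat) \<Rightarrow>\<^sub>0 'k::field) set)"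
proof -
  interpret comm_subring "poly_on V :: ('v, 'k) mpoly set" by (rule comm_subring_poly_on)
  show ?thesis
  proof
    fix J :: "('v, 'k) mpoly set" assume J: "is_ideal J"
    have "\<exists>F\<subseteq>lead ` (J - {0}). finite F \<and> (\<forall>e\<in>lead ` (J - {0}). \<exists>f\<in>F. \<exists>d. e = f + d)"
    proof (rule dickson_basis[OF assms])
      fix e assume "e \<in> lead ` (J - {0})"
      then obtain p where "p \<in> J" "p \<noteq> 0" "e = lead p" by auto
      then show "keys e \<subseteq> V"
        using lead_in_keys[of p] is_ideal_mem[OF J, of p] by (auto simp: poly_on_def)
    qed
    then obtain F where F: "F \<subseteq> lead ` (J - {0})" "finite F"
      "\<And>e. e \<in> lead ` (J - {0}) \<Longrightarrow> \<exists>f\<in>F. \<exists>d. e = f + d" by metis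
    obtain G where G: "G \<subseteq> J - {0}" "finite G" "F = lead ` G"
      using finite_subset_image[OF F(2,1)] by metis
    obtain fs where fs: "set fs = G" using finite_list[OF G(2)] by auto
    define K where "K = adjs {0} fs"
    have sub: "set fs \<subseteq> J" using fs G by auto
    have K: "is_ideal K" "set fs \<subseteq> K"
      using sub is_ideal_subset[OF J] is_ideal_zero_ideal unfolding K_def
      by (auto intro!: is_ideal_adjs intro: subsetD[OF adjs_set])
    have "p \<in> J \<longrightarrow> p \<in> K" if "p \<in> poly_on V" for p
      using assms that
    proof (induction p rule: poly_on_lead_induct)
      case (less p)
      show ?case
      proof (cases "p = 0")
        case False
        show ?thesis
        proof
          assume p: "p \<in> J"
          obtain f d where f: "f \<in> G" "lead p = lead f + d" using F(3)[of "lead p"] p False G(3) by auto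
          have lc: "lookup f (lead f) \<noteq> 0" using f G lead_in_keys[of f] by (auto simp: in_keys_iff)
          define c where "c = lookup p (lead p) / lookup f (lead f)"
          have "keys (lead p) \<subseteq> V"
            using less.hyps lead_in_keys[OF False] unfolding poly_on_def by blast
          then have d: "single d c \<in> poly_on V"
            by (intro single_poly_on) (simp add: f(2) keys_plus_exponent)
          define q where "q = p - single d c * f"
          have "k < lead p" if "k \<in> keys q" for k
            using cancel_lead[of p d f 1 c k] that f lc by (simp add: q_def c_def add.commute)
          moreover have "q \<in> J" using f G p J d unfolding q_def by (intro is_ideal_diff is_ideal_mult) auto
          ultimately have "q \<in> K" using less.IH[of q] False is_ideal_mem[OF J, of q] by blast
          moreover have "single d c * f \<in> K"
            using K f fs d by (intro is_ideal_mult) auto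
          ultimately have "q + single d c * f \<in> K" using K(1) is_ideal_add by blast
          then show "p \<in> K" by (simp add: q_def)
        qed
      qed (use K(1) in \<open>simp add: is_ideal_zero\<close>)
    qed
    then have "J \<subseteq> K" using is_ideal_mem[OF J] by blast
    moreover have "K \<subseteq> J" unfolding K_def using J sub by (intro adjs_least) (auto simp: is_ideal_zero)
    ultimately show "\<exists>fs. set fs \<subseteq> J \<and> J = adjs {0} fs" using sub K_def by blast
  qed
qed

text \<open>The monomials outside the leading exponents of \<open>N\<close> form a basis of the quotient after
  inverting a single \<open>f\<close>, so an inverse of \<open>g\<close> modulo \<open>N\<close> makes \<open>g\<close> divide a power of \<open>f\<close>.\<close>

lemma exists_nonunit_modulo:
  fixes N :: "(('v::linorder \<Rightarrow>\<^sub>0 nat) \<Rightarrow>\<^sub>0 'k::field poly) set"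
  assumes "finite V" "comm_subring.is_ideal (poly_on V) N"
    and const: "\<And>c. single 0 c \<in> N \<Longrightarrow> c = 0"
  shows "\<exists>g. g \<noteq> 0 \<and> (\<forall>h\<in>poly_on V. 1 - single 0 g * h \<notin> N)"
proof -
  interpret comm_subring "poly_on V :: ('v, 'k poly) mpoly set" by (rule comm_subring_poly_on)
  define C :: "'k poly \<Rightarrow> ('v, 'k poly) mpoly" where "C = single 0"
  have C_mult: "C (a * b) = C a * C b" and C_diff: "C (a - b) = C a - C b" and C_one: "C 1 = 1" for a b
    by (simp_all add: C_def mult_single single_diff)
  have C_pow: "C (a ^ n) = C a ^ n" for a n by (induction n) (simp_all add: C_mult C_one)
  have C_on: "C a \<in> poly_on V" for a by (simp add: C_def single_poly_on)
  note N = assms(2)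
  define E where "E = lead ` (N - {0})"
  have "\<exists>F\<subseteq>E. finite F \<and> (\<forall>e\<in>E. \<exists>f\<in>F. \<exists>d. e = f + d)"
  proof (rule dickson_basis[OF assms(1)])
    fix e assume "e \<in> E"
    then obtain p where "p \<in> N" "p \<noteq> 0" "e = lead p" by (auto simp: E_def)
    then show "keys e \<subseteq> V"
      using lead_in_keys[of p] is_ideal_mem[OF N, of p] by (auto simp: poly_on_def)
  qed
  then obtain F where F: "F \<subseteq> E" "finite F" "\<And>e. e \<in> E \<Longrightarrow> \<exists>f\<in>F. \<exists>d. e = f + d" by metis
  obtain G where G: "G \<subseteq> N - {0}" "finite G" "F = lead ` G"
    using finite_subset_image[OF F(2) F(1)[unfolded E_def]] by metis
  \<comment> \<open>Every leading coefficient of the basis divides \<open>f\<close>, so multiplying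
    by \<open>f\<close> permits a division step without inverting coefficients; hence the powers of
    \<open>f\<close> in \<open>reduce\<close>.\<close>
  define f where "f = (\<Prod>p\<in>G. lookup p (lead p))"
  have f0: "f \<noteq> 0" using G lead_in_keys by (auto simp: f_def in_keys_iff)
  have reduce: "\<exists>m h'. C (f ^ m) * h - h' \<in> N \<and> h' \<in> poly_on V \<and> keys h' \<inter> E = {}"
    if "h \<in> poly_on V" for h
    using assms(1) that
  proof (induction h rule: poly_on_lead_induct)
    case (less h)
    show ?case
    proof (cases "h = 0")
      case True
      then show ?thesis by (auto intro!: exI[of _ 0] simp: is_ideal_zero[OF N] mem)
    next
      case False
      have keys_lead: "keys (lead h) \<subseteq> V"
        using less.hyps lead_in_keys[OF False] by (auto simp: poly_on_def)
      show ?thesis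
      proof (cases "lead h \<in> E")
        case True
        then obtain p d where p: "p \<in> G" "lead h = lead p + d" using F(3)[OF True] G(3) by blast
        obtain b where b: "f = lookup p (lead p) * b"
          using dvd_prodI[OF G(2) p(1), of "\<lambda>p. lookup p (lead p)"] by (auto simp: f_def)
        define t where "t = single d (b * lookup h (lead h)) * p"
        have tN: "t \<in> N" unfolding t_def using p G keys_lead
          by (intro is_ideal_mult[OF N] single_poly_on) (auto simp: keys_plus_exponent)
        define q where "q = C f * h - t"
        have q: "q \<in> poly_on V" using tN is_ideal_mem[OF N] less.hyps C_on by (simp add: q_def mem)
        have "k < lead h" if "k \<in> keys q" for k
          using cancel_lead[of h d p f "b * lookup h (lead h)" k] that p b
          by (simp add: q_def C_def t_def add.commute mult_ac)
        then obtain m h' where h': "C (f ^ m) * q - h' \<in> N" "h' \<in> poly_on V" "keys h' \<inter> E = {}"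
          using less.IH[OF q False] by blast
        have "(C (f ^ m) * q - h') + C (f ^ m) * t \<in> N"
          using h' tN C_on by (intro is_ideal_add[OF N] is_ideal_mult[OF N])
        then have "C (f ^ Suc m) * h - h' \<in> N" by (simp add: q_def C_mult algebra_simps)
        then show ?thesis using h' by blast
      next
        case False': False
        \<comment> \<open>No division is possible here: the leading term goes to the remainder, and
          reduction continues below it.\<close>
        define t where "t = single (lead h) (lookup h (lead h))"
        have t: "t \<in> poly_on V" using keys_lead by (simp add: t_def single_poly_on)
        define q where "q = h - t"
        have q: "q \<in> poly_on V" using t less.hyps by (simp add: q_def mem)
        have "k < lead h" if "k \<in> keys q" for k
        proof -
          have "k \<noteq> lead h" using that by (auto simp: q_def t_def in_keys_iff lookup_minus)
          moreover have "k \<in> keys h"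
            using that \<open>k \<noteq> lead h\<close> by (auto simp: q_def t_def in_keys_iff lookup_minus lookup_single)
          ultimately show ?thesis using lead_max[of k h] by simp
        qed
        then obtain m h' where h': "C (f ^ m) * q - h' \<in> N" "h' \<in> poly_on V" "keys h' \<inter> E = {}"
          using less.IH[OF q False] by blast
        have "C (f ^ m) * h - (h' + C (f ^ m) * t) \<in> N" using h' by (simp add: q_def algebra_simps)
        moreover have "h' + C (f ^ m) * t \<in> poly_on V" using h' C_on t by (simp add: mem)
        moreover have "keys (C (f ^ m) * t) \<subseteq> {lead h}"
          by (simp add: C_def t_def mult_single)
        then have "keys (h' + C (f ^ m) * t) \<inter> E = {}"
          using keys_add[of h' "C (f ^ m) * t"] h' False' by blast
        ultimately show ?thesis by blast
      qed
    qed
  qed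
  \<comment> \<open>\<open>g\<close> is coprime to \<open>f\<close> and of positive degree, so it
    divides no power of \<open>f\<close>.\<close>
  define g where "g = 1 + [:0, 1:] * f"
  have deg: "degree g = Suc (degree f)"
    using f0 by (simp add: g_def degree_add_eq_right degree_mult_eq)
  have "g dvd 1" if "g dvd f ^ m" for m
    using that
  proof (induction m)
    case (Suc m)
    have "f ^ m = g * f ^ m - [:0, 1:] * f ^ Suc m" by (simp add: g_def algebra_simps)
    then show ?case using Suc by (metis dvd_diff dvd_mult dvd_triv_left)
  qed simp
  then have "\<not> g dvd f ^ m" for m
    using deg degree_1 by (metis Zero_not_Suc dvd_imp_degree_le le_zero_eq one_neq_zero)
  moreover have "g dvd f ^ m" if h: "h \<in> poly_on V" "1 - C g * h \<in> N" and m: "C (f ^ m) * h - h' \<in> N"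
    "h' \<in> poly_on V" "keys h' \<inter> E = {}" for h h' m
  proof -
    have "C (f ^ m) * (1 - C g * h) + C g * (C (f ^ m) * h - h') \<in> N"
      using h m C_on by (intro is_ideal_add[OF N] is_ideal_mult[OF N])
    then have *: "C (f ^ m) - C g * h' \<in> N" by (simp add: algebra_simps)
    \<comment> \<open>A nonzero element of \<open>N\<close> with leading exponent \<open>0\<close>
      would be a constant.\<close>
    have 0: "0 \<notin> E"
    proof
      assume "0 \<in> E"
      then obtain p where p: "p \<in> N" "p \<noteq> 0" "lead p = 0" unfolding E_def by (elim imageE) auto
      then have "keys p \<subseteq> {0}"
        using lead_max[of _ p] zero_le_exponent by (metis order_antisym singletonI subsetI)
      then have "p = single 0 (lookup p 0)"
        by (intro poly_mapping_eqI) (auto simp: lookup_single when_def in_keys_iff)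
      then show False using const[of "lookup p 0"] p by (metis single_zero)
    qed
    have "keys (C (f ^ m) - C g * h') \<subseteq> insert 0 (keys h')"
      using keys_diff[of "C (f ^ m)" "C g * h'"] keys_single_mult[of 0 g h'] by (auto simp: C_def split: if_splits)
    then have keys: "keys (C (f ^ m) - C g * h') \<inter> E = {}"
      using m(3) 0 by auto
    \<comment> \<open>An element of \<open>N\<close> without exponents in \<open>E\<close> has no
      possible leading exponent. The constant terms then show that \<open>g\<close> divides
      \<open>f ^ m\<close>.\<close>
    have "C (f ^ m) - C g * h' = 0"
    proof (rule ccontr)
      assume ne: "C (f ^ m) - C g * h' \<noteq> 0"
      then have "lead (C (f ^ m) - C g * h') \<in> E" using * by (simp add: E_def)
      then show False using keys lead_in_keys[OF ne] by auto
    qed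
    then have "lookup (C (f ^ m)) 0 = lookup (C g * h') 0" by simp
    then have "f ^ m = g * lookup h' 0"
      using lookup_single_mult[of 0 g h' 0] by (simp add: C_def)
    then show ?thesis by simp
  qed
  moreover have "g \<noteq> 0" using deg by auto
  ultimately show ?thesis using reduce unfolding C_def by blast
qed

section \<open>Evaluation and Zariski's lemma\<close>

lemma sum_single_lookup: "(\<Sum>e\<in>keys p. single e (lookup p e)) = p"
proof (rule poly_mapping_eqI)
  fix k
  have "lookup (\<Sum>e\<in>keys p. single e (lookup p e)) k
      = (\<Sum>e\<in>keys p. if k = e then lookup p k else 0)"
    unfolding lookup_sum by (intro sum.cong) (auto simp: lookup_single when_def)
  then show "lookup (\<Sum>e\<in>keys p. single e (lookup p e)) k
      = lookup p k" by (simp add: in_keys_iff)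
qed

lemma poly_mapping_single_add_induct [case_names zero single_add]:
  assumes "Pr 0" "\<And>e c p. Pr p \<Longrightarrow> Pr (single e c + p)"
  shows "Pr (p :: 'b \<Rightarrow>\<^sub>0 'a::comm_monoid_add)"
proof -
  have "Pr (\<Sum>e\<in>A. single e (f e))" if "finite A" for A and f :: "'b \<Rightarrow> 'a"
    using that by (induction A rule: finite_induct) (auto simp: assms)
  then show ?thesis using sum_single_lookup[of p] finite_keys[of p] by metis
qed

text \<open>Evaluation together with a map of coefficients. It is used with scalars going to
  constants, with univariate polynomials going to their values at \<open>t\<close>, and with scalars
  going to constant univariate polynomials.\<close>

locale coeff_hom =
  fixes h :: "'a::comm_ring_1 \<Rightarrow> 'b::comm_ring_1"
  assumes h_add: "h (a + b) = h a + h b" and h_mult: "h (a * b) = h a * h b" and h_one: "h 1 = 1"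
begin

lemma h_zero: "h 0 = 0"
  using h_add[of 0 0] by simp

definition mon_eval :: "('v \<Rightarrow> 'b) \<Rightarrow> ('v \<Rightarrow>\<^sub>0 nat) \<Rightarrow> 'b" where
  "mon_eval \<sigma> e = (\<Prod>v\<in>keys e. \<sigma> v ^ lookup e v)"

definition mp_eval :: "('v \<Rightarrow> 'b) \<Rightarrow> ('v, 'a) mpoly \<Rightarrow> 'b" where
  "mp_eval \<sigma> p = (\<Sum>e\<in>keys p. h (lookup p e) * mon_eval \<sigma> e)"

lemma mon_eval_superset:
  "finite A \<Longrightarrow> keys e \<subseteq> A \<Longrightarrow> mon_eval \<sigma> e = (\<Prod>v\<in>A. \<sigma> v ^ lookup e v)"
  unfolding mon_eval_def by (intro prod.mono_neutral_left) (auto simp: in_keys_iff)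

lemma mon_eval_add: "mon_eval \<sigma> (d + e) = mon_eval \<sigma> d * mon_eval \<sigma> e"
proof -
  define A where "A = keys d \<union> keys e"
  have "finite A" by (simp add: A_def)
  then show ?thesis
    using mon_eval_superset[of A]
    by (simp add: A_def keys_plus_exponent lookup_add power_add prod.distrib)
qed

lemma mp_eval_superset:
  "finite A \<Longrightarrow> keys p \<subseteq> A \<Longrightarrow> mp_eval \<sigma> p = (\<Sum>e\<in>A. h (lookup p e) * mon_eval \<sigma> e)"
  unfolding mp_eval_def by (intro sum.mono_neutral_left) (auto simp: in_keys_iff h_zero)

lemma mp_eval_add: "mp_eval \<sigma> (p + q) = mp_eval \<sigma> p + mp_eval \<sigma> q"
proof -
  define A where "A = keys p \<union> keys q"
  have "finite A" "keys (p + q) \<subseteq> A" using keys_add[of p q] by (simp_all add: A_def)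
  then show ?thesis
    using mp_eval_superset[of A]
    by (simp add: A_def lookup_add h_add distrib_right sum.distrib)
qed

lemma mp_eval_zero: "mp_eval \<sigma> 0 = 0"
  by (simp add: mp_eval_def)

lemma mp_eval_single: "mp_eval \<sigma> (single e c) = h c * mon_eval \<sigma> e"
  by (simp add: mp_eval_superset[of "{e}"])

lemma mp_eval_mult: "mp_eval \<sigma> (p * q) = mp_eval \<sigma> p * mp_eval \<sigma> q"
proof (induction p rule: poly_mapping_single_add_induct)
  case (single_add e c p)
  have "mp_eval \<sigma> (single e c * q) = mp_eval \<sigma> (single e c) * mp_eval \<sigma> q"
  proof (induction q rule: poly_mapping_single_add_induct)
    case (single_add d b q)
    then show ?case
      by (simp add: distrib_left mp_eval_add mp_eval_single mult_single mon_eval_add h_mult mult_ac)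
  qed (simp add: mp_eval_zero)
  then show ?case using single_add by (simp add: distrib_right mp_eval_add)
qed (simp add: mp_eval_zero)

lemma mp_eval_const: "mp_eval \<sigma> (single 0 c) = h c"
  by (simp add: mp_eval_single mon_eval_def)

lemma mp_eval_one: "mp_eval \<sigma> 1 = 1"
  using mp_eval_const[of \<sigma> 1] by (simp add: h_one)

lemma mp_eval_uminus: "mp_eval \<sigma> (- p) = - mp_eval \<sigma> p"
  using mp_eval_add[of \<sigma> p "- p"] by (simp add: mp_eval_zero minus_unique)

lemma mp_eval_diff: "mp_eval \<sigma> (p - q) = mp_eval \<sigma> p - mp_eval \<sigma> q"
  using mp_eval_add[of \<sigma> p "- q"] by (simp add: mp_eval_uminus)

lemma mp_eval_var: "mp_eval \<sigma> (single (single v 1) 1) = \<sigma> v"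
  by (simp add: mp_eval_single mon_eval_def h_one)

lemma mp_eval_in:
  assumes "comm_subring C" "\<And>c. h c \<in> C" "\<And>v. v \<in> V \<Longrightarrow> \<sigma> v \<in> C" "p \<in> poly_on V"
  shows "mp_eval \<sigma> p \<in> C"
proof -
  interpret comm_subring C by fact
  have pow: "x ^ n \<in> C" if "x \<in> C" for x and n :: nat using that by (induction n) (auto simp: mem)
  have prod: "prod f A \<in> C" if "\<And>x. x \<in> A \<Longrightarrow> f x \<in> C" for f :: "'v \<Rightarrow> 'b" and A
    using that by (induction A rule: infinite_finite_induct) (auto simp: mem)
  have sum: "sum f A \<in> C" if "\<And>x. x \<in> A \<Longrightarrow> f x \<in> C" for f :: "('v \<Rightarrow>\<^sub>0 nat) \<Rightarrow> 'b" and A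
    using that by (induction A rule: infinite_finite_induct) (auto simp: mem)
  show ?thesis unfolding mp_eval_def mon_eval_def
    using assms(2-4) by (intro sum mult_mem prod pow) (auto simp: poly_on_def)
qed

end

lemma coeff_hom_const: "coeff_hom (single 0 :: 'a::comm_ring_1 \<Rightarrow> ('b::comm_monoid_add) \<Rightarrow>\<^sub>0 'a)"
  by standard (simp_all add: single_add mult_single)

lemma (in coeff_hom) coeff_hom_poly: "coeff_hom (\<lambda>g. poly (map_poly h g) t)"
proof
  have pc: "poly (map_poly h (pCons a p)) t = h a + t * poly (map_poly h p) t" for a p
    by (cases "pCons a p = 0") (simp_all add: map_poly_pCons h_zero)
  have sm: "poly (map_poly h (Polynomial.smult a p)) t = h a * poly (map_poly h p) t" for a p
    by (induction p) (simp_all add: pc h_mult h_zero algebra_simps)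
  show add: "poly (map_poly h (a + b)) t = poly (map_poly h a) t + poly (map_poly h b) t" for a b
    by (induction a b rule: poly_induct2) (simp_all add: pc h_add algebra_simps)
  show "poly (map_poly h (a * b)) t = poly (map_poly h a) t * poly (map_poly h b) t" for a b
    by (induction a) (simp_all add: pc add sm h_zero algebra_simps)
  show "poly (map_poly h 1) t = 1"
    using pc[of 1 0] by (simp add: h_one one_pCons)
qed

text \<open>Zariski's lemma: were \<open>t\<close> transcendental modulo \<open>M\<close>, every nonzero polynomial in \<open>t\<close> would be
  invertible modulo \<open>M\<close>.\<close>

lemma algebraic_modulo_maximal:
  fixes M :: "(('v::linorder \<Rightarrow>\<^sub>0 nat) \<Rightarrow>\<^sub>0 'k::field) set"
  assumes "finite V" and M: "comm_subring.is_ideal (poly_on V) M"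
    and max: "\<And>a. a \<in> poly_on V \<Longrightarrow> a \<notin> M \<Longrightarrow> \<exists>b\<in>poly_on V. 1 - a * b \<in> M"
    and t: "t \<in> poly_on V"
  shows "\<exists>g. lead_coeff g = 1 \<and> poly (map_poly (single 0) g) t \<in> M"
proof (rule ccontr)
  assume neg: "\<not> ?thesis"
  interpret S: comm_subring "poly_on V :: ('v, 'k) mpoly set" by (rule comm_subring_poly_on)
  interpret A: comm_subring "poly_on V :: ('v, 'k poly) mpoly set" by (rule comm_subring_poly_on)
  define C :: "'k \<Rightarrow> ('v, 'k) mpoly" where "C = single 0"
  interpret C: coeff_hom C unfolding C_def by (rule coeff_hom_const)
  define h where "h g = poly (map_poly C g) t" for g
  interpret h: coeff_hom h unfolding h_def by (rule C.coeff_hom_poly)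
  define x :: "'v \<Rightarrow> ('v, 'k) mpoly" where "x v = single (single v 1) 1" for v
  have pow_t: "t ^ n \<in> poly_on V" for n by (induction n) (auto simp: S.mem t)
  have h_on: "h g \<in> poly_on V" for g
  proof (induction g)
    case (pCons a p)
    have "h (pCons a p) = C a + t * h p"
      by (cases "pCons a p = 0") (simp_all add: h_def map_poly_pCons C.h_zero)
    then show ?case using pCons t by (simp add: S.mem C_def single_poly_on)
  qed (simp add: h_def S.mem)
  have h_notin: "h g \<notin> M" if "g \<noteq> 0" for g
  proof
    assume hg: "h g \<in> M"
    define g' where "g' = Polynomial.smult (1 / lead_coeff g) g"
    \<comment> \<open>Dividing by the leading coefficient would turn a relation into a monic
      one.\<close>
    have "h g' = h [:1 / lead_coeff g:] * h g" by (simp add: g'_def flip: h.h_mult)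
    then have "h g' \<in> M" using S.is_ideal_mult[OF M h_on hg] by simp
    moreover have "lead_coeff g' = 1" using that by (simp add: g'_def)
    ultimately show False using neg by (auto simp: h_def C_def)
  qed
  define ev where "ev = h.mp_eval x"
  have ev_on: "ev p \<in> poly_on V" if "p \<in> poly_on V" for p
    unfolding ev_def using that h_on
    by (intro h.mp_eval_in[OF S.comm_subring_axioms]) (auto simp: x_def single_poly_on)
  \<comment> \<open>The preimage of \<open>M\<close> in the polynomials over \<open>K[X]\<close>,
    where \<open>X\<close> is sent to \<open>t\<close>. By \<open>h_notin\<close> it contains no
    nonzero constant, as \<open>exists_nonunit_modulo\<close> requires.\<close>
  define N where "N = {p \<in> poly_on V. ev p \<in> M}"
  have N: "A.is_ideal N"
    unfolding A.is_ideal_def N_def using ev_on S.is_ideal_mult[OF M] S.is_ideal_add[OF M] S.is_ideal_zero[OF M]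
    by (auto simp: A.mem ev_def h.mp_eval_add h.mp_eval_mult h.mp_eval_zero)
  obtain g where g: "g \<noteq> 0" "\<And>q. q \<in> poly_on V \<Longrightarrow> 1 - single 0 g * q \<notin> N"
    using exists_nonunit_modulo[OF assms(1) N] h_notin by (auto simp: N_def ev_def h.mp_eval_const)
  obtain b where b: "b \<in> poly_on V" "1 - h g * b \<in> M" using max[OF h_on h_notin[OF g(1)]] by auto
  define C' :: "'k \<Rightarrow> ('v, 'k poly) mpoly" where "C' c = single 0 [:c:]" for c
  interpret C': coeff_hom C' by standard (simp_all add: C'_def mult_single mult.commute one_pCons flip: single_add single_one)
  \<comment> \<open>Reading scalars as constant polynomials in \<open>X\<close> gives a preimage of
    \<open>b\<close> under \<open>ev\<close>.\<close>
  define lift where "lift = C'.mp_eval (\<lambda>v. single (single v 1) 1)"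
  have "lift b \<in> poly_on V" unfolding lift_def using b(1)
    by (intro C'.mp_eval_in[OF A.comm_subring_axioms]) (auto simp: C'_def single_poly_on)
  moreover have "ev (lift b) = b"
  proof -
    have ev_sum: "ev (sum f B) = (\<Sum>i\<in>B. ev (f i))" for f :: "('v \<Rightarrow>\<^sub>0 nat) \<Rightarrow> _" and B
      by (induction B rule: infinite_finite_induct) (simp_all add: ev_def h.mp_eval_add h.mp_eval_zero)
    have ev_prod: "ev (prod f B) = (\<Prod>i\<in>B. ev (f i))" for f :: "'v \<Rightarrow> _" and B
      by (induction B rule: infinite_finite_induct) (simp_all add: ev_def h.mp_eval_mult h.mp_eval_one)
    have ev_pow: "ev (q ^ n) = ev q ^ n" for q n
      by (induction n) (simp_all add: ev_def h.mp_eval_mult h.mp_eval_one)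
    have ev_mult: "ev (p * q) = ev p * ev q" for p q
      by (simp add: ev_def h.mp_eval_mult)
    have ev_x: "ev (single (single v (Suc 0)) 1) = x v" for v
      using h.mp_eval_var[of x v] by (simp add: ev_def)
    have ev_C: "ev (C' c) = C c" for c
      by (simp add: ev_def C'_def h.mp_eval_const h_def map_poly_pCons C.h_zero)
    have mon: "(\<Prod>v\<in>keys e. x v ^ lookup e v) = single e 1" for e
    proof -
      have pw: "x v ^ n = single (single v n) 1" for v n
        by (induction n) (simp_all add: x_def mult_single flip: single_add)
      have "(\<Prod>v\<in>B. single (f v) (1::'k)) = single (\<Sum>v\<in>B. f v) 1" if "finite B"
        for B and f :: "'v \<Rightarrow> 'v \<Rightarrow>\<^sub>0 nat"
        using that by (induction B rule: finite_induct) (simp_all add: mult_single)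
      then show ?thesis using sum_single_lookup[of e] by (simp add: pw)
    qed
    have "ev (lift b) = (\<Sum>e\<in>keys b. C (lookup b e) * single e 1)"
      unfolding lift_def C'.mp_eval_def C'.mon_eval_def ev_sum mon[symmetric]
      by (intro sum.cong) (simp_all add: ev_prod ev_pow ev_C ev_mult ev_x)
    also have "\<dots> = b" using sum_single_lookup[of b] by (simp add: C_def mult_single)
    finally show ?thesis .
  qed
  then have "ev (1 - single 0 g * lift b) = 1 - h g * b"
    by (simp add: ev_def h.mp_eval_diff h.mp_eval_one h.mp_eval_mult h.mp_eval_const)
  ultimately have "1 - single 0 g * lift b \<in> N"
    using b(2) by (auto simp: N_def A.mem single_poly_on)
  then show False using g(2) \<open>lift b \<in> poly_on V\<close> by blast
qed

section \<open>Krull dimension modulo a monomial ideal\<close>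

definition restr :: "'b set \<Rightarrow> ('b \<Rightarrow>\<^sub>0 'a::zero) \<Rightarrow> ('b \<Rightarrow>\<^sub>0 'a)" where
  "restr S p = Poly_Mapping.mapp (\<lambda>k c. c when k \<in> S) p"

lemma lookup_restr: "lookup (restr S p) k = (lookup p k when k \<in> S)"
  by (auto simp: restr_def lookup_mapp when_def in_keys_iff)

lemma keys_restr: "keys (restr S p) = keys p \<inter> S"
  by (auto simp: in_keys_iff lookup_restr)

lemma restr_add: "restr S (p + q) = restr S p + restr S (q :: _ \<Rightarrow>\<^sub>0 'a::comm_ring_1)"
  by (rule poly_mapping_eqI) (simp add: lookup_restr lookup_add when_def)

lemma restr_diff: "restr S (p - q) = restr S p - restr S (q :: _ \<Rightarrow>\<^sub>0 'a::comm_ring_1)"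
  by (rule poly_mapping_eqI) (simp add: lookup_restr lookup_minus when_def)

lemma restr_sum: "restr S (sum f A) = (\<Sum>i\<in>A. restr S (f i :: _ \<Rightarrow>\<^sub>0 'a::comm_ring_1))"
  by (rule poly_mapping_eqI) (simp add: lookup_restr lookup_sum when_def)

lemma restr_split: "restr S p + restr (- S) p = (p :: _ \<Rightarrow>\<^sub>0 'a::comm_ring_1)"
  by (rule poly_mapping_eqI) (simp add: lookup_restr lookup_add when_def)

lemma restr_id: "keys p \<subseteq> S \<Longrightarrow> restr S p = p"
  by (rule poly_mapping_eqI) (auto simp: lookup_restr when_def in_keys_iff)

lemma restr_eq_zero: "keys p \<inter> S = {} \<Longrightarrow> restr S p = 0"
  by (rule poly_mapping_eqI) (auto simp: lookup_restr when_def in_keys_iff)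

lemma restr_poly_on: "p \<in> poly_on V \<Longrightarrow> restr S p \<in> poly_on V"
  by (auto simp: poly_on_def keys_restr)

text \<open>The exponents are consumed by \<open>hd\<close> and \<open>tl\<close>, so the recursion
  follows the list of factors alone; it is applied to lists of equal length.\<close>

fun power_product :: "'a::comm_ring_1 list \<Rightarrow> nat list \<Rightarrow> 'a" where
  "power_product [] ns = 1"
| "power_product (f # fs) ns = f ^ hd ns * power_product fs (tl ns)"

text \<open>Each variable is bounded separately, rather than the total degree, to match the boxes of
  exponents counted in \<open>prime_chain_length_le\<close>.\<close>

definition degrees_le :: "nat \<Rightarrow> (('v \<Rightarrow>\<^sub>0 nat) \<Rightarrow>\<^sub>0 'a::zero) \<Rightarrow> bool" where
  "degrees_le n p \<longleftrightarrow> (\<forall>e\<in>keys p. \<forall>v. lookup e v \<le> n)"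

lemma degrees_le_mono: "degrees_le m p \<Longrightarrow> m \<le> n \<Longrightarrow> degrees_le n p"
  unfolding degrees_le_def by (meson order_trans)

lemma degrees_le_mult: "degrees_le m p \<Longrightarrow> degrees_le n q \<Longrightarrow> degrees_le (m + n) (p * q)"
  using keys_mult[of p q] by (fastforce simp: degrees_le_def lookup_add intro: add_mono)

lemma degrees_le_one: "degrees_le n 1"
  by (simp add: degrees_le_def)

lemma degrees_le_power: "degrees_le m p \<Longrightarrow> degrees_le (n * m) (p ^ n)"
  by (induction n) (auto intro: degrees_le_mult degrees_le_one)

lemma degrees_le_power_product:
  assumes "\<And>f. f \<in> set fs \<Longrightarrow> degrees_le m f" "length ns = length fs"
  shows "degrees_le (sum_list ns * m) (power_product fs ns)"
  using assms
proof (induction fs arbitrary: ns)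
  case (Cons f fs)
  then obtain n ns' where ns: "ns = n # ns'" by (cases ns) auto
  show ?case using Cons degrees_le_mult[OF degrees_le_power[of m f n]]
    by (simp add: ns distrib_right)
qed (simp add: degrees_le_one)

lemma exists_degrees_le:
  fixes A :: "(('v \<Rightarrow>\<^sub>0 nat) \<Rightarrow>\<^sub>0 'a::zero) set"
  assumes "finite A"
  shows "\<exists>n. \<forall>p\<in>A. degrees_le n p"
proof -
  define E where "E = (\<Union>p\<in>A. \<Union>e\<in>keys p. Poly_Mapping.range e)"
  have "finite E" using assms by (auto simp: E_def)
  then have le: "x \<le> Max (insert 0 E)" if "x \<in> E" for x using that by simp
  have "lookup e v \<le> Max (insert 0 E)" if "p \<in> A" "e \<in> keys p" for p e v
  proof (cases "v \<in> keys e")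
    case True
    then have "lookup e v \<in> E" using that by (auto simp: E_def intro: in_keys_lookup_in_range)
    then show ?thesis by (rule le)
  qed (simp add: in_keys_iff)
  then show ?thesis by (auto simp: degrees_le_def)
qed

locale poly_ring =
  fixes V :: "'v::linorder set" and k :: "'k::field itself"
  assumes finite_V: "finite V"
begin

sublocale noetherian_subring "poly_on V :: ('v, 'k) mpoly set"
  using noetherian_poly_on[OF finite_V] .

abbreviation const :: "'k \<Rightarrow> ('v, 'k) mpoly" where
  "const \<equiv> single 0"

abbreviation S :: "('v, 'k) mpoly set" where
  "S \<equiv> poly_on V"

lemma const_S: "const c \<in> S"
  by (simp add: single_poly_on)

lemma power_S: "a \<in> S \<Longrightarrow> a ^ n \<in> S"
  by (induction n) (auto simp: mem)

lemma sum_S: "(\<And>i. i \<in> A \<Longrightarrow> f i \<in> S) \<Longrightarrow> sum f A \<in> S"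
  by (rule is_ideal_sum[OF is_ideal_carrier])

lemma const_notin_prime:
  assumes "prime_idl P" "c \<noteq> 0" shows "const c \<notin> P"
proof
  assume "const c \<in> P"
  then have "const (1 / c) * const c \<in> P"
    using prime_idl_ideal[OF assms(1)] const_S by (intro is_ideal_mult)
  then show False using assms prime_idl_one by (simp add: mult_single)
qed

lemma power_product_S: "set fs \<subseteq> S \<Longrightarrow> power_product fs ns \<in> S"
  by (induction fs arbitrary: ns) (auto simp: mem power_S)

text \<open>The argument of Coquand and Lombardi: a lowest-order term of an algebraic relation
  climbs up the chain of primes.\<close>

lemma prime_chain_independent:
  assumes "length Ps = Suc (length fs)" "\<And>P. P \<in> set Ps \<Longrightarrow> prime_idl P" "sorted_wrt (\<subset>) Ps"
    and "\<And>i. i < length fs \<Longrightarrow> fs ! i \<in> Ps ! Suc i - Ps ! i"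
    and "finite T" "\<And>ns. ns \<in> T \<Longrightarrow> length ns = length fs" "ns \<in> T" "c ns \<noteq> 0"
  shows "(\<Sum>ns\<in>T. const (c ns) * power_product fs ns) \<notin> hd Ps"
  using assms
proof (induction fs arbitrary: Ps T c ns)
  case Nil
  then have "T = {[]}" "ns = []" by auto
  moreover have "hd Ps \<in> set Ps" using Nil by (cases Ps) auto
  ultimately show ?case using Nil const_notin_prime by simp
next
  case (Cons f fs)
  obtain P Q Ps' where Ps: "Ps = P # Q # Ps'"
    using Cons.prems(1) by (metis Suc_length_conv length_Cons)
  have f: "f \<in> Q" "f \<notin> P" using Cons.prems(4)[of 0] by (auto simp: Ps)
  have pP: "prime_idl P" "P \<subseteq> Q" and pQ: "prime_idl Q" using Cons.prems(2,3) by (auto simp: Ps)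
  note idP = prime_idl_ideal[OF pP(1)] and idQ = prime_idl_ideal[OF pQ]
  have fS: "f \<in> S" using f idQ is_ideal_mem by auto
  have fsS: "set fs \<subseteq> S"
  proof
    fix g assume "g \<in> set fs"
    then obtain i where i: "i < length fs" "g = fs ! i" by (auto simp: in_set_conv_nth)
    then have "g \<in> Ps ! Suc (Suc i)" using Cons.prems(4)[of "Suc i"] by auto
    moreover have "Ps ! Suc (Suc i) \<in> set Ps" using i Cons.prems(1) by (intro nth_mem) auto
    ultimately show "g \<in> S" using Cons.prems(2) prime_idl_ideal is_ideal_mem by blast
  qed
  \<comment> \<open>Zero coefficients are discarded, so that the minimum \<open>m\<close> is
    attained by a term that occurs.\<close>
  define T' where "T' = {ns \<in> T. c ns \<noteq> 0}"
  have T': "finite T'" "ns \<in> T'" using Cons.prems by (auto simp: T'_def)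
  \<comment> \<open>\<open>f ^ m\<close> can be cancelled modulo \<open>P\<close>. The terms of
    \<open>T2\<close> keep a factor \<open>f \<in> Q\<close>, so modulo \<open>Q\<close> only
    \<open>s1\<close> remains: a relation among the other elements for the chain that starts at
    \<open>Q\<close>.\<close>
  define m where "m = Min (hd ` T')"
  have "m \<in> hd ` T'" unfolding m_def using T' by (intro Min_in) auto
  have m_le: "m \<le> hd ns" if "ns \<in> T'" for ns unfolding m_def using T' that by simp
  define T1 where "T1 = {ns \<in> T'. hd ns = m}"
  define T2 where "T2 = {ns \<in> T'. hd ns \<noteq> m}"
  obtain ms where ms: "ms \<in> T1" using \<open>m \<in> hd ` T'\<close> by (auto simp: T1_def)
  define s1 where "s1 = (\<Sum>ns\<in>T1. const (c ns) * power_product fs (tl ns))"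
  define s2 where "s2 = (\<Sum>ns\<in>T2. const (c ns) * (f ^ (hd ns - Suc m) * power_product fs (tl ns)))"
  have sS: "s1 \<in> S" "s2 \<in> S" unfolding s1_def s2_def using fS fsS
    by (auto intro!: sum_S mult_mem const_S power_product_S power_S)
  have "(\<Sum>ns\<in>T. const (c ns) * power_product (f # fs) ns)
      = (\<Sum>ns\<in>T'. const (c ns) * power_product (f # fs) ns)"
    using Cons.prems(5) by (intro sum.mono_neutral_right) (auto simp: T'_def)
  also have "\<dots> = (\<Sum>ns\<in>T1. const (c ns) * power_product (f # fs) ns) + (\<Sum>ns\<in>T2. const (c ns) * power_product (f # fs) ns)"
    using T' by (subst sum.union_disjoint[symmetric]) (auto simp: T1_def T2_def intro!: sum.cong)
  also have "(\<Sum>ns\<in>T1. const (c ns) * power_product (f # fs) ns) = s1 * f ^ m"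
    unfolding s1_def sum_distrib_right by (intro sum.cong) (auto simp: T1_def mult_ac)
  also have "(\<Sum>ns\<in>T2. const (c ns) * power_product (f # fs) ns) = s2 * f * f ^ m"
    unfolding s2_def sum_distrib_right
  proof (intro sum.cong refl)
    fix ns assume "ns \<in> T2"
    then have "hd ns = (hd ns - Suc m) + Suc m" using m_le[of ns] by (auto simp: T2_def)
    then have "f ^ hd ns = f ^ (hd ns - Suc m) * f * f ^ m" by (metis mult.assoc power_Suc power_add)
    then show "const (c ns) * power_product (f # fs) ns
      = const (c ns) * (f ^ (hd ns - Suc m) * power_product fs (tl ns)) * f * f ^ m"
      by (simp add: mult_ac)
  qed
  finally have sum_eq: "(\<Sum>ns\<in>T. const (c ns) * power_product (f # fs) ns) = (s1 + s2 * f) * f ^ m"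
    by (simp add: distrib_right)
  have fm: "f ^ m \<notin> P" for m
    using f(2) fS pP(1) power_S by (induction m) (auto simp: prime_idl_one dest: prime_idl_mult)
  show ?case
  proof
    assume *: "(\<Sum>ns\<in>T. const (c ns) * power_product (f # fs) ns) \<in> hd Ps"
    have "(s1 + s2 * f) * f ^ m \<in> P" using *[unfolded sum_eq] by (simp add: Ps)
    then have "s1 + s2 * f \<in> P"
      using prime_idl_mult[OF pP(1), of "s1 + s2 * f" "f ^ m"] fm[of m] sS fS power_S
      by (simp add: mem)
    moreover have "s2 * f \<in> Q" using idQ sS f by (intro is_ideal_mult) auto
    ultimately have "s1 \<in> Q" using is_ideal_add_iff[OF idQ] pP(2) by blast
    have inj: "inj_on tl T1"
    proof (rule inj_onI)
      fix a b assume ab: "a \<in> T1" "b \<in> T1" "tl a = tl b"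
      have "length a = Suc (length fs)" "length b = Suc (length fs)"
        using ab Cons.prems(6)[of a] Cons.prems(6)[of b] by (simp_all add: T1_def T'_def)
      then show "a = b" using ab by (cases a; cases b) (auto simp: T1_def)
    qed
    have "s1 = (\<Sum>ns\<in>tl ` T1. const (c (m # ns)) * power_product fs ns)"
      unfolding s1_def sum.reindex[OF inj] 
    proof (intro sum.cong refl)
      fix ns assume "ns \<in> T1"
      then have "length ns = Suc (length fs)" "hd ns = m" using Cons.prems(6)[of ns] by (auto simp: T1_def T'_def)
      then show "const (c ns) * power_product fs (tl ns)
          = ((\<lambda>ns. const (c (m # ns)) * power_product fs ns) \<circ> tl) ns" by (cases ns) auto
    qed
    moreover have "(\<Sum>ns\<in>tl ` T1. const (c (m # ns)) * power_product fs ns) \<notin> hd (Q # Ps')"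
    proof (rule Cons.IH)
      show "length (Q # Ps') = Suc (length fs)" "\<And>P. P \<in> set (Q # Ps') \<Longrightarrow> prime_idl P"
        "sorted_wrt (\<subset>) (Q # Ps')" using Cons.prems(1-3) by (auto simp: Ps)
      show "fs ! i \<in> (Q # Ps') ! Suc i - (Q # Ps') ! i" if "i < length fs" for i
        using Cons.prems(4)[of "Suc i"] that by (simp add: Ps)
      show "finite (tl ` T1)" using T' by (simp add: T1_def)
      show "length ns = length fs" if "ns \<in> tl ` T1" for ns
        using that Cons.prems(6) by (auto simp: T1_def T'_def)
      show "tl ms \<in> tl ` T1" using ms by simp
      have "length ms = Suc (length fs)" "hd ms = m" "c ms \<noteq> 0"
        using ms Cons.prems(6)[of ms] by (auto simp: T1_def T'_def)
      then show "c (m # tl ms) \<noteq> 0" by (cases ms) auto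
    qed
    ultimately show False using \<open>s1 \<in> Q\<close> by simp
  qed
qed

definition mono_ideal :: "('v \<Rightarrow>\<^sub>0 nat) set \<Rightarrow> ('v, 'k) mpoly set" where
  "mono_ideal U = {p \<in> S. keys p \<subseteq> U}"

lemma is_ideal_mono_ideal:
  assumes "\<And>e d. e \<in> U \<Longrightarrow> d + e \<in> U" shows "is_ideal (mono_ideal U)"
  unfolding is_ideal_def mono_ideal_def
proof (intro conjI ballI)
  fix a b assume "a \<in> {p \<in> S. keys p \<subseteq> U}" "b \<in> {p \<in> S. keys p \<subseteq> U}"
  then show "a + b \<in> {p \<in> S. keys p \<subseteq> U}" using keys_add[of a b] by (auto simp: mem)
next
  fix c a assume "c \<in> S" "a \<in> {p \<in> S. keys p \<subseteq> U}"
  moreover from this have "keys (c * a) \<subseteq> U"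
    using assms by (intro keys_mult_subset) auto
  ultimately show "c * a \<in> {p \<in> S. keys p \<subseteq> U}"
    by (simp add: mult_mem)
qed (auto simp: mem)

text \<open>Elements chosen between consecutive primes are algebraically independent modulo the
  first prime. Their products with exponents up to \<open>N\<close> give \<open>(N + 1) ^ r\<close>
  independent elements in a space whose dimension grows only like \<open>N ^ d\<close>.\<close>

lemma prime_chain_length_le:
  assumes count: "\<And>N. finite {e. keys e \<subseteq> V \<and> e \<notin> U \<and> (\<forall>v. lookup e v \<le> N)}"
      "\<And>N. card {e. keys e \<subseteq> V \<and> e \<notin> U \<and> (\<forall>v. lookup e v \<le> N)} \<le> a * Suc N ^ d"
    and Ps: "length Ps = Suc r" "\<And>P. P \<in> set Ps \<Longrightarrow> prime_idl P \<and> mono_ideal U \<subseteq> P" "sorted_wrt (\<subset>) Ps"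
  shows "r \<le> d"
proof (rule ccontr)
  assume "\<not> r \<le> d"
  then have "Suc d \<le> r" by simp
  have "\<exists>f. f \<in> Ps ! Suc i - Ps ! i" if "i < r" for i
    using sorted_wrt_nth_less[OF Ps(3), of i "Suc i"] Ps(1) that by (intro psubset_imp_ex_mem) auto
  then obtain F where F: "\<And>i. i < r \<Longrightarrow> F i \<in> Ps ! Suc i - Ps ! i" by metis
  define fs where "fs = map F [0..<r]"
  have fs: "length fs = r" "\<And>i. i < r \<Longrightarrow> fs ! i \<in> Ps ! Suc i - Ps ! i" using F by (auto simp: fs_def)
  have fsS: "set fs \<subseteq> S"
  proof
    fix g assume "g \<in> set fs"
    then obtain i where i: "i < r" "g = fs ! i" by (auto simp: in_set_conv_nth fs)
    then have "g \<in> Ps ! Suc i" using fs(2) by auto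
    moreover have "Ps ! Suc i \<in> set Ps" using i Ps(1) by (intro nth_mem) auto
    ultimately show "g \<in> S" using Ps(2) prime_idl_ideal is_ideal_mem by blast
  qed
  have hd_mem: "hd Ps \<in> set Ps" using Ps(1) by (cases Ps) auto
  obtain D where D: "\<And>f. f \<in> set fs \<Longrightarrow> degrees_le D f" using exists_degrees_le[of "set fs"] by auto
  interpret vs: vector_space "\<lambda>c p. const c * p"
    by standard (simp_all add: single_add distrib_left distrib_right mult_single flip: mult.assoc)
  \<comment> \<open>With this \<open>N\<close>, \<open>a * ((r * D + 1) * (N + 1)) ^ d\<close>
    equals \<open>N * (N + 1) ^ d\<close>, which is less than \<open>(N + 1) ^ (d + 1)\<close>.
    \<open>M\<close> bounds the exponents in all the products indexed by \<open>T\<close>.\<close>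
  define N where "N = a * Suc (r * D) ^ d"
  define M where "M = r * N * D"
  define B where "B = {e. keys e \<subseteq> V \<and> e \<notin> U \<and> (\<forall>v. lookup e v \<le> M)}"
  define T where "T = {ns. set ns \<subseteq> {..N} \<and> length ns = r}"
  have T: "finite T" "card T = Suc N ^ r"
    unfolding T_def using card_lists_length_eq[of "{..N}" r] finite_lists_length_eq[of "{..N}" r] by auto
  \<comment> \<open>The part supported off \<open>U\<close>. What is cut away lies in
    \<open>mono_ideal U\<close>, hence in the first prime of the chain.\<close>
  define u where "u ns = restr (- U) (power_product fs ns)" for ns
  have indep: "c ns = 0" if c: "(\<Sum>ns\<in>T. const (c ns) * u ns) = 0" and ns: "ns \<in> T" for c ns
  proof (rule ccontr)
    assume "c ns \<noteq> 0"
    have "(\<Sum>ns\<in>T. const (c ns) * power_product fs ns)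
        = (\<Sum>ns\<in>T. const (c ns) * u ns) + (\<Sum>ns\<in>T. const (c ns) * restr U (power_product fs ns))"
      unfolding sum.distrib[symmetric] distrib_left[symmetric] u_def
      by (simp add: restr_split[of "- U", simplified])
    moreover have "const (c ns) * restr U (power_product fs ns) \<in> mono_ideal U" for ns
      unfolding mono_ideal_def using fsS keys_single_mult[of 0 "c ns" "restr U (power_product fs ns)"]
      by (auto simp: keys_restr intro!: mult_mem const_S restr_poly_on power_product_S)
    then have "(\<Sum>ns\<in>T. const (c ns) * restr U (power_product fs ns)) \<in> hd Ps"
      using Ps(2)[OF hd_mem] by (intro is_ideal_sum prime_idl_ideal) auto
    ultimately have "(\<Sum>ns\<in>T. const (c ns) * power_product fs ns) \<in> hd Ps" using c by simp
    moreover have "(\<Sum>ns\<in>T. const (c ns) * power_product fs ns) \<notin> hd Ps"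
      using Ps fs T(1) ns \<open>c ns \<noteq> 0\<close>
      by (intro prime_chain_independent) (auto simp: T_def)
    ultimately show False by simp
  qed
  have inj: "inj_on u T"
  proof (rule inj_onI, rule ccontr)
    fix ns ms assume *: "ns \<in> T" "ms \<in> T" "u ns = u ms" "ns \<noteq> ms"
    define c where "c xs = (if xs = ns then 1 else if xs = ms then -1 else 0 :: 'k)" for xs
    have "(\<Sum>xs\<in>T. const (c xs) * u xs) = (\<Sum>xs\<in>{ns, ms}. const (c xs) * u xs)"
      using T * by (intro sum.mono_neutral_right) (auto simp: c_def)
    also have "\<dots> = 0" using * by (simp add: c_def single_uminus)
    finally have "c ns = 0" using * indep by blast
    then show False by (simp add: c_def)
  qed
  have "vs.independent (u ` T)"
  proof (rule vs.independent_if_scalars_zero)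
    fix f x assume "(\<Sum>x\<in>u ` T. const (f x) * x) = 0" "x \<in> u ` T"
    then show "f x = 0" using indep[of "\<lambda>ns. f (u ns)"] by (auto simp: sum.reindex[OF inj])
  qed (use T in simp)
  moreover have "u ` T \<subseteq> vs.span ((\<lambda>e. single e 1) ` B)"
  proof
    fix x assume "x \<in> u ` T"
    then obtain ns where ns: "ns \<in> T" "x = u ns" by auto
    have "sum_list ns \<le> r * N"
      using sum_list_mono[of ns "\<lambda>x. x" "\<lambda>_. N"] ns(1) by (auto simp: T_def sum_list_triv)
    then have "degrees_le M (power_product fs ns)"
      using degrees_le_mono[OF degrees_le_power_product[OF D], of fs ns M] ns(1)
      by (auto simp: T_def fs(1) M_def)
    then have "keys x \<subseteq> B"
      using power_product_S[OF fsS, of ns] unfolding ns(2) u_def keys_restr B_def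
      by (auto simp: degrees_le_def poly_on_def)
    then have "(\<Sum>e\<in>keys x. const (lookup x e) * single e 1)
        \<in> vs.span ((\<lambda>e. single e 1) ` B)"
      by (intro vs.span_sum vs.span_scale vs.span_base) auto
    then show "x \<in> vs.span ((\<lambda>e. single e 1) ` B)"
      using sum_single_lookup[of x] by (simp add: mult_single)
  qed
  ultimately have "card (u ` T) \<le> card ((\<lambda>e. single e (1::'k)) ` B)"
    using vs.independent_span_bound count(1)[of M] by (auto simp: B_def)
  then have "Suc N ^ r \<le> card B"
    using card_image[OF inj] T(2) card_image_le[of B "\<lambda>e. single e (1::'k)"] count(1)[of M]
    by (simp add: B_def)
  also have "\<dots> \<le> a * Suc M ^ d" using count(2)[of M] by (simp add: B_def)
  also have "\<dots> \<le> a * (Suc (r * D) * Suc N) ^ d"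
    by (intro mult_left_mono power_mono) (auto simp: M_def algebra_simps)
  also have "\<dots> = N * Suc N ^ d" by (simp add: N_def power_mult_distrib mult.assoc del: power_Suc mult_Suc mult_Suc_right)
  also have "\<dots> < Suc N ^ Suc d" by simp
  also have "\<dots> \<le> Suc N ^ r" using \<open>Suc d \<le> r\<close> by (intro power_increasing) auto
  finally show False by simp
qed

end

section \<open>Gradings and monic polynomials in one variable\<close>

context comm_subring
begin

lemma rseq_cong:
  assumes "is_ideal J" "list_all2 (\<lambda>f g. f \<in> C \<and> g \<in> C \<and> f - g \<in> J) fs gs"
  shows "rseq J fs \<longleftrightarrow> rseq J gs"
proof -
  have "rseq K fs \<longleftrightarrow> rseq K gs" if "is_ideal K" "J \<subseteq> K" for K
    using assms(2) that
  proof (induction fs gs arbitrary: K rule: list_all2_induct)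
    case (Cons f fs g gs)
    have "f - g \<in> K" "f \<in> C" using Cons by auto
    then have "adj K f = adj K g" "nzd K f \<longleftrightarrow> nzd K g"
      using adj_cong[OF Cons.prems(1)] nzd_cong[OF Cons.prems(1)] by blast+
    moreover have "rseq (adj K f) fs \<longleftrightarrow> rseq (adj K f) gs"
      using Cons.prems \<open>f \<in> C\<close> adj_superset[of K f] by (intro Cons.IH is_ideal_adj) auto
    ultimately show ?case by simp
  qed simp
  then show ?thesis using assms(1) by blast
qed

end

context poly_ring
begin

text \<open>The weight is arbitrary here; the applications take the exponent of one variable, which
  gives a grading for each vertex.\<close>

definition homog :: "(('v \<Rightarrow>\<^sub>0 nat) \<Rightarrow> nat) \<Rightarrow> nat \<Rightarrow> ('v, 'k) mpoly \<Rightarrow> bool" where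
  "homog w n p \<longleftrightarrow> (\<forall>e\<in>keys p. w e = n)"

definition comp :: "(('v \<Rightarrow>\<^sub>0 nat) \<Rightarrow> nat) \<Rightarrow> nat \<Rightarrow> ('v, 'k) mpoly \<Rightarrow> ('v, 'k) mpoly" where
  "comp w n = restr {e. w e = n}"

definition graded :: "(('v \<Rightarrow>\<^sub>0 nat) \<Rightarrow> nat) \<Rightarrow> ('v, 'k) mpoly set \<Rightarrow> bool" where
  "graded w J \<longleftrightarrow> (\<forall>p\<in>J. \<forall>n. comp w n p \<in> J)"

lemma comp_S: "p \<in> S \<Longrightarrow> comp w n p \<in> S"
  by (simp add: comp_def restr_poly_on)

lemma comp_add: "comp w n (p + q) = comp w n p + comp w n q"
  by (simp add: comp_def restr_add)

lemma comp_diff: "comp w n (p - q) = comp w n p - comp w n q"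
  by (simp add: comp_def restr_diff)

lemma comp_sum: "comp w n (sum f A) = (\<Sum>i\<in>A. comp w n (f i))"
  by (simp add: comp_def restr_sum)

lemma graded_mono_ideal: "graded w (mono_ideal U)"
  by (auto simp: graded_def mono_ideal_def comp_def keys_restr restr_poly_on)

lemma comps_mem_imp_mem:
  assumes "is_ideal J" "\<And>n. comp w n p \<in> J" shows "p \<in> J"
proof -
  have "p = (\<Sum>n\<in>w ` keys p. comp w n p)"
  proof (rule poly_mapping_eqI)
    fix e
    have "lookup (\<Sum>n\<in>w ` keys p. comp w n p) e
        = (\<Sum>n\<in>w ` keys p. if n = w e then lookup p e else 0)"
      unfolding lookup_sum comp_def by (intro sum.cong) (auto simp: lookup_restr when_def)
    then show "lookup p e = lookup (\<Sum>n\<in>w ` keys p. comp w n p) e"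
      by (auto simp: in_keys_iff)
  qed
  then show ?thesis using is_ideal_sum[OF assms(1), of "w ` keys p" "\<lambda>n. comp w n p"] assms(2)
    by simp
qed

lemma comp_eventually_zero: "\<exists>N. \<forall>n\<ge>N. comp w n p = 0"
proof -
  have "comp w n p = 0" if n: "n \<ge> Suc (Max (insert 0 (w ` keys p)))" for n
  proof -
    have "w e < n" if e: "e \<in> keys p" for e
    proof -
      have "w e \<le> Max (insert 0 (w ` keys p))" using e by (intro Max_ge) auto
      then show ?thesis using n by simp
    qed
    then show ?thesis unfolding comp_def by (intro restr_eq_zero) auto
  qed
  then show ?thesis by blast
qed

context
  fixes w :: "('v \<Rightarrow>\<^sub>0 nat) \<Rightarrow> nat"
  assumes w_add: "w (d + e) = w d + w e"
begin

lemma comp_mult_homog: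
  assumes "homog w m h"
  shows "comp w n (p * h) = (if m \<le> n then comp w (n - m) p * h else 0)"
proof -
  have keys: "keys (q * h) \<subseteq> {e. w e \<in> (\<lambda>e. w e + m) ` keys q}" for q
    using assms by (intro keys_mult_subset) (auto simp: homog_def w_add)
  show ?thesis
  proof (cases "m \<le> n")
    case True
    define A where "A = comp w (n - m) p"
    define B where "B = restr (- {e. w e = n - m}) p"
    have "p * h = A * h + B * h"
      using restr_split[of "{e. w e = n - m}" p] by (simp add: A_def B_def comp_def flip: distrib_right)
    moreover have "comp w n (A * h) = A * h"
      unfolding comp_def using keys[of A] True by (intro restr_id) (auto simp: A_def comp_def keys_restr)
    moreover have "comp w n (B * h) = 0"
      unfolding comp_def using keys[of B] True by (intro restr_eq_zero) (auto simp: B_def keys_restr)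
    ultimately show ?thesis using True by (simp add: comp_add A_def)
  next
    case False
    then have "comp w n (p * h) = 0"
      unfolding comp_def using keys[of p] by (intro restr_eq_zero) auto
    then show ?thesis using False by simp
  qed
qed

lemma graded_adj:
  assumes "is_ideal J" "graded w J" "f \<in> S" "homog w 0 f" shows "graded w (adj J f)"
  unfolding graded_def
proof (intro ballI allI)
  fix p n assume "p \<in> adj J f"
  then obtain j c where "j \<in> J" "c \<in> S" "p = j + c * f" by (rule adjE)
  then show "comp w n p \<in> adj J f"
    using assms adjI[of "comp w n j" J "comp w n c" f]
    by (simp add: comp_add comp_mult_homog comp_S graded_def)
qed

text \<open>In degree \<open>n\<close> the hypothesis says that \<open>x\<close> times the component
  of \<open>a\<close> of degree \<open>n - 1\<close> is congruent to the component of degree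
  \<open>n\<close>. Starting from degree \<open>0\<close>, all components of \<open>a\<close> lie in
  \<open>J\<close>.\<close>

lemma nzd_minus_one:
  assumes J: "is_ideal J" "graded w J" and x: "x \<in> S" "homog w 1 x" shows "nzd J (x - 1)"
  unfolding nzd_def
proof (intro ballI impI)
  fix a assume a: "a \<in> S" "a * (x - 1) \<in> J"
  have *: "comp w n (a * x) - comp w n a \<in> J" for n
    using a J(2) by (auto simp: graded_def right_diff_distrib comp_diff dest!: bspec)
  have "comp w n a \<in> J" for n
  proof (induction n)
    case 0
    then show ?case using *[of 0] is_ideal_uminus[OF J(1)] by (force simp: comp_mult_homog[OF x(2)])
  next
    case (Suc n)
    have 1: "comp w n a * x \<in> J" using Suc x J(1) by (intro is_ideal_mult_right)
    have 2: "comp w n a * x - comp w (Suc n) a \<in> J"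
      using *[of "Suc n"] by (simp add: comp_mult_homog[OF x(2)])
    show ?case using is_ideal_diff[OF J(1) 1 2] by simp
  qed
  then show "a \<in> J" using comps_mem_imp_mem[OF J(1)] by blast
qed

lemma homog_power: "homog w 1 x \<Longrightarrow> homog w n (x ^ n)"
proof (induction n)
  case 0
  then show ?case using w_add[of 0 0] by (simp add: homog_def)
next
  case (Suc n)
  then have "keys (x * x ^ n) \<subseteq> {e. w e = Suc n}"
    by (intro keys_mult_subset) (auto simp: homog_def w_add)
  then show ?case by (auto simp: homog_def)
qed

lemma homog_mult_const: "homog w n p \<Longrightarrow> homog w n (const c * p)"
  using keys_single_mult[of 0 c p] by (auto simp: homog_def)

text \<open>Descending induction on the degree. In degree \<open>n + D\<close> the product contains
  \<open>comp w n a * x ^ D\<close>; its other terms involve components of \<open>a\<close> of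
  degree above \<open>n\<close>, already known to lie in \<open>J\<close>.\<close>

lemma nzd_monic:
  assumes J: "is_ideal J" "graded w J" and x: "x \<in> S" "homog w 1 x" "nzd J x" and g: "lead_coeff g = 1"
  shows "nzd J (poly (map_poly const g) x)"
  unfolding nzd_def
proof (intro ballI impI)
  define D where "D = degree g"
  define f where "f = (\<Sum>i\<le>D. const (coeff g i) * x ^ i)"
  have f: "poly (map_poly const g) x = f"
  proof -
    have "degree (map_poly const g) = D" unfolding D_def by (rule degree_map_poly) (simp flip: keys_eq_empty)
    then show ?thesis by (simp add: poly_altdef f_def coeff_map_poly)
  qed
  fix a assume a: "a \<in> S" "a * poly (map_poly const g) x \<in> J"
  have nzdD: "b \<in> J" if "b \<in> S" "b * x ^ n \<in> J" for b n
    using that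
  proof (induction n)
    case (Suc n)
    then have "(b * x ^ n) * x \<in> J" by (simp add: mult_ac)
    then have "b * x ^ n \<in> J" using x(3) mult_mem[OF Suc.prems(1) power_S[OF x(1)]] unfolding nzd_def by blast
    then show ?case using Suc.IH Suc.prems(1) by blast
  qed simp
  obtain N where N: "\<And>n. n \<ge> N \<Longrightarrow> comp w n a = 0" using comp_eventually_zero[of w a] by auto
  have "comp w n a \<in> J" for n
  proof (induction "N - n" arbitrary: n rule: less_induct)
    case less
    show ?case
    proof (cases "n < N")
      case True
      have hom: "homog w i (const (coeff g i) * x ^ i)" for i
        using homog_mult_const[OF homog_power[OF x(2)]] .
      have "comp w (n + D) (a * f) = (\<Sum>i\<le>D. comp w (n + D) (a * (const (coeff g i) * x ^ i)))"
        by (simp add: f_def sum_distrib_left comp_sum)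
      also have "\<dots> = (\<Sum>i\<le>D. comp w (n + D - i) a * (const (coeff g i) * x ^ i))"
        by (intro sum.cong) (auto simp: comp_mult_homog[OF hom])
      also have "\<dots> = (\<Sum>i<D. comp w (n + D - i) a * (const (coeff g i) * x ^ i)) + comp w n a * x ^ D"
        using g by (simp add: D_def flip: lessThan_Suc_atMost)
      finally have eq: "comp w (n + D) (a * f)
          = (\<Sum>i<D. comp w (n + D - i) a * (const (coeff g i) * x ^ i)) + comp w n a * x ^ D" .
      have "(\<Sum>i<D. comp w (n + D - i) a * (const (coeff g i) * x ^ i)) \<in> J"
        using True x(1) J(1) 
        by (intro is_ideal_sum[OF J(1)] is_ideal_mult_right[OF J(1)] less mult_mem const_S power_S) auto
      moreover have "comp w (n + D) (a * f) \<in> J" using a(2) J(2) unfolding f graded_def by blast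
      ultimately have "comp w n a * x ^ D \<in> J" 
        unfolding eq by (subst (asm) add.commute) (simp add: is_ideal_add_iff[OF J(1)])
      then show ?thesis using nzdD comp_S[OF a(1)] by blast
    qed (use N[of n] is_ideal_zero[OF J(1)] in auto)
  qed
  then show "a \<in> J" using comps_mem_imp_mem[OF J(1)] by blast
qed

end

abbreviation var :: "'v \<Rightarrow> ('v, 'k) mpoly" where
  "var \<equiv> variable"

abbreviation expo :: "'v \<Rightarrow> ('v \<Rightarrow>\<^sub>0 nat) \<Rightarrow> nat" where
  "expo v e \<equiv> lookup e v"

lemma var_S: "v \<in> V \<Longrightarrow> var v \<in> S"
  by (simp add: variable_def single_poly_on)

lemma homog_var: "homog (expo v) 1 (var v)"
  by (simp add: homog_def variable_def)

lemma homog_var_other: "u \<noteq> v \<Longrightarrow> homog (expo v) 0 (var u)"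
  by (simp add: homog_def variable_def lookup_single)

lemma homog_zero_subring: "comm_subring {p \<in> S. homog (expo v) 0 p}"
proof
  fix p q assume "p \<in> {p \<in> S. homog (expo v) 0 p}" "q \<in> {p \<in> S. homog (expo v) 0 p}"
  then show "p - q \<in> {p \<in> S. homog (expo v) 0 p}" "p * q \<in> {p \<in> S. homog (expo v) 0 p}"
    using keys_diff[of p q] keys_mult[of p q] by (fastforce simp: homog_def mem lookup_add)+
qed (auto simp: homog_def mem)

lemma poly_const_mem:
  assumes "comm_subring T" "\<And>c. const c \<in> T" "x \<in> T" shows "poly (map_poly const g) x \<in> T"
proof -
  interpret T: comm_subring T by fact
  show ?thesis
    by (induction g) (simp_all add: map_poly_pCons T.mem assms)
qed

lemma poly_const_cong:
  assumes "is_ideal J" "x \<in> S" "y \<in> S" "x - y \<in> J"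
  shows "poly (map_poly const g) x - poly (map_poly const g) y \<in> J"
proof (induction g)
  case (pCons a p)
  have "x * (poly (map_poly const p) x - poly (map_poly const p) y) + poly (map_poly const p) y * (x - y) \<in> J"
    using assms pCons comm_subring_axioms const_S
    by (intro is_ideal_add is_ideal_mult poly_const_mem) auto
  then show ?case using pCons by (simp add: map_poly_pCons algebra_simps)
qed (simp add: is_ideal_zero[OF assms(1)])

text \<open>A polynomial homogeneous of positive degree in \<open>v\<close> is divisible by
  \<open>var v\<close>. Comparing components of \<open>b * var v = j + c * f\<close>, where
  \<open>f\<close> has degree \<open>0\<close>, therefore allows \<open>var v\<close> to be
  cancelled.\<close>

lemma nzd_adj_var:
  assumes J: "is_ideal J" "graded (expo v) J" "nzd J (var v)" and v: "v \<in> V"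
    and f: "f \<in> S" "homog (expo v) 0 f"
  shows "nzd (adj J f) (var v)"
  unfolding nzd_def
proof (intro ballI impI)
  fix b assume b: "b \<in> S" "b * var v \<in> adj J f"
  then obtain j c where jc: "j \<in> J" "c \<in> S" "b * var v = j + c * f" by (meson adjE)
  have w: "expo v (d + e) = expo v d + expo v e" for d e by (simp add: lookup_add)
  show "b \<in> adj J f"
  proof (rule comps_mem_imp_mem[OF is_ideal_adj[OF J(1) f(1)]])
    fix n
    define q where "q = comp (expo v) (Suc n) c"
    \<comment> \<open>The quotient of \<open>q\<close> by \<open>var v\<close>, which exists because
      every exponent of \<open>q\<close> has degree \<open>Suc n\<close> in
      \<open>v\<close>.\<close>
    define q' where "q' = (\<Sum>e\<in>keys q. single (e - single v 1) (lookup q e))"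
    have "keys e \<subseteq> V" if "e \<in> keys q" for e
      using that jc(2) by (auto simp: q_def comp_def keys_restr poly_on_def)
    then have q'S: "q' \<in> S" unfolding q'_def
      by (intro sum_S single_poly_on) (fastforce simp: in_keys_iff lookup_minus)
    have "(e - single v 1) + single v 1 = e" if "e \<in> keys q" for e
    proof (rule poly_mapping_eqI)
      have "expo v e = Suc n" using that by (auto simp: q_def comp_def keys_restr)
      then show "lookup (e - single v 1 + single v 1) k = lookup e k" for k
        by (auto simp: lookup_add lookup_minus lookup_single when_def)
    qed
    then have "q' * var v = q"
      using sum_single_lookup[of q] by (simp add: q'_def sum_distrib_right variable_def mult_single)
    moreover have "comp (expo v) n b * var v = comp (expo v) (Suc n) j + q * f"
      using arg_cong[OF jc(3), of "comp (expo v) (Suc n)"]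
      by (simp add: comp_mult_homog[OF w homog_var] comp_add comp_mult_homog[OF w f(2)] q_def)
    ultimately have "(comp (expo v) n b - q' * f) * var v = comp (expo v) (Suc n) j"
      by (simp add: algebra_simps)
    moreover have "comp (expo v) (Suc n) j \<in> J" using jc(1) J(2) by (auto simp: graded_def)
    ultimately have "comp (expo v) n b - q' * f \<in> J"
      using J(3) comp_S[OF b(1)] q'S f(1) by (simp add: nzd_def mem)
    then show "comp (expo v) n b \<in> adj J f" using adjI[of "comp (expo v) n b - q' * f" J q' f] q'S by simp
  qed
qed

text \<open>Each polynomial involves its own variable only and has degree \<open>0\<close> in the
  others, so adjoining it preserves the gradings and the nonzerodivisors for the variables still to
  come.\<close>

lemma rseq_monic_vars:
  assumes "is_ideal J" "distinct (map fst vgs)"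
    and "\<And>v g. (v, g) \<in> set vgs \<Longrightarrow> v \<in> V \<and> lead_coeff g = 1 \<and> graded (expo v) J \<and> nzd J (var v)"
  shows "rseq J (map (\<lambda>(v, g). poly (map_poly const g) (var v)) vgs)"
  using assms
proof (induction vgs arbitrary: J)
  case (Cons vg vgs)
  obtain v g where vg: "vg = (v, g)" by (cases vg)
  define f where "f = poly (map_poly const g) (var v)"
  have v: "v \<in> V" "lead_coeff g = 1" "graded (expo v) J" "nzd J (var v)" using Cons.prems(3)[of v g] vg by auto
  have w: "expo u (d + e) = expo u d + expo u e" for u d e by (simp add: lookup_add)
  have fS: "f \<in> S" unfolding f_def using v var_S const_S comm_subring_axioms by (intro poly_const_mem)
  have "nzd J f" unfolding f_def using v var_S homog_var Cons.prems(1) by (intro nzd_monic[OF w]) auto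
  moreover have "rseq (adj J f) (map (\<lambda>(v, g). poly (map_poly const g) (var v)) vgs)"
  proof (rule Cons.IH)
    show "is_ideal (adj J f)" using Cons.prems(1) fS by (rule is_ideal_adj)
    show "distinct (map fst vgs)" using Cons.prems(2) by simp
    fix u h assume uh: "(u, h) \<in> set vgs"
    then have u: "u \<in> V" "lead_coeff h = 1" "graded (expo u) J" "nzd J (var u)" using Cons.prems(3)[of u h] by auto
    have "u \<noteq> v" using uh Cons.prems(2) vg by (force simp: image_iff)
    then have "f \<in> {p \<in> S. homog (expo u) 0 p}" unfolding f_def
      using v(1) const_S homog_var_other[of v u]
      by (intro poly_const_mem[OF homog_zero_subring]) (simp_all add: var_S homog_def[of _ _ "const _"])
    then have "homog (expo u) 0 f" by simp
    then show "u \<in> V \<and> lead_coeff h = 1 \<and> graded (expo u) (adj J f) \<and> nzd (adj J f) (var u)"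
      using u graded_adj[of "expo u", OF lookup_add Cons.prems(1)] nzd_adj_var[OF Cons.prems(1)] fS by blast
  qed
  ultimately show ?case by (simp add: vg f_def)
qed simp

end

section \<open>Stanley--Reisner ideals\<close>

context poly_ring
begin

sublocale const: coeff_hom "const"
  by (rule coeff_hom_const)

abbreviation ev :: "('v \<Rightarrow> ('v, 'k) mpoly) \<Rightarrow> ('v, 'k) mpoly \<Rightarrow> ('v, 'k) mpoly" where
  "ev \<equiv> const.mp_eval"

lemmas ev_simps = const.mp_eval_add const.mp_eval_diff const.mp_eval_mult const.mp_eval_zero
  const.mp_eval_one const.mp_eval_const

lemma ev_var: "ev \<sigma> (var v) = \<sigma> v"
  unfolding variable_def by (rule const.mp_eval_var)

lemma ev_sum: "ev \<sigma> (sum f A) = (\<Sum>i\<in>A. ev \<sigma> (f i))"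
  by (induction A rule: infinite_finite_induct) (simp_all add: ev_simps)

lemma ev_prod: "ev \<sigma> (prod f A) = (\<Prod>i\<in>A. ev \<sigma> (f i))"
  by (induction A rule: infinite_finite_induct) (simp_all add: ev_simps)

lemma ev_power: "ev \<sigma> (p ^ n) = ev \<sigma> p ^ n"
  by (induction n) (simp_all add: ev_simps)

lemma ev_ev: "ev \<tau> (ev \<sigma> p) = ev (\<lambda>v. ev \<tau> (\<sigma> v)) p"
  unfolding const.mp_eval_def[of \<sigma> p] const.mp_eval_def[of "\<lambda>v. ev \<tau> (\<sigma> v)" p]
  by (simp add: ev_sum ev_simps const.mon_eval_def ev_prod ev_power)

lemma var_power: "var v ^ n = single (single v n) 1"
  by (induction n) (simp_all add: variable_def mult_single flip: single_add)

lemma prod_single: "finite A \<Longrightarrow> (\<Prod>v\<in>A. single (f v) (1::'k)) = single (\<Sum>v\<in>A. f v) 1"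
  for f :: "'u \<Rightarrow> 'v \<Rightarrow>\<^sub>0 nat"
  by (induction A rule: finite_induct) (simp_all add: mult_single)

lemma mon_eval_var: "const.mon_eval var e = single e 1"
  using sum_single_lookup[of e] by (simp add: const.mon_eval_def var_power prod_single)

lemma ev_id: "ev var p = p"
  using sum_single_lookup[of p] by (simp add: const.mp_eval_def mon_eval_var mult_single)

lemma ev_cong:
  assumes "p \<in> S" "\<And>v. v \<in> V \<Longrightarrow> \<sigma> v = \<tau> v" shows "ev \<sigma> p = ev \<tau> p"
  unfolding const.mp_eval_def const.mon_eval_def
  using assms by (intro sum.cong arg_cong2[of _ _ _ _ "(*)"] prod.cong) (force simp: poly_on_def)+

lemma ev_restr: "ev (\<lambda>v. if v \<in> F then var v else 0) p = restr {e. keys e \<subseteq> F} p"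
proof -
  have mon: "const.mon_eval (\<lambda>v. if v \<in> F then var v else 0) e
      = (if keys e \<subseteq> F then single e 1 else 0)" for e
  proof (cases "keys e \<subseteq> F")
    case True
    then have "const.mon_eval (\<lambda>v. if v \<in> F then var v else 0) e = const.mon_eval var e"
      unfolding const.mon_eval_def by (intro prod.cong) auto
    then show ?thesis using True by (simp add: mon_eval_var)
  next
    case False
    then obtain v where "v \<in> keys e" "v \<notin> F" by auto
    then have "const.mon_eval (\<lambda>v. if v \<in> F then var v else 0) e = 0"
      unfolding const.mon_eval_def
      by (intro prod_zero[OF finite_keys]) (auto simp: in_keys_iff intro!: bexI[of _ v])
    then show ?thesis using False by simp
  qed
  have "ev (\<lambda>v. if v \<in> F then var v else 0) p = (\<Sum>e\<in>keys p.
      if keys e \<subseteq> F then single e (lookup p e) else 0)"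
    unfolding const.mp_eval_def mon by (intro sum.cong) (auto simp: mult_single)
  also have "\<dots> = (\<Sum>e\<in>keys (restr {e. keys e \<subseteq> F} p).
      single e (lookup (restr {e. keys e \<subseteq> F} p) e))"
    by (intro sum.mono_neutral_cong_right) (auto simp: keys_restr lookup_restr)
  finally show ?thesis by (simp only: sum_single_lookup)
qed

text \<open>Structural induction in disguise: a property preserved by ring operations, given as the
  set \<open>T\<close>, has to be checked for constants and variables only.\<close>

lemma subring_all:
  assumes "comm_subring T" "\<And>c. const c \<in> T" "\<And>v. v \<in> V \<Longrightarrow> var v \<in> T" "p \<in> S"
  shows "p \<in> T"
  using const.mp_eval_in[OF assms(1,2), of V var p] assms(3,4) by (simp add: ev_id)

definition Ker :: "('v \<Rightarrow> ('v, 'k) mpoly) \<Rightarrow> ('v, 'k) mpoly set" where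
  "Ker \<sigma> = {p \<in> S. ev \<sigma> p = 0}"

text \<open>The values of \<open>ev \<sigma>\<close> lie in a polynomial ring over a field, an
  integral domain.\<close>

lemma prime_Ker: "prime_idl (Ker \<sigma>)"
  by (auto simp: prime_idl_def is_ideal_def Ker_def ev_simps mem)

lemma Ker_comp_subset: "(\<And>v. v \<in> V \<Longrightarrow> \<tau> v = ev \<rho> (\<sigma> v)) \<Longrightarrow> Ker \<sigma> \<subseteq> Ker \<tau>"
  using ev_cong[of _ \<tau> "\<lambda>v. ev \<rho> (\<sigma> v)"]
  by (auto simp: Ker_def ev_simps simp flip: ev_ev)

text \<open>Evaluation at a point takes values in the field of constants, where nonzero values are
  invertible.\<close>

lemma maximal_Ker_const:
  assumes "a \<in> S" "a \<notin> Ker (\<lambda>v. const (\<alpha> v))"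
  shows "\<exists>b\<in>S. 1 - a * b \<in> Ker (\<lambda>v. const (\<alpha> v))"
proof -
  have "comm_subring (range const)"
  proof
    show "1 \<in> range const" by (metis rangeI single_one)
    show "p - q \<in> range const" "p * q \<in> range const" if "p \<in> range const" "q \<in> range const" for p q
      using that by (auto simp: mult_single simp flip: single_diff)
  qed
  then have "ev (\<lambda>v. const (\<alpha> v)) a \<in> range const"
    using assms(1) by (intro const.mp_eval_in[of _ V]) auto
  then obtain c where c: "ev (\<lambda>v. const (\<alpha> v)) a = const c" by auto
  then have "c \<noteq> 0" using assms by (auto simp: Ker_def)
  then have "1 - a * const (1 / c) \<in> Ker (\<lambda>v. const (\<alpha> v))"
    using assms(1) c const_S by (simp add: Ker_def mem ev_simps mult_single)
  then show ?thesis using const_S by blast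
qed

definition down_closed :: "'v set set \<Rightarrow> bool" where
  "down_closed \<Gamma> \<longleftrightarrow> (\<forall>F\<in>\<Gamma>. \<forall>G. G \<subseteq> F \<longrightarrow> G \<in> \<Gamma>)"

text \<open>A description by monomials instead of generators;
  \<open>stanley_reisner_ideal_eq\<close> shows the agreement. For \<open>\<Gamma> = {}\<close>, the
  void complex, it is the unit ideal, where the induction over a shelling starts.\<close>

definition SR :: "'v set set \<Rightarrow> ('v, 'k) mpoly set" where
  "SR \<Gamma> = mono_ideal {e. keys e \<notin> \<Gamma>}"

lemma is_ideal_SR: "down_closed \<Gamma> \<Longrightarrow> is_ideal (SR \<Gamma>)"
  unfolding SR_def by (rule is_ideal_mono_ideal) (auto simp: keys_plus_exponent down_closed_def)

lemma SR_iff: "p \<in> SR \<Gamma> \<longleftrightarrow> p \<in> S \<and> (\<forall>e\<in>keys p. keys e \<notin> \<Gamma>)"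
  by (auto simp: SR_def mono_ideal_def)

lemma SR_Pow: "SR (Pow F) = Ker (\<lambda>v. if v \<in> F then var v else 0)"
proof -
  have "restr {e. keys e \<subseteq> F} p = 0 \<longleftrightarrow> (\<forall>e\<in>keys p. \<not> keys e \<subseteq> F)"
    for p :: "('v, 'k) mpoly"
    by (subst keys_eq_empty[symmetric]) (auto simp: keys_restr simp del: keys_eq_empty)
  then show ?thesis by (auto simp: Ker_def SR_iff ev_restr)
qed

lemma prime_SR_Pow: "prime_idl (SR (Pow F))"
  unfolding SR_Pow by (rule prime_Ker)

text \<open>Specialising the variables of the face \<open>set vs\<close> one after the other gives a chain of primes.\<close>

lemma prime_chain_face:
  assumes "distinct vs" "set vs \<in> \<Gamma>" "down_closed \<Gamma>" "set vs \<subseteq> V" "\<And>v. v \<notin> set vs \<Longrightarrow> \<alpha> v = 0"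
  shows "\<exists>Ps. length Ps = Suc (length vs) \<and> (\<forall>P\<in>set Ps. prime_idl P \<and> SR \<Gamma> \<subseteq> P)
    \<and> sorted_wrt (\<subset>) Ps \<and> last Ps = Ker (\<lambda>v. const (\<alpha> v))"
proof -
  \<comment> \<open>The first \<open>i\<close> vertices of the face take their values from
    \<open>\<alpha>\<close>, the others stay indeterminate, and vertices off the face are
    \<open>0\<close> throughout.\<close>
  define \<sigma> where "\<sigma> i v = (if v \<in> set (take i vs) then const (\<alpha> v) else if v \<in> set vs then var v else 0)" for i v
  have step: "Ker (\<sigma> i) \<subset> Ker (\<sigma> (Suc i))" if i: "i < length vs" for i
  proof
    have notin: "vs ! i \<notin> set (take i vs)"
      using assms(1) i by (auto simp: in_set_conv_nth distinct_conv_nth)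
    show "Ker (\<sigma> i) \<subseteq> Ker (\<sigma> (Suc i))"
    proof (rule Ker_comp_subset)
      fix v assume "v \<in> V"
      show "\<sigma> (Suc i) v = ev (\<lambda>u. if u = vs ! i then const (\<alpha> u) else var u) (\<sigma> i v)"
        using i nth_mem[OF i] by (auto simp: \<sigma>_def take_Suc_conv_app_nth ev_simps ev_var)
    qed
    \<comment> \<open>This polynomial vanishes under \<open>\<sigma> (Suc i)\<close> but is fixed by
      \<open>\<sigma> i\<close>, so the inclusion is strict.\<close>
    define p where "p = var (vs ! i) - const (\<alpha> (vs ! i))"
    have pS: "p \<in> S" using i assms(4) nth_mem[OF i] by (auto simp: p_def intro!: diff_mem var_S const_S)
    have "ev (\<sigma> (Suc i)) p = 0"
      using i by (simp add: p_def ev_simps ev_var \<sigma>_def take_Suc_conv_app_nth)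
    moreover have "ev (\<sigma> i) p = p"
      using i notin by (simp add: p_def ev_simps ev_var \<sigma>_def)
    moreover have "single (vs ! i) (Suc 0) \<noteq> 0" by (simp flip: keys_eq_empty)
    then have "lookup p (single (vs ! i) 1) = 1"
      by (simp add: p_def lookup_minus variable_def lookup_single)
    then have "p \<noteq> 0" by auto
    ultimately have "p \<in> Ker (\<sigma> (Suc i))" "p \<notin> Ker (\<sigma> i)" using pS by (simp_all add: Ker_def)
    then show "Ker (\<sigma> i) \<noteq> Ker (\<sigma> (Suc i))" by blast
  qed
  have "SR \<Gamma> \<subseteq> Ker (\<sigma> 0)"
  proof -
    have "SR \<Gamma> \<subseteq> SR (Pow (set vs))" using assms(2,3) unfolding SR_iff down_closed_def subset_iff Pow_iff by blast
    also have "\<sigma> 0 = (\<lambda>v. if v \<in> set vs then var v else 0)" by (simp add: \<sigma>_def fun_eq_iff)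
    then have "SR (Pow (set vs)) = Ker (\<sigma> 0)" by (simp add: SR_Pow)
    finally show ?thesis .
  qed
  moreover have mono: "Ker (\<sigma> i) \<subset> Ker (\<sigma> j)" if "i < j" "j \<le> length vs" for i j
    using that
  proof (induction j)
    case (Suc j)
    then show ?case using step[of j] by (cases "i = j") auto
  qed simp
  ultimately have sub: "SR \<Gamma> \<subseteq> Ker (\<sigma> i)" if "i \<le> length vs" for i
    using that by (cases "i = 0") (auto dest: mono[of 0 i])
  have "\<sigma> (length vs) = (\<lambda>v. const (\<alpha> v))" using assms(5) by (auto simp: \<sigma>_def)
  then have "last (map (\<lambda>i. Ker (\<sigma> i)) [0..<Suc (length vs)]) = Ker (\<lambda>v. const (\<alpha> v))" by simp
  moreover have "sorted_wrt (\<subset>) (map (\<lambda>i. Ker (\<sigma> i)) [0..<Suc (length vs)])"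
    unfolding sorted_wrt_iff_nth_less
  proof (intro allI impI)
    fix i j assume "i < j" "j < length (map (\<lambda>i. Ker (\<sigma> i)) [0..<Suc (length vs)])"
    then show "map (\<lambda>i. Ker (\<sigma> i)) [0..<Suc (length vs)] ! i \<subset> map (\<lambda>i. Ker (\<sigma> i)) [0..<Suc (length vs)] ! j"
      using mono[of i j] by (simp del: upt_Suc)
  qed
  moreover have "\<forall>P\<in>set (map (\<lambda>i. Ker (\<sigma> i)) [0..<Suc (length vs)]). prime_idl P \<and> SR \<Gamma> \<subseteq> P"
    using sub prime_Ker by (simp del: upt_Suc)
  ultimately show ?thesis
    by (intro exI[of _ "map (\<lambda>i. Ker (\<sigma> i)) [0..<Suc (length vs)]"]) simp
qed

text \<open>An exponent is determined by its support, which is a face, and by at most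
  \<open>d\<close> values up to \<open>N\<close>.\<close>

lemma SR_exponents_finite_card:
  assumes "finite \<Gamma>" "\<And>F. F \<in> \<Gamma> \<Longrightarrow> finite F \<and> card F \<le> d"
  defines "B \<equiv> \<lambda>N. {e. keys e \<subseteq> V \<and> e \<notin> {e. keys e \<notin> \<Gamma>} \<and> (\<forall>v. lookup e v \<le> N)}"
  shows "finite (B N)" "card (B N) \<le> card \<Gamma> * Suc N ^ d"
proof -
  define T where "T = (SIGMA F:\<Gamma>. F \<rightarrow>\<^sub>E {..N})"
  define \<phi> where "\<phi> e = (keys e, restrict (lookup e) (keys e))"
    for e :: "'v \<Rightarrow>\<^sub>0 nat"
  have T: "finite T" unfolding T_def using assms by (intro finite_SigmaI finite_PiE) auto
  have "inj_on \<phi> (B N)"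
  proof (rule inj_onI)
    fix a b assume "\<phi> a = \<phi> b"
    then have k: "keys a = keys b"
      and r: "restrict (lookup a) (keys a) = restrict (lookup b) (keys a)"
      by (auto simp: \<phi>_def)
    show "a = b"
    proof (rule poly_mapping_eqI)
      fix v show "lookup a v = lookup b v"
        using fun_cong[OF r, of v] k by (cases "v \<in> keys a") (auto simp: in_keys_iff)
    qed
  qed
  moreover have "\<phi> ` B N \<subseteq> T" by (auto simp: \<phi>_def T_def B_def)
  ultimately show "finite (B N)" "card (B N) \<le> card \<Gamma> * Suc N ^ d"
  proof -
    assume inj: "inj_on \<phi> (B N)" and sub: "\<phi> ` B N \<subseteq> T"
    show "finite (B N)" using finite_imageD[OF finite_subset[OF sub T] inj] .
    have "card (B N) = card (\<phi> ` B N)" using card_image[OF inj] by simp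
    also have "\<dots> \<le> card T" using card_mono[OF T sub] .
    also have "\<dots> = (\<Sum>F\<in>\<Gamma>. card (F \<rightarrow>\<^sub>E {..N}))"
      unfolding T_def using assms by (intro card_SigmaI) (auto intro: finite_PiE)
    also have "\<dots> \<le> (\<Sum>F\<in>\<Gamma>. Suc N ^ d)"
      using assms by (intro sum_mono) (simp add: card_PiE power_increasing)
    finally show "card (B N) \<le> card \<Gamma> * Suc N ^ d" by simp
  qed
qed

end

text \<open>A monomial whose support is not a face is a multiple of the squarefree generator of its
  support.\<close>

lemma stanley_reisner_ideal_eq:
  fixes \<Delta> :: "'v::linorder set set"
  assumes "abstract_simplicial_complex \<Delta>"
  shows "stanley_reisner_ideal \<Delta> = (poly_ring.SR (\<Union>\<Delta>) \<Delta> :: (('v \<Rightarrow>\<^sub>0 nat) \<Rightarrow>\<^sub>0 'k::field) set)"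
proof -
  have fin: "finite (\<Union>\<Delta>)" using assms by (auto simp: abstract_simplicial_complex_def)
  interpret poly_ring "\<Union>\<Delta>" "TYPE('k::field)" by standard fact
  have ring_eq: "poly_ring_on (\<Union>\<Delta>) = (as_ring :: ('v, 'k) mpoly ring)"
    unfolding poly_ring_on_def as_ring_def by (simp add: poly_on_def)
  interpret R: cring as_ring by (rule cring_as_ring)
  have dc: "down_closed \<Delta>" using assms by (auto simp: down_closed_def abstract_simplicial_complex_def)
  define G :: "('v, 'k) mpoly set" where "G = {\<Prod>v\<in>F. variable v |F. F \<subseteq> \<Union>\<Delta> \<and> F \<notin> \<Delta>}"
  define \<rho> where "\<rho> F = (\<Sum>v\<in>F. single v (Suc 0))" for F :: "'v set"
  have keys_\<rho>: "keys (\<rho> F) = F" and lookup_\<rho>: "lookup (\<rho> F) v = (if v \<in> F then 1 else 0)"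
    if "finite F" for F v
    using that by (simp_all add: \<rho>_def lookup_sum_single_one keys_sum_single_one)
  have prod: "(\<Prod>v\<in>F. var v) = single (\<rho> F) 1" if "finite F" for F
    using prod_single[OF that, of "\<lambda>v. single v (Suc 0)"] by (simp add: variable_def \<rho>_def)
  have GS: "G \<subseteq> carrier as_ring"
    using finite_subset[OF _ fin] by (auto simp: G_def prod intro!: single_poly_on) (auto simp: keys_\<rho>)
  have "Idl\<^bsub>as_ring\<^esub> G = SR \<Delta>"
  proof
    have "G \<subseteq> SR \<Delta>"
    proof
      fix g assume "g \<in> G"
      then obtain F where F: "F \<subseteq> \<Union>\<Delta>" "F \<notin> \<Delta>" "g = (\<Prod>v\<in>F. var v)" by (auto simp: G_def)
      have "finite F" using F(1) fin by (rule finite_subset)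
      then show "g \<in> SR \<Delta>" using F by (simp add: prod SR_iff keys_\<rho> single_poly_on)
    qed
    then show "Idl\<^bsub>as_ring\<^esub> G \<subseteq> SR \<Delta>"
      using is_ideal_SR[OF dc] ideal_as_ring_iff by (intro R.genideal_minimal) auto
    have I: "is_ideal (Idl\<^bsub>as_ring\<^esub> G)" using R.genideal_ideal[OF GS] ideal_as_ring_iff by auto
    show "SR \<Delta> \<subseteq> Idl\<^bsub>as_ring\<^esub> G"
    proof
      fix p assume p: "p \<in> SR \<Delta>"
      have "single e (lookup p e) \<in> Idl\<^bsub>as_ring\<^esub> G" if e: "e \<in> keys p" for e
      proof -
        define F where "F = keys e"
        have F: "finite F" "F \<subseteq> \<Union>\<Delta>" "F \<notin> \<Delta>" using p e by (auto simp: SR_iff poly_on_def F_def)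
        then have "(\<Prod>v\<in>F. var v) \<in> Idl\<^bsub>as_ring\<^esub> G" using R.genideal_self[OF GS] by (auto simp: G_def)
        moreover have "single (e - \<rho> F) (lookup p e) \<in> S"
          using F keys_minus_exponent[of e "\<rho> F"] by (intro single_poly_on) (auto simp: F_def)
        ultimately have "single (e - \<rho> F) (lookup p e) * (\<Prod>v\<in>F. var v) \<in> Idl\<^bsub>as_ring\<^esub> G"
          using I by (intro is_ideal_mult)
        moreover have "e - \<rho> F + \<rho> F = e"
          by (rule poly_mapping_eqI) (auto simp: lookup_add lookup_minus lookup_\<rho>[OF F(1), unfolded F_def] F_def in_keys_iff)
        ultimately show ?thesis by (simp add: prod[OF F(1)] mult_single)
      qed
      then have "(\<Sum>e\<in>keys p. single e (lookup p e)) \<in> Idl\<^bsub>as_ring\<^esub> G"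
        by (intro is_ideal_sum[OF I])
      then show "p \<in> Idl\<^bsub>as_ring\<^esub> G" by (simp only: sum_single_lookup)
    qed
  qed
  then show ?thesis by (simp add: stanley_reisner_ideal_def ring_eq G_def)
qed

section \<open>Coloured shellable complexes\<close>

lemma complex_face_in_facet:
  assumes "finite \<Delta>" "F \<in> \<Delta>" shows "\<exists>H\<in>facets \<Delta>. F \<subseteq> H"
proof -
  have "finite {G \<in> \<Delta>. F \<subseteq> G}" "{G \<in> \<Delta>. F \<subseteq> G} \<noteq> {}" using assms by auto
  then obtain H where "H \<in> {G \<in> \<Delta>. F \<subseteq> G}" "\<And>G. G \<in> {G \<in> \<Delta>. F \<subseteq> G} \<Longrightarrow> H \<subseteq> G \<Longrightarrow> H = G"
    using finite_has_maximal[of "{G \<in> \<Delta>. F \<subseteq> G}"] by metis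
  then have "H \<in> facets \<Delta>" "F \<subseteq> H" unfolding facets_def by blast+
  then show ?thesis by blast
qed

lemma facet_card_complex_dim:
  assumes "finite \<Delta>" "\<And>F. F \<in> \<Delta> \<Longrightarrow> finite F" "pure_complex \<Delta>" "H \<in> facets \<Delta>"
  shows "int (card H) = complex_dim \<Delta> + 1"
proof -
  have "H \<in> \<Delta>" using assms(4) by (auto simp: facets_def)
  have "Max (card ` \<Delta>) = card H"
  proof (rule Max_eqI)
    fix n assume "n \<in> card ` \<Delta>"
    then obtain F where F: "F \<in> \<Delta>" "n = card F" by auto
    obtain G where G: "G \<in> facets \<Delta>" "F \<subseteq> G" using complex_face_in_facet[OF assms(1) F(1)] by auto
    have "finite G" using G(1) assms(2)[of G] by (simp add: facets_def)
    then have "card F \<le> card G" using G(2) by (intro card_mono)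
    moreover have "card G = card H" using assms(3,4) G(1) unfolding pure_complex_def by blast
    ultimately show "n \<le> card H" using F(2) by simp
  qed (use assms \<open>H \<in> \<Delta>\<close> in auto)
  then show ?thesis by (simp add: complex_dim_def)
qed

text \<open>The set on the right is the restriction of the facet in the shelling. As the
  intersection with the earlier facets is pure of codimension one, an old face lies in an old
  \<open>Fs ! i - {v}\<close> and so misses the vertex \<open>v\<close> of the restriction.\<close>

lemma shelling_restriction:
  assumes sc: "abstract_simplicial_complex \<Delta>" "pure_complex \<Delta>"
    and Fs: "set Fs = facets \<Delta>" "i < length Fs"
    and shell: "0 < i \<Longrightarrow> pure_complex ((\<Union>j<i. Pow (Fs ! j)) \<inter> Pow (Fs ! i)) \<and>
       complex_dim ((\<Union>j<i. Pow (Fs ! j)) \<inter> Pow (Fs ! i)) = complex_dim \<Delta> - 1"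
    and G: "G \<subseteq> Fs ! i"
  shows "G \<in> (\<Union>j<i. Pow (Fs ! j)) \<longleftrightarrow>
    \<not> {v \<in> Fs ! i. Fs ! i - {v} \<in> (\<Union>j<i. Pow (Fs ! j))} \<subseteq> G"
proof
  let ?\<Gamma> = "\<Union>j<i. Pow (Fs ! j)" and ?F = "Fs ! i"
  assume "\<not> {v \<in> ?F. ?F - {v} \<in> ?\<Gamma>} \<subseteq> G"
  then obtain v where v: "?F - {v} \<in> ?\<Gamma>" "v \<notin> G" by auto
  then have "G \<subseteq> ?F - {v}" using G by auto
  then show "G \<in> ?\<Gamma>" using v by fastforce
next
  let ?\<Gamma> = "\<Union>j<i. Pow (Fs ! j)" and ?F = "Fs ! i"
  assume g: "G \<in> ?\<Gamma>"
  then have i: "0 < i" by (cases i) auto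
  have F: "?F \<in> facets \<Delta>" using Fs nth_mem by blast
  have finF: "finite ?F" "finite \<Delta>" "\<And>F. F \<in> \<Delta> \<Longrightarrow> finite F" 
    using F sc by (auto simp: facets_def abstract_simplicial_complex_def)
  obtain H where H: "H \<in> facets (?\<Gamma> \<inter> Pow ?F)" "G \<subseteq> H"
    using complex_face_in_facet[of "?\<Gamma> \<inter> Pow ?F" G] g G finF(1) by auto
  have "int (card H) = complex_dim (?\<Gamma> \<inter> Pow ?F) + 1"
    using shell[OF i] finF(1) H(1) by (intro facet_card_complex_dim) (auto intro: finite_subset)
  moreover have "int (card ?F) = complex_dim \<Delta> + 1"
    using facet_card_complex_dim[OF finF(2,3) sc(2) F] by simp
  ultimately have card: "Suc (card H) = card ?F" using shell[OF i] by simp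
  have HF: "H \<subseteq> ?F" "H \<in> ?\<Gamma>" using H by (auto simp: facets_def)
  then have "card (?F - H) = 1" using card finF(1) by (simp add: card_Diff_subset finite_subset)
  then obtain v where v: "?F - H = {v}" by (auto simp: card_1_singleton_iff)
  then have *: "?F - {v} = H" "v \<in> ?F" "v \<notin> H" using HF by auto
  then have "v \<in> {v \<in> ?F. ?F - {v} \<in> ?\<Gamma>}" "v \<notin> G" using HF(2) H(2) by auto
  then show "\<not> {v \<in> ?F. ?F - {v} \<in> ?\<Gamma>} \<subseteq> G" by blast
qed

context poly_ring
begin

text \<open>Over the zero module every sequence qualifies; this is the base of the induction over a
  shelling.\<close>

lemma rseq_carrier: "set fs \<subseteq> S \<Longrightarrow> rseq S fs"
proof (induction fs)
  case (Cons f fs)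
  have "adj S f = S" using adj_superset[of S f] is_ideal_subset[OF is_ideal_adj[OF is_ideal_carrier, of f]] Cons.prems by auto
  then show ?case using Cons by (simp add: nzd_def)
qed simp

text \<open>The squarefree monomial \<open>m\<close> of \<open>R\<close> generates
  \<open>SR \<Gamma>\<close> modulo \<open>SR (\<Gamma> \<union> Pow F)\<close>, because the new
  faces are those containing \<open>R\<close>. Its annihilator there is \<open>SR (Pow F)\<close>,
  so \<open>rseq_extension\<close> applies.\<close>

lemma rseq_shelling_step:
  assumes dc: "down_closed \<Gamma>" and F: "finite F" "F \<subseteq> V" "R \<subseteq> F"
    and R: "\<And>G. G \<subseteq> F \<Longrightarrow> G \<in> \<Gamma> \<longleftrightarrow> \<not> R \<subseteq> G"
    and fs: "set fs \<subseteq> S" "rseq (SR \<Gamma>) fs" "rseq (SR (Pow F)) fs"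
  shows "rseq (SR (\<Gamma> \<union> Pow F)) fs"
proof (rule rseq_extension)
  have finR: "finite R" using F finite_subset by auto
  define \<rho> where "\<rho> = (\<Sum>v\<in>R. single v (Suc 0))"
  have lookup_\<rho>: "lookup \<rho> v = (if v \<in> R then 1 else 0)" and keys_\<rho>: "keys \<rho> = R" for v
    using finR by (simp_all add: \<rho>_def lookup_sum_single_one keys_sum_single_one)
  define m :: "('v, 'k) mpoly" where "m = single \<rho> 1"
  have dc': "down_closed (\<Gamma> \<union> Pow F)" using dc unfolding down_closed_def by blast
  have RG: "R \<notin> \<Gamma>" using R[of R] F by auto
  show J: "is_ideal (SR (\<Gamma> \<union> Pow F))" using dc' by (rule is_ideal_SR)
  show mS: "m \<in> S" using F by (simp add: m_def single_poly_on keys_\<rho>)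
  show "is_ideal (SR (Pow F))" using prime_SR_Pow prime_idl_ideal by blast
  show "SR \<Gamma> = adj (SR (\<Gamma> \<union> Pow F)) m"
  proof
    have "m \<in> SR \<Gamma>" using mS RG by (simp add: SR_iff m_def keys_\<rho>)
    then show "adj (SR (\<Gamma> \<union> Pow F)) m \<subseteq> SR \<Gamma>"
      using is_ideal_SR[OF dc] by (intro adj_least) (auto simp: SR_iff)
    show "SR \<Gamma> \<subseteq> adj (SR (\<Gamma> \<union> Pow F)) m"
    proof
      fix p assume p: "p \<in> SR \<Gamma>"
      have "single e (lookup p e) \<in> adj (SR (\<Gamma> \<union> Pow F)) m"
        if e: "e \<in> keys p" for e
      proof (cases "keys e \<subseteq> F")
        case True
        then have "R \<subseteq> keys e" using R[of "keys e"] p e by (auto simp: SR_iff)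
        then have "1 \<le> lookup e v" if "v \<in> R" for v using that by (auto simp: in_keys_iff Suc_le_eq)
        then have "e - \<rho> + \<rho> = e"
          by (intro poly_mapping_eqI) (simp add: lookup_add lookup_minus lookup_\<rho>)
        then have "0 + single (e - \<rho>) (lookup p e) * m = single e (lookup p e)"
          by (simp add: m_def mult_single)
        moreover have "single (e - \<rho>) (lookup p e) \<in> S"
          using True F(2) keys_minus_exponent[of e \<rho>] by (intro single_poly_on) auto
        ultimately show ?thesis using adjI[OF is_ideal_zero[OF J]] by metis
      next
        case False
        have "single e (lookup p e) \<in> SR (\<Gamma> \<union> Pow F)"
          using False p e by (auto simp: SR_iff poly_on_def)
        then show ?thesis using adj_superset by blast
      qed
      then have "(\<Sum>e\<in>keys p. single e (lookup p e)) \<in> adj (SR (\<Gamma> \<union> Pow F)) m"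
        using J mS by (intro is_ideal_sum is_ideal_adj)
      then show "p \<in> adj (SR (\<Gamma> \<union> Pow F)) m" by (simp only: sum_single_lookup)
    qed
  qed
  fix b :: "('v, 'k) mpoly" assume b: "b \<in> S"
  have "keys (b * m) = (+) \<rho> ` keys b"
  proof
    show "keys (b * m) \<subseteq> (+) \<rho> ` keys b"
      using keys_single_mult[of \<rho> 1 b] by (simp add: m_def mult.commute)
    show "(+) \<rho> ` keys b \<subseteq> keys (b * m)"
      using lookup_single_mult[of \<rho> 1 b] by (auto simp: in_keys_iff m_def mult.commute)
  qed
  moreover have "R \<union> G \<notin> \<Gamma> \<union> Pow F \<longleftrightarrow> \<not> G \<subseteq> F" for G
    using RG dc F(3) unfolding down_closed_def by blast
  ultimately show "b * m \<in> SR (\<Gamma> \<union> Pow F) \<longleftrightarrow> b \<in> SR (Pow F)"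
    using b mS by (simp add: SR_iff mem keys_plus_exponent keys_\<rho>)
qed (use fs in auto)

lemma rseq_shelling:
  assumes "\<And>i. i < length Fs \<Longrightarrow> finite (Fs ! i) \<and> Fs ! i \<subseteq> V \<and> rseq (SR (Pow (Fs ! i))) fs"
    and "\<And>i G. i < length Fs \<Longrightarrow> G \<subseteq> Fs ! i \<Longrightarrow> G \<in> (\<Union>j<i. Pow (Fs ! j)) \<longleftrightarrow>
      \<not> {v \<in> Fs ! i. Fs ! i - {v} \<in> (\<Union>j<i. Pow (Fs ! j))} \<subseteq> G"
    and "set fs \<subseteq> S"
  shows "rseq (SR (\<Union>F\<in>set Fs. Pow F)) fs"
proof -
  have "rseq (SR (\<Union>j<i. Pow (Fs ! j))) fs" if "i \<le> length Fs" for i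
    using that
  proof (induction i)
    case 0
    have "SR {} = S" by (auto simp: SR_iff)
    then show ?case using rseq_carrier assms(3) by simp
  next
    case (Suc i)
    have "rseq (SR ((\<Union>j<i. Pow (Fs ! j)) \<union> Pow (Fs ! i))) fs"
    proof (rule rseq_shelling_step)
      show "down_closed (\<Union>j<i. Pow (Fs ! j))" unfolding down_closed_def by blast
      show "G \<in> (\<Union>j<i. Pow (Fs ! j)) \<longleftrightarrow> \<not> {v \<in> Fs ! i. Fs ! i - {v} \<in> (\<Union>j<i. Pow (Fs ! j))} \<subseteq> G"
        if "G \<subseteq> Fs ! i" for G
        using assms(2)[of i G] Suc.prems that by simp
      show "finite (Fs ! i)" "Fs ! i \<subseteq> V" "rseq (SR (Pow (Fs ! i))) fs"
        using assms(1)[of i] Suc.prems by simp_all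
      show "rseq (SR (\<Union>j<i. Pow (Fs ! j))) fs" using Suc by simp
    qed (use assms(3) in auto)
    then show ?case by (simp add: lessThan_Suc Un_commute)
  qed
  then have "rseq (SR (\<Union>j<length Fs. Pow (Fs ! j))) fs" by simp
  moreover have "(\<Union>j<length Fs. Pow (Fs ! j)) = (\<Union>F\<in>set Fs. Pow F)"
    by (auto simp: set_conv_nth)
  ultimately show ?thesis by simp
qed

text \<open>Every colour occurs exactly once in \<open>F\<close>. Modulo the ideal of
  \<open>F\<close>, the sum of the variables of colour \<open>i\<close> is thus the variable of
  \<open>u i\<close>, and \<open>rseq_monic_vars\<close> applies.\<close>

lemma rseq_coloured_face:
  assumes "F \<subseteq> V" "card F = d" "inj_on \<kappa> F" "\<And>v. v \<in> V \<Longrightarrow> \<kappa> v < d" "\<And>i. i < d \<Longrightarrow> lead_coeff (g i) = 1"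
  shows "rseq (SR (Pow F)) (map (\<lambda>i. poly (map_poly const (g i)) (\<Sum>v\<in>{v\<in>V. \<kappa> v = i}. var v)) [0..<d])"
proof -
  have finF: "finite F" using assms(1) finite_V finite_subset by auto
  have "\<kappa> ` F \<subseteq> {..<d}" using assms by auto
  then have onto: "\<kappa> ` F = {..<d}"
    using card_image[OF assms(3)] assms(2) by (intro card_subset_eq) auto
  define u where "u = inv_into F \<kappa>"
  have u: "u i \<in> F" "\<kappa> (u i) = i" if "i < d" for i
    using that onto inv_into_into[of i \<kappa> F] f_inv_into_f[of i \<kappa> F] by (auto simp: u_def)
  have uF: "v = u (\<kappa> v)" if "v \<in> F" for v using that assms(3) by (simp add: u_def)
  define P where "P = SR (Pow F)"
  have P: "prime_idl P" "is_ideal P" using prime_SR_Pow prime_idl_ideal by (auto simp: P_def)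
  have var_P: "var v \<in> P \<longleftrightarrow> v \<notin> F" if "v \<in> V" for v
    using that var_S[OF that] by (auto simp: P_def SR_iff variable_def)
  have "rseq P (map (\<lambda>(v, g). poly (map_poly const g) (var v)) (map (\<lambda>i. (u i, g i)) [0..<d]))"
  proof (rule rseq_monic_vars[OF P(2)])
    have "inj_on u {0..<d}" using u by (intro inj_on_inverseI[of _ \<kappa>]) auto
    then show "distinct (map fst (map (\<lambda>i. (u i, g i)) [0..<d]))" by (simp add: distinct_map o_def)
    fix v h assume "(v, h) \<in> set (map (\<lambda>i. (u i, g i)) [0..<d])"
    then obtain i where i: "i < d" "v = u i" "h = g i" by auto
    have v: "v \<in> F" "v \<in> V" using u i assms(1) by auto
    have "nzd P (var v)"
      using prime_idl_mult[OF P(1) _ var_S[OF v(2)]] var_P[OF v(2)] v(1) by (auto simp: nzd_def)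
    then show "v \<in> V \<and> lead_coeff h = 1 \<and> graded (expo v) P \<and> nzd P (var v)"
      using v i assms(5) graded_mono_ideal by (auto simp: P_def SR_def)
  qed
  moreover have "list_all2 (\<lambda>f g. f \<in> S \<and> g \<in> S \<and> f - g \<in> P)
      (map (\<lambda>i. poly (map_poly const (g i)) (\<Sum>v\<in>{v\<in>V. \<kappa> v = i}. var v)) [0..<d])
      (map (\<lambda>(v, g). poly (map_poly const g) (var v)) (map (\<lambda>i. (u i, g i)) [0..<d]))"
    unfolding list_all2_conv_all_nth
  proof (intro conjI allI impI)
    fix i assume "i < length (map (\<lambda>i. poly (map_poly const (g i)) (\<Sum>v\<in>{v\<in>V. \<kappa> v = i}. var v)) [0..<d])"
    then have i: "i < d" by simp
    define \<theta> where "\<theta> = (\<Sum>v\<in>{v\<in>V. \<kappa> v = i}. var v)"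
    have ui: "u i \<in> V" using u[OF i] assms(1) by auto
    have \<theta>: "\<theta> \<in> S" unfolding \<theta>_def by (rule sum_S) (auto intro: var_S)
    have "\<theta> = var (u i) + (\<Sum>v\<in>{v\<in>V. \<kappa> v = i} - {u i}. var v)"
      unfolding \<theta>_def using finite_V ui u[OF i] by (intro sum.remove) auto
    moreover have "(\<Sum>v\<in>{v\<in>V. \<kappa> v = i} - {u i}. var v) \<in> P"
      using uF by (intro is_ideal_sum[OF P(2)]) (auto simp: var_P)
    ultimately have "\<theta> - var (u i) \<in> P" by simp
    then have "poly (map_poly const (g i)) \<theta> - poly (map_poly const (g i)) (var (u i)) \<in> P"
      by (rule poly_const_cong[OF P(2) \<theta> var_S[OF ui]])
    moreover have "poly (map_poly const (g i)) \<theta> \<in> S" "poly (map_poly const (g i)) (var (u i)) \<in> S"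
      using \<theta> var_S[OF ui] const_S comm_subring_axioms by (auto intro: poly_const_mem)
    ultimately show "map (\<lambda>i. poly (map_poly const (g i)) (\<Sum>v\<in>{v\<in>V. \<kappa> v = i}. var v)) [0..<d] ! i \<in> S"
      "map (\<lambda>(v, g). poly (map_poly const g) (var v)) (map (\<lambda>i. (u i, g i)) [0..<d]) ! i \<in> S"
      "map (\<lambda>i. poly (map_poly const (g i)) (\<Sum>v\<in>{v\<in>V. \<kappa> v = i}. var v)) [0..<d] ! i -
       map (\<lambda>(v, g). poly (map_poly const g) (var v)) (map (\<lambda>i. (u i, g i)) [0..<d]) ! i \<in> P"
      using i by (simp_all add: \<theta>_def)
  qed simp
  ultimately show ?thesis using rseq_cong[OF P(2)] by (simp add: P_def)
qed

end

text \<open>The colouring provides parameters that reduce to one variable on each facet, whatever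
  the field; generic linear forms would require an infinite one.\<close>

theorem Cohen_Macaulay_of_coloured_shellable:
  fixes \<Delta> :: "'v::linorder set set"
  assumes "shellable \<Delta>" and card: "\<And>F. F \<in> facets \<Delta> \<Longrightarrow> card F = d"
    and \<kappa>: "\<And>F. F \<in> \<Delta> \<Longrightarrow> inj_on \<kappa> F" "\<And>v. v \<in> \<Union>\<Delta> \<Longrightarrow> \<kappa> v < d"
  shows "Cohen_Macaulay_complex TYPE('k::field) \<Delta>"
proof -
  have sc: "abstract_simplicial_complex \<Delta>" "pure_complex \<Delta>" using assms(1) by (auto simp: shellable_def)
  obtain Fs where Fs: "set Fs = facets \<Delta>"
    "\<And>i. 0 < i \<and> i < length Fs \<Longrightarrow> pure_complex ((\<Union>j<i. Pow (Fs ! j)) \<inter> Pow (Fs ! i)) \<and>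
       complex_dim ((\<Union>j<i. Pow (Fs ! j)) \<inter> Pow (Fs ! i)) = complex_dim \<Delta> - 1"
    using assms(1) unfolding shellable_def Let_def by blast
  have fin: "finite \<Delta>" "finite (\<Union>\<Delta>)" "\<And>F. F \<in> \<Delta> \<Longrightarrow> finite F" using sc by (auto simp: abstract_simplicial_complex_def)
  interpret poly_ring "\<Union>\<Delta>" "TYPE('k::field)" by standard fact
  have dc: "down_closed \<Delta>" using sc by (auto simp: down_closed_def abstract_simplicial_complex_def)
  interpret noetherian_quotient "poly_on (\<Union>\<Delta>) :: ('v, 'k) mpoly set" "SR \<Delta>"
    by standard (rule is_ideal_SR[OF dc])
  have Q: "stanley_reisner_ring TYPE('k) \<Delta> = Q"
    unfolding stanley_reisner_ring_def Q_def stanley_reisner_ideal_eq[OF sc(1)] poly_ring_on_def as_ring_def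
    by (simp add: poly_on_def)
  have \<Delta>: "(\<Union>F\<in>set Fs. Pow F) = \<Delta>"
  proof
    show "(\<Union>F\<in>set Fs. Pow F) \<subseteq> \<Delta>" using dc by (auto simp: Fs(1) facets_def down_closed_def)
    show "\<Delta> \<subseteq> (\<Union>F\<in>set Fs. Pow F)" using complex_face_in_facet[OF fin(1)] by (fastforce simp: Fs(1))
  qed
  have card_le: "card F \<le> d" if F: "F \<in> \<Delta>" for F
  proof -
    obtain H where "H \<in> facets \<Delta>" "F \<subseteq> H" using complex_face_in_facet[OF fin(1) F] by auto
    then show ?thesis using card[of H] fin(3) card_mono[of H F] by (auto simp: facets_def)
  qed
  have "Cohen_Macaulay_ring Q"
  proof (rule Cohen_Macaulay_ring_Q)
    fix Ps :: "('v, 'k) mpoly set list" and r assume Ps: "length Ps = Suc r"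
      "\<And>P. P \<in> set Ps \<Longrightarrow> prime_idl P \<and> SR \<Delta> \<subseteq> P" "sorted_wrt (\<subset>) Ps"
    show "r \<le> d"
    proof (rule prime_chain_length_le[OF _ _ Ps(1) _ Ps(3)])
      fix N
      show "finite {e. keys e \<subseteq> \<Union>\<Delta> \<and> e \<notin> {e. keys e \<notin> \<Delta>} \<and> (\<forall>v. lookup e v \<le> N)}"
        "card {e. keys e \<subseteq> \<Union>\<Delta> \<and> e \<notin> {e. keys e \<notin> \<Delta>} \<and> (\<forall>v. lookup e v \<le> N)} \<le> card \<Delta> * Suc N ^ d"
        using SR_exponents_finite_card[of \<Delta> d N] fin card_le by auto
    qed (use Ps(2) in \<open>auto simp: SR_def\<close>)
  next
    fix P :: "('v, 'k) mpoly set"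
    assume P: "prime_idl P" "SR \<Delta> \<subseteq> P" and max: "\<And>a. a \<in> poly_on (\<Union>\<Delta>) \<Longrightarrow> a \<notin> P \<Longrightarrow> \<exists>b\<in>poly_on (\<Union>\<Delta>). 1 - a * b \<in> P"
    define \<theta> where "\<theta> i = (\<Sum>v\<in>{v \<in> \<Union>\<Delta>. \<kappa> v = i}. var v)" for i
    have \<theta>: "\<theta> i \<in> S" for i unfolding \<theta>_def by (rule sum_S) (auto intro: var_S)
    have "\<exists>g. lead_coeff g = 1 \<and> poly (map_poly const g) (\<theta> i) \<in> P" for i
      using algebraic_modulo_maximal[OF fin(2) prime_idl_ideal[OF P(1)] max \<theta>] by blast
    then obtain g where g: "\<And>i. lead_coeff (g i) = 1" "\<And>i. poly (map_poly const (g i)) (\<theta> i) \<in> P" by metis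
    define fs where "fs = map (\<lambda>i. poly (map_poly const (g i)) (\<theta> i)) [0..<d]"
    have "set fs \<subseteq> P" using g by (auto simp: fs_def)
    moreover have "rseq (SR (\<Union>F\<in>set Fs. Pow F)) fs"
    proof (rule rseq_shelling)
      fix i assume i: "i < length Fs"
      then have F: "Fs ! i \<in> facets \<Delta>" "Fs ! i \<in> \<Delta>" using Fs(1) nth_mem by (auto simp: facets_def)
      then show "finite (Fs ! i) \<and> Fs ! i \<subseteq> \<Union>\<Delta> \<and> rseq (SR (Pow (Fs ! i))) fs"
        using fin(3) card \<kappa> g(1) unfolding fs_def \<theta>_def
        by (intro conjI rseq_coloured_face) auto
      fix G assume "G \<subseteq> Fs ! i"
      then show "G \<in> (\<Union>j<i. Pow (Fs ! j)) \<longleftrightarrow> \<not> {v \<in> Fs ! i. Fs ! i - {v} \<in> (\<Union>j<i. Pow (Fs ! j))} \<subseteq> G"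
        using i Fs(2) by (intro shelling_restriction[OF sc Fs(1)]) auto
    qed (use calculation prime_idl_ideal[OF P(1)] is_ideal_subset in blast)
    ultimately show "\<exists>fs. length fs = d \<and> set fs \<subseteq> P \<and> rseq (SR \<Delta>) fs"
      by (intro exI[of _ fs]) (simp add: fs_def \<Delta>)
  qed
  then show ?thesis by (simp add: Cohen_Macaulay_complex_def Q)
qed

section \<open>Links with two disjoint simplices\<close>

context poly_ring
begin

text \<open>\<open>var v - 1\<close> has degree \<open>0\<close> in every other variable, so
  adjoining it keeps the other gradings and \<open>nzd_minus_one\<close> applies again.\<close>

lemma rseq_vars_minus_one:
  assumes "is_ideal J" "distinct vs" "\<And>v. v \<in> set vs \<Longrightarrow> v \<in> V \<and> graded (expo v) J"
  shows "rseq J (map (\<lambda>v. var v - 1) vs)"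
  using assms
proof (induction vs arbitrary: J)
  case (Cons v vs)
  have v: "v \<in> V" "graded (expo v) J" using Cons.prems(3)[of v] by auto
  have fS: "var v - 1 \<in> S" using var_S[OF v(1)] by (simp add: mem)
  have "nzd J (var v - 1)"
    using Cons.prems(1) v var_S homog_var by (intro nzd_minus_one[of "expo v", OF lookup_add]) auto
  moreover have "rseq (adj J (var v - 1)) (map (\<lambda>v. var v - 1) vs)"
  proof (rule Cons.IH)
    show "is_ideal (adj J (var v - 1))" using Cons.prems(1) fS by (rule is_ideal_adj)
    fix u assume u: "u \<in> set vs"
    have "v \<noteq> u" using u Cons.prems(2) by auto
    then have "homog (expo u) 0 (var v - 1)"
      using keys_diff[of "var v" 1] homog_var_other[of v u] unfolding homog_def by fastforce
    then show "u \<in> V \<and> graded (expo u) (adj J (var v - 1))"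
      using Cons.prems(3)[of u] u graded_adj[of "expo u", OF lookup_add Cons.prems(1)] fS by auto
  qed (use Cons.prems in auto)
  ultimately show ?case by simp
qed simp

end

text \<open>At the maximal ideal where the variables of \<open>C\<close> are \<open>1\<close> and the others vanish, the ring looks
  like that of the link: two linear spaces meeting in a point, hence of depth \<open>1\<close>.\<close>

theorem Cohen_Macaulay_link_disjoint_simplices:
  fixes \<Delta> :: "'v::linorder set set"
  assumes sc: "abstract_simplicial_complex \<Delta>" and CM: "Cohen_Macaulay_complex TYPE('k::field) \<Delta>"
    and C: "C \<in> \<Delta>" and link: "link \<Delta> C = Pow A \<union> Pow B" and AB: "A \<inter> B = {}" "A \<noteq> {}" "B \<noteq> {}"
  shows "card A \<le> 1"
proof -
  have fin: "finite \<Delta>" "finite (\<Union>\<Delta>)" "\<And>F. F \<in> \<Delta> \<Longrightarrow> finite F" using sc by (auto simp: abstract_simplicial_complex_def)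
  interpret poly_ring "\<Union>\<Delta>" "TYPE('k::field)" by standard fact
  have dc: "down_closed \<Delta>" using sc by (auto simp: down_closed_def abstract_simplicial_complex_def)
  interpret noetherian_quotient "poly_on (\<Union>\<Delta>) :: ('v, 'k) mpoly set" "SR \<Delta>"
    by standard (rule is_ideal_SR[OF dc])
  have Q: "stanley_reisner_ring TYPE('k) \<Delta> = Q"
    unfolding stanley_reisner_ring_def Q_def stanley_reisner_ideal_eq[OF sc(1)] poly_ring_on_def as_ring_def
    by (simp add: poly_on_def)
  have linkD: "C \<union> D \<in> \<Delta>" "C \<inter> D = {}" if "D = A \<or> D = B" for D
  proof -
    have "D \<in> link \<Delta> C" using that link by auto
    then show "C \<union> D \<in> \<Delta>" "C \<inter> D = {}" by (auto simp: link_def)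
  qed
  obtain a b where ab: "a \<in> A" "b \<in> B" using AB by auto
  have abC: "a \<notin> C" "b \<notin> C" "a \<notin> B" "b \<notin> A" using ab linkD AB by auto
  have inV: "A \<subseteq> \<Union>\<Delta>" "B \<subseteq> \<Union>\<Delta>" "C \<subseteq> \<Union>\<Delta>" using linkD by blast+
  have finC: "finite C" using fin C by auto
  obtain cs where cs: "set cs = C" "distinct cs" using finite_distinct_list[OF finC] by auto
  \<comment> \<open>\<open>\<zeta>\<close> evaluates at the chosen point, \<open>\<epsilon>\<close>
    only sets the variables of \<open>C\<close> to \<open>1\<close>, and \<open>\<tau> D\<close>
    restricts to the linear space through the point with coordinates \<open>D\<close>.\<close>
  define \<zeta> :: "'v \<Rightarrow> ('v, 'k) mpoly" where "\<zeta> v = const (if v \<in> C then 1 else 0)" for v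
  define \<epsilon> :: "'v \<Rightarrow> ('v, 'k) mpoly" where "\<epsilon> v = (if v \<in> C then 1 else var v)" for v
  define \<tau> :: "'v set \<Rightarrow> 'v \<Rightarrow> ('v, 'k) mpoly"
    where "\<tau> D v = (if v \<in> C then 1 else if v \<in> D then var v else 0)" for D v
  define J where "J = adjs (SR \<Delta>) (map (\<lambda>v. var v - 1) cs)"
  have csS: "set (map (\<lambda>v. var v - 1) cs) \<subseteq> S" using cs inV by (auto intro!: diff_mem var_S mem)
  have idJ: "is_ideal J" unfolding J_def using is_ideal_SR[OF dc] csS by (rule is_ideal_adjs)
  have J_sub: "J \<subseteq> Ker (\<tau> D)" if D: "D = A \<or> D = B" for D
    unfolding J_def
  proof (rule adjs_least)
    show "is_ideal (Ker (\<tau> D))" using prime_Ker prime_idl_ideal by blast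
    have "SR \<Delta> \<subseteq> SR (Pow (C \<union> D))"
      using linkD(1)[OF D] dc unfolding SR_iff down_closed_def subset_iff Pow_iff by blast
    also have "\<dots> \<subseteq> Ker (\<tau> D)" unfolding SR_Pow
      by (rule Ker_comp_subset[where \<rho> = \<epsilon>]) (auto simp: \<tau>_def \<epsilon>_def ev_var ev_simps)
    finally show "SR \<Delta> \<subseteq> Ker (\<tau> D)" .
    show "set (map (\<lambda>v. var v - 1) cs) \<subseteq> Ker (\<tau> D)"
      using csS by (auto simp: Ker_def ev_simps ev_var \<tau>_def cs)
  qed
  have \<epsilon>_S: "ev \<epsilon> p \<in> S" if "p \<in> S" for p
    using that const_S by (intro const.mp_eval_in[OF comm_subring_axioms]) (auto simp: \<epsilon>_def mem var_S)
  have cong: "p - ev \<epsilon> p \<in> J" if "p \<in> S" for p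
  proof -
    have "comm_subring {p \<in> S. p - ev \<epsilon> p \<in> J}"
    proof
      fix p q assume p: "p \<in> {p \<in> S. p - ev \<epsilon> p \<in> J}" and q: "q \<in> {p \<in> S. p - ev \<epsilon> p \<in> J}"
      have "(p - ev \<epsilon> p) - (q - ev \<epsilon> q) \<in> J" 
        using is_ideal_diff[OF idJ, of "p - ev \<epsilon> p" "q - ev \<epsilon> q"] p q by simp
      then show "p - q \<in> {p \<in> S. p - ev \<epsilon> p \<in> J}" using p q by (simp add: mem ev_simps algebra_simps)
      have "p * (q - ev \<epsilon> q) + ev \<epsilon> q * (p - ev \<epsilon> p) \<in> J"
        using p q idJ \<epsilon>_S by (intro is_ideal_add is_ideal_mult) auto
      then show "p * q \<in> {p \<in> S. p - ev \<epsilon> p \<in> J}" using p q by (simp add: mem ev_simps algebra_simps)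
    qed (simp add: mem ev_simps is_ideal_zero[OF idJ])
    moreover have "const c \<in> {p \<in> S. p - ev \<epsilon> p \<in> J}" for c
      by (simp add: const_S ev_simps is_ideal_zero[OF idJ])
    moreover have "var v \<in> {p \<in> S. p - ev \<epsilon> p \<in> J}" if "v \<in> \<Union>\<Delta>" for v
      using adjs_set[OF is_ideal_SR[OF dc] csS, folded J_def] that cs
      by (auto simp: var_S ev_var \<epsilon>_def is_ideal_zero[OF idJ])
    ultimately show ?thesis using subring_all[of "{p \<in> S. p - ev \<epsilon> p \<in> J}" p] \<open>p \<in> S\<close> by auto
  qed
  \<comment> \<open>Modulo \<open>J\<close> this monomial is \<open>1\<close>; multiplying by it
    turns nonfaces of the link into nonfaces of \<open>\<Delta>\<close>.\<close>
  define xC where "xC = single (\<Sum>v\<in>C. single v (Suc 0)) (1::'k)"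
  have xC: "xC = (\<Prod>v\<in>C. var v)" using prod_single[OF finC] by (simp add: xC_def variable_def)
  have xCS: "xC \<in> S" using inV by (simp add: xC_def single_poly_on keys_sum_single_one[OF finC])
  have xC1: "xC - 1 \<in> J" using cong[OF xCS] by (simp add: xC ev_prod ev_var \<epsilon>_def)
  \<comment> \<open>Together with \<open>J_sub\<close>, this identifies \<open>J\<close> as the
    ideal of the union of the two linear spaces.\<close>
  have J_sup: "p \<in> J" if p: "p \<in> Ker (\<tau> A)" "p \<in> Ker (\<tau> B)" for p
  proof -
    have pS: "p \<in> S" using p by (simp add: Ker_def)
    define q where "q = ev \<epsilon> p"
    have "q \<in> poly_on (\<Union>\<Delta> - C)" unfolding q_def
      by (rule const.mp_eval_in[OF comm_subring_poly_on _ _ pS])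
        (auto simp: \<epsilon>_def single_poly_on variable_def comm_subring.one_mem[OF comm_subring_poly_on])
    then have avoid: "keys e \<inter> C = {}" "keys e \<subseteq> \<Union>\<Delta>" if "e \<in> keys q" for e
      using that by (auto simp: poly_on_def)
    have restr: "restr {e. keys e \<subseteq> D} q = 0" if "D = A \<or> D = B" for D
    proof -
      have "\<tau> D = (\<lambda>v. ev (\<lambda>v. if v \<in> D then var v else 0) (\<epsilon> v))"
        by (auto simp: \<tau>_def \<epsilon>_def ev_simps ev_var fun_eq_iff)
      then have "ev (\<tau> D) p = restr {e. keys e \<subseteq> D} q"
        by (simp add: q_def flip: ev_ev ev_restr)
      then show ?thesis using p that by (auto simp: Ker_def)
    qed
    have "single e (lookup q e) \<in> J" if e: "e \<in> keys q" for e
    proof -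
      have no: "\<not> keys e \<subseteq> D" if "D = A \<or> D = B" for D
        using restr[OF that] e keys_restr[of "{e. keys e \<subseteq> D}" q] by auto
      have "keys e \<notin> link \<Delta> C" using no link by auto
      then have "keys e \<union> C \<notin> \<Delta>"
        using avoid(1)[OF e] dc by (auto simp: link_def Un_commute Int_commute down_closed_def)
      then have "single e (lookup q e) * xC \<in> SR \<Delta>"
        using avoid(2)[OF e] inV(3) xCS single_poly_on[of e "\<Union>\<Delta>" "lookup q e"]
        by (simp add: SR_iff mem)
          (simp add: xC_def mult_single keys_plus_exponent keys_sum_single_one[OF finC])
      then have 1: "single e (lookup q e) * xC \<in> J"
        using adjs_superset[of "SR \<Delta>"] by (auto simp: J_def)
      have 2: "single e (lookup q e) * (xC - 1) \<in> J"
        using avoid(2)[OF e] xC1 by (intro is_ideal_mult[OF idJ] single_poly_on)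
      show ?thesis using is_ideal_diff[OF idJ 1 2] by (simp add: right_diff_distrib)
    qed
    then have "(\<Sum>e\<in>keys q. single e (lookup q e)) \<in> J"
      by (intro is_ideal_sum[OF idJ])
    then have "(p - q) + q \<in> J"
      using cong[OF pS] unfolding q_def sum_single_lookup by (intro is_ideal_add[OF idJ])
    then show ?thesis by simp
  qed
  \<comment> \<open>\<open>f\<close> vanishes at the point but on neither linear space, so it is a
    nonzerodivisor modulo \<open>J\<close>.\<close>
  define f where "f = var a + var b"
  have vS: "var a \<in> S" "var b \<in> S" using ab inV by (auto intro!: var_S)
  have fS: "f \<in> S" using vS by (simp add: f_def mem)
  have var0: "var v \<noteq> (0 :: ('v, 'k) mpoly)" for v
    by (simp add: variable_def flip: keys_eq_empty)
  have ev_f: "ev (\<tau> A) f = var a" "ev (\<tau> B) f = var b"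
    using ab abC by (auto simp: f_def ev_simps ev_var \<tau>_def)
  have nzd_f: "nzd J f" unfolding nzd_def
  proof (intro ballI impI)
    fix p assume p: "p \<in> S" "p * f \<in> J"
    have "p \<in> Ker (\<tau> D)" if D: "D = A \<or> D = B" for D
      using J_sub[OF D] p prime_idl_mult[OF prime_Ker p(1) fS, of "\<tau> D"] D ev_f var0 by (auto simp: Ker_def)
    then show "p \<in> J" using J_sup by blast
  qed
  define xs where "xs = map (\<lambda>v. var v - 1) cs @ [f]"
  have adjs_xs: "adjs (SR \<Delta>) xs = adj J f" by (simp add: xs_def J_def adjs_append)
  have "rseq (SR \<Delta>) (map (\<lambda>v. var v - 1) cs)"
    using cs inV(3) is_ideal_SR[OF dc] graded_mono_ideal
    by (intro rseq_vars_minus_one) (auto simp: SR_def)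
  then have rseq_xs: "rseq (SR \<Delta>) xs"
    using nzd_f by (simp add: xs_def rseq_append J_def)
  have \<zeta>\<tau>: "ev \<zeta> (ev (\<tau> D) p) = ev \<zeta> p" if "D = A \<or> D = B" for D p
  proof -
    have "\<zeta> = (\<lambda>v. ev \<zeta> (\<tau> D v))" using linkD(2)[OF that] by (auto simp: \<tau>_def \<zeta>_def ev_simps ev_var fun_eq_iff)
    then show ?thesis unfolding ev_ev by simp
  qed
  \<comment> \<open>In a relation \<open>var a = j + h * f\<close> the factor \<open>h\<close> would
    be \<open>1\<close> on one space and \<open>0\<close> on the other, although they share a
    point.\<close>
  have notin: "var a \<notin> adj J f"
  proof
    assume "var a \<in> adj J f"
    then obtain j h where jh: "j \<in> J" "h \<in> S" "var a = j + h * f" by (rule adjE)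
    have 0: "ev (\<tau> A) j = 0" "ev (\<tau> B) j = 0" using J_sub[of A] J_sub[of B] jh(1) by (auto simp: Ker_def)
    have "var a = ev (\<tau> A) h * var a"
      using arg_cong[OF jh(3), of "ev (\<tau> A)"] 0 ev_f ab abC by (simp add: ev_simps ev_var \<tau>_def)
    then have 1: "ev (\<tau> A) h = 1" using var0[of a] by simp
    have "0 = ev (\<tau> B) h * var b"
      using arg_cong[OF jh(3), of "ev (\<tau> B)"] 0 ev_f ab abC by (simp add: ev_simps ev_var \<tau>_def)
    then have 2: "ev (\<tau> B) h = 0" using var0[of b] by simp
    show False using \<zeta>\<tau>[of A h] \<zeta>\<tau>[of B h] 1 2 by (simp add: ev_simps)
  qed
  define P where "P = Ker \<zeta>"
  have \<zeta>: "\<zeta> = (\<lambda>v. const (if v \<in> C then 1 else 0))" by (auto simp: \<zeta>_def)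
  have P: "prime_idl P" "is_ideal P" using prime_Ker prime_idl_ideal by (auto simp: P_def)
  have idK: "is_ideal (adj J f)" using idJ fS by (rule is_ideal_adj)
  have \<zeta>_S: "ev \<zeta> p \<in> S" if "p \<in> S" for p
    using that const_S by (intro const.mp_eval_in[OF comm_subring_axioms]) (auto simp: \<zeta>_def)
  \<comment> \<open>\<open>P\<close> is generated by the \<open>var v - \<zeta> v\<close> as far as
    congruences go, so variables suffice. For \<open>v \<in> A\<close> the product
    \<open>var v * var b\<close> vanishes on both spaces, and \<open>f\<close> trades
    \<open>var b\<close> for \<open>- var a\<close>; for other \<open>v\<close> the product with
    \<open>var a\<close> already vanishes on both.\<close>
  have socle: "p * var a \<in> adj J f" if p: "p \<in> P" for p
  proof -
    define T where "T = {p \<in> S. (p - ev \<zeta> p) * var a \<in> adj J f}"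
    have "comm_subring T"
    proof
      fix p q assume p: "p \<in> T" and q: "q \<in> T"
      have "(p - ev \<zeta> p) * var a - (q - ev \<zeta> q) * var a \<in> adj J f"
        using is_ideal_diff[OF idK, of "(p - ev \<zeta> p) * var a" "(q - ev \<zeta> q) * var a"] p q by (simp add: T_def)
      then show "p - q \<in> T" using p q by (simp add: T_def mem ev_simps algebra_simps)
      have "p * ((q - ev \<zeta> q) * var a) + ev \<zeta> q * ((p - ev \<zeta> p) * var a) \<in> adj J f"

        using p q by (intro is_ideal_add[OF idK is_ideal_mult[OF idK] is_ideal_mult[OF idK]] \<zeta>_S)
          (simp_all add: T_def)
      then show "p * q \<in> T" using p q by (simp add: T_def mem ev_simps algebra_simps)
    qed (simp add: T_def mem ev_simps is_ideal_zero[OF idK])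
    moreover have "const c \<in> T" for c
      by (simp add: T_def const_S ev_simps is_ideal_zero[OF idK])
    moreover have "var v \<in> T" if v: "v \<in> \<Union>\<Delta>" for v
    proof -
      have "(var v - \<zeta> v) * var a \<in> adj J f"
      proof (cases "v \<in> A")
        case True
        then have nC: "v \<notin> C" "v \<notin> B" using linkD(2) AB by auto
        have "var v * var b \<in> J"
          using True v nC vS ab abC by (intro J_sup) (auto simp: Ker_def mem var_S ev_simps ev_var \<tau>_def)
        then have "- (var v * var b) + var v * f \<in> adj J f"
          using idJ var_S[OF v] by (intro adjI is_ideal_uminus)
        then show ?thesis using nC by (simp add: f_def \<zeta>_def algebra_simps)
      next
        case False
        have "(var v - \<zeta> v) * var a \<in> J"
          using False v vS ab abC const_S
          by (intro J_sup) (auto simp: Ker_def \<zeta>_def mem var_S ev_simps ev_var \<tau>_def)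
        then show ?thesis using adj_superset by blast
      qed
      then show ?thesis using v by (simp add: T_def var_S ev_var)
    qed
    moreover have "p \<in> S" "ev \<zeta> p = 0" using p by (auto simp: P_def Ker_def)
    ultimately have "p \<in> T" using subring_all by blast
    then show ?thesis using \<open>ev \<zeta> p = 0\<close> by (simp add: T_def)
  qed
  \<comment> \<open>The face \<open>C \<union> A\<close> yields a chain of primes below
    \<open>P\<close> with \<open>card C + card A\<close> steps, to be compared with the
    \<open>card C + 1\<close> entries of \<open>xs\<close>.\<close>
  have finCA: "finite (C \<union> A)" "C \<union> A \<in> \<Delta>" using linkD(1)[of A] fin(3) by auto
  obtain vs where vs: "set vs = C \<union> A" "distinct vs" using finite_distinct_list[OF finCA(1)] by auto
  have "\<exists>Ps. length Ps = Suc (length vs) \<and> (\<forall>P\<in>set Ps. prime_idl P \<and> SR \<Delta> \<subseteq> P)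
      \<and> sorted_wrt (\<subset>) Ps \<and> last Ps = Ker (\<lambda>v. const (if v \<in> C then 1 else 0))"
    using vs finCA(2) dc inV by (intro prime_chain_face) auto
  then obtain Ps where Ps: "length Ps = Suc (length vs)" "\<forall>P\<in>set Ps. prime_idl P \<and> SR \<Delta> \<subseteq> P"
    "sorted_wrt (\<subset>) Ps" "last Ps = P" unfolding P_def \<zeta> by blast
  have "last Ps \<in> set Ps" using Ps(1) by (intro last_in_set) auto
  then have SRP: "SR \<Delta> \<subseteq> P" using Ps by auto
  have xsP: "set xs \<subseteq> P"
    using csS fS cs abC by (auto simp: xs_def P_def Ker_def f_def ev_simps ev_var \<zeta>_def)
  have "length vs \<le> length xs"
  proof (rule Cohen_Macaulay_ring_QD)
    show "Cohen_Macaulay_ring Q" using CM by (simp add: Cohen_Macaulay_complex_def Q)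
    show "prime_idl P" "SR \<Delta> \<subseteq> P" by fact+
    show "\<And>a. a \<in> S \<Longrightarrow> a \<notin> P \<Longrightarrow> \<exists>b\<in>S. 1 - a * b \<in> P"
      unfolding P_def \<zeta> by (rule maximal_Ker_const)
    show "length fs \<le> length xs" if "set fs \<subseteq> P" "rseq (SR \<Delta>) fs" for fs
      using rseq_length_le_socle[OF P(2) is_ideal_SR[OF dc] xsP that(1) rseq_xs that(2) vS(1)]
        notin socle by (simp add: adjs_xs)
  qed (use Ps in auto)
  moreover have "length vs = card C + card A"
    using distinct_card[OF vs(2)] vs(1) finCA(1) linkD(2)[of A] card_Un_disjoint[of C A] by simp
  moreover have "length xs = card C + 1"
    using distinct_card[OF cs(2)] cs(1) by (simp add: xs_def)
  ultimately show ?thesis by simp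
qed

section \<open>Vertex decomposable complexes\<close>

lemma facets_Pow: "facets (Pow F) = {F}"
  by (auto simp: facets_def)

lemma abstract_simplicial_complex_Pow: "finite F \<Longrightarrow> abstract_simplicial_complex (Pow F)"
  by (auto simp: abstract_simplicial_complex_def finite_subset)

lemma shellable_Pow: "finite F \<Longrightarrow> shellable (Pow F)"
  unfolding shellable_def
  by (auto simp: abstract_simplicial_complex_Pow pure_complex_def facets_Pow intro!: exI[of _ "[F]"])

text \<open>A facet of the deletion could be enlarged only by \<open>x\<close>; it would then lie in
  the link, which the shedding condition excludes.\<close>

lemma facets_shedding:
  assumes sc: "abstract_simplicial_complex \<Delta>" and "\<forall>G\<in>link \<Delta> {x}. G \<notin> facets (deletion \<Delta> x)"
  shows "facets \<Delta> = facets (deletion \<Delta> x) \<union> insert x ` facets (link \<Delta> {x})"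
proof (intro equalityI subsetI)
  fix F assume F: "F \<in> facets \<Delta>"
  then have F': "F \<in> \<Delta>" "\<And>G. G \<in> \<Delta> \<Longrightarrow> F \<subseteq> G \<Longrightarrow> G = F" by (auto simp: facets_def)
  show "F \<in> facets (deletion \<Delta> x) \<union> insert x ` facets (link \<Delta> {x})"
  proof (cases "x \<in> F")
    case True
    have "F - {x} \<in> \<Delta>" using sc F'(1) unfolding abstract_simplicial_complex_def by blast
    then have "F - {x} \<in> link \<Delta> {x}" using True F'(1) by (auto simp: link_def insert_absorb)
    moreover have "G = F - {x}" if "G \<in> link \<Delta> {x}" "F - {x} \<subseteq> G" for G
      using that F'(2)[of "insert x G"] by (auto simp: link_def)
    ultimately have "F - {x} \<in> facets (link \<Delta> {x})" by (auto simp: facets_def)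
    then show ?thesis using True by (metis UnI2 image_eqI insert_Diff)
  next
    case False
    then have "F \<in> facets (deletion \<Delta> x)" using F' by (auto simp: facets_def deletion_def)
    then show ?thesis ..
  qed
next
  fix F assume "F \<in> facets (deletion \<Delta> x) \<union> insert x ` facets (link \<Delta> {x})"
  then show "F \<in> facets \<Delta>"
  proof
    assume F: "F \<in> facets (deletion \<Delta> x)"
    then have F': "F \<in> \<Delta>" "x \<notin> F" "\<And>G. G \<in> \<Delta> \<Longrightarrow> x \<notin> G \<Longrightarrow> F \<subseteq> G \<Longrightarrow> G = F"
      by (auto simp: facets_def deletion_def)
    have "G = F" if G: "G \<in> \<Delta>" "F \<subseteq> G" for G
    proof (cases "x \<in> G")
      case True
      have "insert x F \<subseteq> G" using True G by auto
      then have "insert x F \<in> \<Delta>" using sc G(1) unfolding abstract_simplicial_complex_def by blast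
      then have "F \<in> link \<Delta> {x}" using F' by (auto simp: link_def)
      then show ?thesis using assms(2) F by auto
    qed (use F' G in auto)
    then show ?thesis using F' by (auto simp: facets_def)
  next
    assume "F \<in> insert x ` facets (link \<Delta> {x})"
    then obtain H where H: "F = insert x H" "H \<in> link \<Delta> {x}" "\<And>G. G \<in> link \<Delta> {x} \<Longrightarrow> H \<subseteq> G \<Longrightarrow> G = H"
      by (auto simp: facets_def)
    have "G = F" if G: "G \<in> \<Delta>" "F \<subseteq> G" for G
    proof -
      have "G - {x} \<in> \<Delta>" using sc G(1) unfolding abstract_simplicial_complex_def by blast
      then have "G - {x} \<in> link \<Delta> {x}" using G H(1) by (auto simp: link_def insert_absorb)
      moreover have "x \<notin> H" using H(2) by (auto simp: link_def)
      ultimately show ?thesis using H(3)[of "G - {x}"] H(1) G by auto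
    qed
    then show ?thesis using H by (auto simp: facets_def link_def)
  qed
qed

text \<open>The shelling lists the facets of the deletion first and then \<open>insert x H\<close>
  for the facets \<open>H\<close> of the link, each in their own order.\<close>

lemma shellable_shedding:
  assumes sc: "abstract_simplicial_complex \<Delta>" and pure: "pure_complex \<Delta>" and x: "{x} \<in> \<Delta>"
    and del: "shellable (deletion \<Delta> x)" and lk: "shellable (link \<Delta> {x})"
    and shed: "\<forall>G\<in>link \<Delta> {x}. G \<notin> facets (deletion \<Delta> x)"
  shows "shellable \<Delta>"
proof -
  define D where "D = deletion \<Delta> x"
  define K where "K = link \<Delta> {x}"
  have scD: "abstract_simplicial_complex D" "pure_complex D" and scK: "abstract_simplicial_complex K" "pure_complex K"
    using del lk by (auto simp: shellable_def D_def K_def)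
  have finite_faces: "finite \<Gamma>" "\<And>F. F \<in> \<Gamma> \<Longrightarrow> finite F" "{} \<in> \<Gamma>" if "abstract_simplicial_complex \<Gamma>" for \<Gamma> :: "'a set set"
    using that by (auto simp: abstract_simplicial_complex_def)
  have facets: "facets \<Delta> = facets D \<union> insert x ` facets K"
    using facets_shedding[OF sc shed] by (simp add: D_def K_def)
  have xK: "x \<notin> H" if "H \<in> K" for H using that by (auto simp: K_def link_def)
  have xD: "x \<notin> H" if "H \<in> D" for H using that by (auto simp: D_def deletion_def)
  obtain d where d: "int d = complex_dim \<Delta> + 1" "\<And>F. F \<in> facets \<Delta> \<Longrightarrow> card F = d"
  proof -
    obtain H where H: "H \<in> facets \<Delta>" using complex_face_in_facet[OF finite_faces(1,3)[OF sc]] by auto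
    have "card F = card H" if "F \<in> facets \<Delta>" for F using pure H that unfolding pure_complex_def by blast
    then show thesis
      using facet_card_complex_dim[OF finite_faces(1,2)[OF sc] pure H] by (intro that)
  qed
  have dimD: "complex_dim D = complex_dim \<Delta>"
  proof -
    obtain H where H: "H \<in> facets D" using complex_face_in_facet[OF finite_faces(1,3)[OF scD(1)]] by auto
    then show ?thesis
      using facet_card_complex_dim[OF finite_faces(1,2)[OF scD(1)] scD(2) H] d facets by auto
  qed
  have cardK: "Suc (card H) = d" if "H \<in> facets K" for H
  proof -
    have "H \<in> K" using that by (auto simp: facets_def)
    then show ?thesis using d(2)[of "insert x H"] that facets xK finite_faces(2)[OF scK(1)] by auto
  qed
  have dimK: "complex_dim K = complex_dim \<Delta> - 1"
  proof -
    obtain H where H: "H \<in> facets K" using complex_face_in_facet[OF finite_faces(1,3)[OF scK(1)]] by auto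
    then show ?thesis
      using facet_card_complex_dim[OF finite_faces(1,2)[OF scK(1)] scK(2) H] d cardK[OF H] by auto
  qed
  obtain Fd where Fd: "distinct Fd" "set Fd = facets D"
    "\<And>i. 0 < i \<Longrightarrow> i < length Fd \<Longrightarrow> pure_complex ((\<Union>j<i. Pow (Fd ! j)) \<inter> Pow (Fd ! i)) \<and>
       complex_dim ((\<Union>j<i. Pow (Fd ! j)) \<inter> Pow (Fd ! i)) = complex_dim D - 1"
    using del unfolding shellable_def Let_def D_def by blast
  obtain Fk where Fk: "distinct Fk" "set Fk = facets K"
    "\<And>i. 0 < i \<Longrightarrow> i < length Fk \<Longrightarrow> pure_complex ((\<Union>j<i. Pow (Fk ! j)) \<inter> Pow (Fk ! i)) \<and>
       complex_dim ((\<Union>j<i. Pow (Fk ! j)) \<inter> Pow (Fk ! i)) = complex_dim K - 1"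
    using lk unfolding shellable_def Let_def K_def by blast
  define Fs where "Fs = Fd @ map (insert x) Fk"
  have FkK: "Fk ! j \<in> K" "Fk ! j \<in> facets K" if "j < length Fk" for j
    using that Fk(2) nth_mem[OF that] by (auto simp: facets_def)
  have "inj_on (insert x) (set Fk)"
    using Fk(2) xK by (intro inj_onI) (auto simp: facets_def insert_ident)
  moreover have "set Fd \<inter> insert x ` set Fk = {}" using Fd(2) xD by (auto simp: facets_def)
  ultimately have "distinct Fs" using Fd(1) Fk(1) by (simp add: Fs_def distinct_map)
  moreover have "set Fs = facets \<Delta>" using Fd(2) Fk(2) facets by (simp add: Fs_def)
  moreover have "pure_complex ((\<Union>j<i. Pow (Fs ! j)) \<inter> Pow (Fs ! i)) \<and>
       complex_dim ((\<Union>j<i. Pow (Fs ! j)) \<inter> Pow (Fs ! i)) = complex_dim \<Delta> - 1"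
    if i: "0 < i" "i < length Fs" for i
  proof (cases "i < length Fd")
    case True
    then have "(\<Union>j<i. Pow (Fs ! j)) = (\<Union>j<i. Pow (Fd ! j))" "Fs ! i = Fd ! i"
      by (auto simp: Fs_def nth_append)
    then show ?thesis using Fd(3)[OF i(1) True] dimD by simp
  next
    case False
    define j where "j = i - length Fd"
    have j: "i = length Fd + j" "j < length Fk" using False i by (auto simp: j_def Fs_def)
    define H where "H = Fk ! j"
    have H: "H \<in> K" "H \<in> facets K" "finite H" "x \<notin> H"
      using FkK[OF j(2)] finite_faces(2)[OF scK(1)] xK by (auto simp: H_def)
    have Fsi: "Fs ! i = insert x H" using j by (simp add: Fs_def nth_append H_def)
    define \<Gamma>k where "\<Gamma>k = (\<Union>l<j. Pow (Fk ! l)) \<inter> Pow H"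
    define \<Gamma> where "\<Gamma> = (\<Union>l<i. Pow (Fs ! l)) \<inter> Pow (Fs ! i)"
    \<comment> \<open>\<open>H\<close> is a face of the deletion, hence contained in an earlier
      facet. Faces through \<open>x\<close> come only from the earlier facets of the link.\<close>
    have "\<Gamma> = Pow H \<union> insert x ` \<Gamma>k"
    proof (intro equalityI subsetI)
      fix Y assume "Y \<in> \<Gamma>"
      then obtain l where l: "l < i" "Y \<subseteq> Fs ! l" "Y \<subseteq> insert x H" by (auto simp: \<Gamma>_def Fsi)
      show "Y \<in> Pow H \<union> insert x ` \<Gamma>k"
      proof (cases "x \<in> Y")
        case True
        have "\<not> l < length Fd"
        proof
          assume "l < length Fd"
          then have "Fs ! l \<in> D" using Fd(2) nth_mem[of l Fd] by (auto simp: Fs_def nth_append facets_def)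
          then show False using xD True l(2) by auto
        qed
        then have "l - length Fd < j" "Fs ! l = insert x (Fk ! (l - length Fd))"
          using l(1) j by (auto simp: Fs_def nth_append)
        then have "Y - {x} \<in> \<Gamma>k" using l by (auto simp: \<Gamma>k_def)
        then show ?thesis using True by (metis UnI2 image_eqI insert_Diff)
      qed (use l in auto)
    next
      fix Y assume "Y \<in> Pow H \<union> insert x ` \<Gamma>k"
      then show "Y \<in> \<Gamma>"
      proof
        assume Y: "Y \<in> Pow H"
        have "H \<in> D" using H by (auto simp: K_def D_def link_def deletion_def)
        then obtain G where "G \<in> facets D" "H \<subseteq> G" using complex_face_in_facet[OF finite_faces(1)[OF scD(1)]] by auto
        then obtain l where "l < length Fd" "H \<subseteq> Fd ! l" using Fd(2) by (metis in_set_conv_nth)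
        then have "l < i" "H \<subseteq> Fs ! l" using j by (auto simp: Fs_def nth_append)
        then show ?thesis using Y by (auto simp: \<Gamma>_def Fsi)
      next
        assume "Y \<in> insert x ` \<Gamma>k"
        then obtain G l where G: "Y = insert x G" "l < j" "G \<subseteq> Fk ! l" "G \<subseteq> H" by (auto simp: \<Gamma>k_def)
        then have "length Fd + l < i" "Y \<subseteq> Fs ! (length Fd + l)" using j by (auto simp: Fs_def nth_append)
        then show ?thesis using G by (auto simp: \<Gamma>_def Fsi)
      qed
    qed
    note \<Gamma> = this
    have fin\<Gamma>: "finite \<Gamma>" "\<And>Y. Y \<in> \<Gamma> \<Longrightarrow> finite Y" using H(3)
      by (auto simp: \<Gamma>_def Fsi intro: finite_subset)
    have fin\<Gamma>k: "finite \<Gamma>k" "\<And>Y. Y \<in> \<Gamma>k \<Longrightarrow> finite Y" using H(3) by (auto simp: \<Gamma>k_def intro: finite_subset)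
    have card: "card Y = card H" if Y: "Y \<in> facets \<Gamma>" for Y
    proof (cases "x \<in> Y")
      case False
      then have "Y \<subseteq> H" using Y \<Gamma> by (auto simp: facets_def)
      moreover have "H \<in> \<Gamma>" using \<Gamma> by auto
      ultimately have "Y = H" using Y unfolding facets_def by blast
      then show ?thesis by simp
    next
      case True
      then obtain G where G: "Y = insert x G" "G \<in> \<Gamma>k" using Y \<Gamma> H(4) by (auto simp: facets_def)
      have xG: "x \<notin> G'" if "G' \<in> \<Gamma>k" for G' using that H(4) by (auto simp: \<Gamma>k_def)
      have "G' = G" if "G' \<in> \<Gamma>k" "G \<subseteq> G'" for G'
      proof -
        have "insert x G' \<in> \<Gamma>" "Y \<subseteq> insert x G'" using that \<Gamma> G by auto
        then have "insert x G' = insert x G" using Y G unfolding facets_def by blast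
        then show ?thesis using xG that G by (simp add: insert_ident)
      qed
      then have "G \<in> facets \<Gamma>k" using G by (auto simp: facets_def)
      \<comment> \<open>For \<open>j = 0\<close> the complex \<open>\<Gamma>k\<close> is void, so no
        facet of \<open>\<Gamma>\<close> contains \<open>x\<close>.\<close>
      moreover have "0 < j" using G(2) by (cases j) (auto simp: \<Gamma>k_def)
      then have "pure_complex \<Gamma>k" "complex_dim \<Gamma>k = complex_dim K - 1"
        using Fk(3)[of j] j(2) by (auto simp: \<Gamma>k_def H_def)
      ultimately have "int (card G) = complex_dim K"
        using facet_card_complex_dim[OF fin\<Gamma>k] by simp
      then have "card Y = d - 1" using G xG[OF G(2)] fin\<Gamma>k(2)[OF G(2)] dimK d(1) by simp
      then show ?thesis using cardK[OF H(2)] by simp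
    qed
    then have "pure_complex \<Gamma>" by (simp add: pure_complex_def)
    moreover obtain Y where "Y \<in> facets \<Gamma>" using complex_face_in_facet[OF fin\<Gamma>(1), of H] \<Gamma> by auto
    ultimately have "int (card H) = complex_dim \<Gamma> + 1"
      using facet_card_complex_dim[OF fin\<Gamma>] card by metis
    then show ?thesis using \<open>pure_complex \<Gamma>\<close> cardK[OF H(2)] d(1) by (simp add: \<Gamma>_def)
  qed
  ultimately show ?thesis unfolding shellable_def Let_def using sc pure by blast
qed

theorem shellable_of_vertex_decomposable: "vertex_decomposable \<Delta> \<Longrightarrow> shellable \<Delta>"
  by (induction rule: vertex_decomposable.induct) (auto intro: shellable_Pow shellable_shedding)

text \<open>Recording the facet size makes purity automatic in a shedding step, where deletion and
  link have facets of sizes \<open>Suc r\<close> and \<open>r\<close>.\<close>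

definition vd_rank :: "nat \<Rightarrow> 'a set set \<Rightarrow> bool" where
  "vd_rank r \<Delta> \<longleftrightarrow> vertex_decomposable \<Delta> \<and> (\<forall>F\<in>facets \<Delta>. card F = r)"

lemma vd_rank_Pow: "finite F \<Longrightarrow> vd_rank (card F) (Pow F)"
  by (auto simp: vd_rank_def facets_Pow intro: vertex_decomposable.simplex)

lemma vertex_decomposable_complex: "vertex_decomposable \<Delta> \<Longrightarrow> abstract_simplicial_complex \<Delta>"
  by (induction rule: vertex_decomposable.induct) (auto intro: abstract_simplicial_complex_Pow)

lemma vd_rank_shedding:
  assumes sc: "abstract_simplicial_complex \<Delta>" and x: "{x} \<in> \<Delta>"
    and "vd_rank (Suc r) (deletion \<Delta> x)" "vd_rank r (link \<Delta> {x})"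
    and shed: "\<forall>G\<in>link \<Delta> {x}. G \<notin> facets (deletion \<Delta> x)"
  shows "vd_rank (Suc r) \<Delta>"
proof -
  have "card (insert x H) = Suc r" if "H \<in> facets (link \<Delta> {x})" for H
  proof -
    have "x \<notin> H" "finite H" using that sc by (auto simp: facets_def link_def abstract_simplicial_complex_def)
    then show ?thesis using that assms(4) by (simp add: vd_rank_def)
  qed
  then have card: "\<forall>F\<in>facets \<Delta>. card F = Suc r"
    using facets_shedding[OF sc shed] assms(3) by (auto simp: vd_rank_def)
  then have "pure_complex \<Delta>" by (simp add: pure_complex_def)
  then show ?thesis using assms card by (auto simp: vd_rank_def intro: vertex_decomposable.shedding)
qed

definition cone :: "'a \<Rightarrow> 'a set set \<Rightarrow> 'a set set" where
  "cone y \<Delta> = \<Delta> \<union> insert y ` \<Delta>"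

lemma facets_cone:
  assumes "y \<notin> \<Union>\<Delta>" shows "facets (cone y \<Delta>) = insert y ` facets \<Delta>"
proof (intro equalityI subsetI)
  fix F assume F: "F \<in> facets (cone y \<Delta>)"
  have "insert y F \<in> cone y \<Delta>" using F by (auto simp: facets_def cone_def)
  then have "y \<in> F" using F unfolding facets_def by blast
  then obtain G where G: "F = insert y G" "G \<in> \<Delta>" using F assms by (auto simp: facets_def cone_def)
  have "G' = G" if "G' \<in> \<Delta>" "G \<subseteq> G'" for G'
  proof -
    have "insert y G' = insert y G" using F G that unfolding facets_def cone_def by blast
    then show ?thesis using that G assms by (metis UnionI insert_ident)
  qed
  then show "F \<in> insert y ` facets \<Delta>" using G by (auto simp: facets_def)
next
  fix F assume "F \<in> insert y ` facets \<Delta>"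
  then obtain G where G: "F = insert y G" "G \<in> \<Delta>" "\<And>G'. G' \<in> \<Delta> \<Longrightarrow> G \<subseteq> G' \<Longrightarrow> G' = G" by (auto simp: facets_def)
  have "H = F" if H: "H \<in> cone y \<Delta>" "F \<subseteq> H" for H
  proof -
    have "y \<in> H" using H G by auto
    then obtain G' where G': "H = insert y G'" "G' \<in> \<Delta>" using H(1) assms by (auto simp: cone_def)
    then have "G \<subseteq> G'" using H(2) G assms by auto
    then have "G' = G" by (rule G(3)[OF G'(2)])
    then show ?thesis using G'(1) G(1) by simp
  qed
  then show "F \<in> facets (cone y \<Delta>)" using G by (auto simp: facets_def cone_def)
qed

lemma abstract_simplicial_complex_cone:
  assumes "abstract_simplicial_complex \<Delta>" shows "abstract_simplicial_complex (cone y \<Delta>)"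
proof -
  have "G \<in> cone y \<Delta>" if F: "F \<in> \<Delta>" "G \<subseteq> insert y F" for F G
  proof -
    have "G - {y} \<in> \<Delta>" using assms F unfolding abstract_simplicial_complex_def by blast
    then show ?thesis by (cases "y \<in> G") (auto simp: cone_def insert_Diff intro: rev_image_eqI)
  qed
  note sub = this
  have "G \<in> cone y \<Delta>" if F: "F \<in> cone y \<Delta>" "G \<subseteq> F" for F G
  proof -
    obtain F' where "F' \<in> \<Delta>" "F \<subseteq> insert y F'" using F(1) by (auto simp: cone_def)
    then show ?thesis using F(2) by (intro sub[of F' G]) auto
  qed
  moreover have "finite (cone y \<Delta>)" "{} \<in> cone y \<Delta>" "\<forall>F\<in>cone y \<Delta>. finite F"
    using assms by (auto simp: cone_def abstract_simplicial_complex_def)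
  ultimately show ?thesis unfolding abstract_simplicial_complex_def by simp
qed

text \<open>Coning commutes with deletion and link, so a shedding vertex of the base is one of the
  cone.\<close>

lemma vertex_decomposable_cone:
  assumes "vertex_decomposable \<Delta>" "y \<notin> \<Union>\<Delta>" shows "vertex_decomposable (cone y \<Delta>)"
  using assms
proof (induction rule: vertex_decomposable.induct)
  case (simplex F)
  have "cone y (Pow F) = Pow (insert y F)" by (auto simp: cone_def Pow_insert)
  then show ?case using simplex vertex_decomposable.simplex[of "insert y F"] by simp
next
  case (shedding \<Delta> x)
  have xy: "x \<noteq> y" using shedding.hyps(3) shedding.prems by auto
  have del: "deletion (cone y \<Delta>) x = cone y (deletion \<Delta> x)" using xy by (auto simp: deletion_def cone_def)
  have lk: "link (cone y \<Delta>) {x} = cone y (link \<Delta> {x})"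
  proof (intro equalityI subsetI)
    fix G assume G: "G \<in> link (cone y \<Delta>) {x}"
    then have G': "G \<in> cone y \<Delta>" "x \<notin> G" "insert x G \<in> cone y \<Delta>" by (auto simp: link_def)
    show "G \<in> cone y (link \<Delta> {x})"
    proof (cases "y \<in> G")
      case True
      then obtain H where H: "G = insert y H" "H \<in> \<Delta>" using G' shedding.prems by (auto simp: cone_def)
      obtain H' where H': "insert x G = insert y H'" "H' \<in> \<Delta>" using True G' shedding.prems by (auto simp: cone_def)
      have "y \<notin> H" "y \<notin> H'" using H H' shedding.prems by auto
      then have "H' = insert x H" using H H' xy by auto
      then have "H \<in> link \<Delta> {x}" using H H' G' by (auto simp: link_def)
      then show ?thesis using H by (auto simp: cone_def)
    next
      case False
      then have "G \<in> \<Delta>" "insert x G \<in> \<Delta>" using G' xy by (auto simp: cone_def)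
      then show ?thesis using G' by (auto simp: cone_def link_def)
    qed
  next
    fix G assume "G \<in> cone y (link \<Delta> {x})"
    then show "G \<in> link (cone y \<Delta>) {x}" using xy by (auto simp: cone_def link_def insert_commute)
  qed
  have ys: "y \<notin> \<Union>(deletion \<Delta> x)" "y \<notin> \<Union>(link \<Delta> {x})" using shedding.prems by (auto simp: deletion_def link_def)
  show ?case
  proof (rule vertex_decomposable.shedding)
    show "abstract_simplicial_complex (cone y \<Delta>)" using shedding.hyps(1) by (rule abstract_simplicial_complex_cone)
    have "card (insert y F) = Suc (card F)" if "F \<in> facets \<Delta>" for F
    proof -
      have "finite F" "y \<notin> F"
        using that shedding.hyps(1) shedding.prems by (auto simp: facets_def abstract_simplicial_complex_def)
      then show ?thesis by simp
    qed
    then have "card (insert y F) = card (insert y G)" if "F \<in> facets \<Delta>" "G \<in> facets \<Delta>" for F G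
      using that shedding.hyps(2) unfolding pure_complex_def by (metis (no_types))
    then show "pure_complex (cone y \<Delta>)"
      unfolding pure_complex_def facets_cone[OF shedding.prems] by blast
    show "{x} \<in> cone y \<Delta>" using shedding.hyps(3) by (simp add: cone_def)
    show "vertex_decomposable (deletion (cone y \<Delta>) x)" "vertex_decomposable (link (cone y \<Delta>) {x})"
      using shedding.IH ys by (simp_all add: del lk)
    show "\<forall>G\<in>link (cone y \<Delta>) {x}. G \<notin> facets (deletion (cone y \<Delta>) x)"
    proof
      fix G assume G: "G \<in> link (cone y \<Delta>) {x}"
      show "G \<notin> facets (deletion (cone y \<Delta>) x)"
      proof
        assume "G \<in> facets (deletion (cone y \<Delta>) x)"
        then obtain H where H: "G = insert y H" "H \<in> facets (deletion \<Delta> x)"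
          unfolding del facets_cone[OF ys(1)] by auto
        have "y \<notin> H" using H ys by (auto simp: facets_def)
        moreover have "insert y H \<in> cone y (link \<Delta> {x})" using G H(1) lk by simp
        ultimately have "H \<in> link \<Delta> {x}" using ys(2) by (auto simp: cone_def insert_ident)
        then show False using shedding.hyps H by blast
      qed
    qed
  qed
qed

lemma vd_rank_cone:
  assumes "vd_rank r \<Delta>" "y \<notin> \<Union>\<Delta>" shows "vd_rank (Suc r) (cone y \<Delta>)"
proof -
  have "card (insert y F) = Suc r" if "F \<in> facets \<Delta>" for F
  proof -
    have "finite F" "y \<notin> F"
      using that assms vertex_decomposable_complex[of \<Delta>]
      by (auto simp: facets_def abstract_simplicial_complex_def vd_rank_def)
    then show ?thesis using assms that by (simp add: vd_rank_def)
  qed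
  then show ?thesis
    using assms vertex_decomposable_cone by (auto simp: vd_rank_def facets_cone)
qed

section \<open>Order complexes of truncated rectangles\<close>

definition pt :: "nat \<Rightarrow> nat \<Rightarrow> nat" where
  "pt a b = 2 ^ a * 3 ^ b"

definition rk :: "nat \<Rightarrow> nat" where
  "rk x = multiplicity 2 x + multiplicity 3 x"

lemma coprime_2_3_powers: "coprime (2 ^ a) (3 ^ b :: nat)"
  by simp

lemma pt_dvd_iff: "pt a b dvd pt c d \<longleftrightarrow> a \<le> c \<and> b \<le> d"
proof
  assume *: "pt a b dvd pt c d"
  have "2 ^ a dvd pt c d" "3 ^ b dvd pt c d" using * by (auto simp: pt_def dest: dvd_mult_left dvd_mult_right)
  then have "(2::nat) ^ a dvd 2 ^ c" "(3::nat) ^ b dvd 3 ^ d"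
    unfolding pt_def using coprime_2_3_powers[of a d] coprime_2_3_powers[of c b]
    by (simp_all add: coprime_dvd_mult_left_iff coprime_dvd_mult_right_iff coprime_commute)
  then show "a \<le> c \<and> b \<le> d" by (simp add: power_dvd_imp_le)
qed (auto simp: pt_def intro: mult_dvd_mono le_imp_power_dvd)

lemma pt_eq_iff: "pt a b = pt c d \<longleftrightarrow> a = c \<and> b = d"
  using pt_dvd_iff[of a b c d] pt_dvd_iff[of c d a b] by fastforce

lemma rk_pt: "rk (pt a b) = a + b"
proof -
  have p: "prime_elem (2::nat)" "prime_elem (3::nat)" by (simp_all add: prime_imp_prime_elem)
  have "multiplicity 2 ((3::nat) ^ b) = 0" by (intro not_dvd_imp_multiplicity_0) simp
  moreover have "multiplicity 3 ((2::nat) ^ a) = 0"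
    using prime_elem_dvd_power[OF p(2), of 2 a] by (intro not_dvd_imp_multiplicity_0) auto
  ultimately show ?thesis
    using p by (simp add: rk_def pt_def prime_elem_multiplicity_mult_distrib multiplicity_same_power)
qed

lemma divisor_lattice_pt: "divisor_lattice (2 ^ n * 3 ^ m) = {pt a b |a b. a \<le> n \<and> b \<le> m}"
proof (intro equalityI subsetI)
  fix x assume "x \<in> divisor_lattice (2 ^ n * 3 ^ m)"
  then obtain c d where "x = c * d" "c dvd 2 ^ n" "d dvd 3 ^ m"
    unfolding divisor_lattice_def using division_decomp by blast
  then show "x \<in> {pt a b |a b. a \<le> n \<and> b \<le> m}"
    by (auto simp: divides_primepow_nat pt_def)
next
  fix x assume "x \<in> {pt a b |a b. a \<le> n \<and> b \<le> m}"
  then show "x \<in> divisor_lattice (2 ^ n * 3 ^ m)"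
    using pt_dvd_iff[of _ _ n m] by (auto simp: divisor_lattice_def pt_def)
qed

lemma pt_in_divisor_lattice: "pt a b \<in> divisor_lattice (2 ^ n * 3 ^ m) \<longleftrightarrow> a \<le> n \<and> b \<le> m"
  by (auto simp: divisor_lattice_pt pt_eq_iff)

lemma finite_divisor_lattice: "finite (divisor_lattice (2 ^ n * 3 ^ m))"
proof -
  have "divisor_lattice (2 ^ n * 3 ^ m) = (\<lambda>(a, b). pt a b) ` ({..n} \<times> {..m})"
    by (auto simp: divisor_lattice_pt)
  then show ?thesis by simp
qed

lemma rk_strict_mono:
  assumes "x \<in> divisor_lattice (2 ^ n * 3 ^ m)" "y \<in> divisor_lattice (2 ^ n * 3 ^ m)" "x dvd y" "x \<noteq> y"
  shows "rk x < rk y"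
  using assms by (auto simp: divisor_lattice_pt rk_pt pt_dvd_iff pt_eq_iff)

lemma poset_rank_divisor_lattice:
  assumes x: "x \<in> divisor_lattice (2 ^ n * 3 ^ m)"
  shows "poset_rank (dvd) (divisor_lattice (2 ^ n * 3 ^ m)) x = rk x"
  unfolding poset_rank_def
proof (rule Greatest_equality)
  let ?L = "divisor_lattice (2 ^ n * 3 ^ m)"
  obtain a b where ab: "x = pt a b" "a \<le> n" "b \<le> m" using x by (auto simp: divisor_lattice_pt)
  \<comment> \<open>A saturated chain: along the bottom row to \<open>pt a 0\<close>, then up the
    column.\<close>
  define xs where "xs = map (\<lambda>i. pt i 0) [0..<a] @ map (pt a) [0..<Suc b]"
  have "sorted_wrt (\<lambda>a b. a dvd b \<and> a \<noteq> b) xs"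
    by (auto simp: xs_def sorted_wrt_append sorted_wrt_map pt_dvd_iff pt_eq_iff sorted_wrt_upt
        simp del: upt_Suc intro!: sorted_wrt_mono_rel[OF _ sorted_wrt_upt])
  then show "\<exists>xs. length xs = Suc (rk x) \<and> set xs \<subseteq> ?L \<and> sorted_wrt (\<lambda>a b. a dvd b \<and> a \<noteq> b) xs \<and> last xs = x"
    using ab by (intro exI[of _ xs]) (auto simp: xs_def rk_pt pt_in_divisor_lattice)
  have "length xs \<le> Suc (rk (last xs))"
    if "set xs \<subseteq> ?L" "sorted_wrt (\<lambda>a b. a dvd b \<and> a \<noteq> b) xs" "xs \<noteq> []" for xs
    using that
  proof (induction xs rule: rev_induct)
    case (snoc y ys)
    show ?case
    proof (cases "ys = []")
      case False
      then have "rk (last ys) < rk y"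
        using snoc.prems by (intro rk_strict_mono[of _ n m]) (auto simp: sorted_wrt_append)
      then show ?thesis using snoc False by (auto simp: sorted_wrt_append)
    qed simp
  qed simp
  then show "r \<le> rk x" if "\<exists>xs. length xs = Suc r \<and> set xs \<subseteq> ?L \<and> sorted_wrt (\<lambda>a b. a dvd b \<and> a \<noteq> b) xs \<and> last xs = x" for r
    using that by fastforce
qed

lemma rank_fixed_ideal:
  fixes n m r :: nat
  defines "L \<equiv> divisor_lattice (2 ^ n * 3 ^ m)"
  shows "dual_order_ideal (dvd) L {x \<in> L. r \<le> rk x}" "rank_fixed (dvd) L {x \<in> L. r \<le> rk x}"
proof -
  have mono: "rk x \<le> rk y" if "x \<in> L" "y \<in> L" "x dvd y" for x y
    using rk_strict_mono[of x n m y] that by (cases "x = y") (auto simp: L_def)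
  then show "dual_order_ideal (dvd) L {x \<in> L. r \<le> rk x}"
    unfolding dual_order_ideal_def by (auto intro: order_trans)
  have "minimal_elements (dvd) {x \<in> L. r \<le> rk x} = {x \<in> L. rk x = r}"
  proof (intro equalityI subsetI)
    fix x assume "x \<in> minimal_elements (dvd) {x \<in> L. r \<le> rk x}"
    then have x: "x \<in> L" "r \<le> rk x" and min: "\<And>y. y \<in> L \<Longrightarrow> r \<le> rk y \<Longrightarrow> y dvd x \<Longrightarrow> y = x"
      by (auto simp: minimal_elements_def)
    obtain a b where ab: "x = pt a b" "a \<le> n" "b \<le> m" using x by (auto simp: L_def divisor_lattice_pt)
    \<comment> \<open>An element of rank \<open>r\<close> below \<open>x\<close>: keep as much of
      the first exponent as \<open>r\<close> allows; \<open>r \<le> a + b\<close> makes the rest fit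
      under \<open>b\<close>.\<close>
    define y where "y = pt (min a r) (r - min a r)"
    have "rk y = r" "y dvd x" "y \<in> L"
      using ab x(2) by (auto simp: y_def rk_pt pt_dvd_iff L_def pt_in_divisor_lattice)
    then show "x \<in> {x \<in> L. rk x = r}" using min[of y] by auto
  next
    fix x assume "x \<in> {x \<in> L. rk x = r}"
    then show "x \<in> minimal_elements (dvd) {x \<in> L. r \<le> rk x}"
      using rk_strict_mono[of _ n m x] by (force simp: minimal_elements_def L_def)
  qed
  then show "rank_fixed (dvd) L {x \<in> L. r \<le> rk x}"
    unfolding rank_fixed_def L_def using poset_rank_divisor_lattice by (intro exI[of _ r]) auto
qed

text \<open>Elements of \<open>I\<close> lie above minimal ones, and elements of rank at least
  \<open>r\<close> lie above elements of rank \<open>r\<close>. If \<open>r\<close> exceeds every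
  rank, \<open>I\<close> is empty and the truncation is vacuous.\<close>

lemma rank_fixed_idealD:
  fixes n m :: nat
  defines "L \<equiv> divisor_lattice (2 ^ n * 3 ^ m)"
  assumes I: "dual_order_ideal (dvd) L I" "rank_fixed (dvd) L I"
  shows "\<exists>r. L - I = {x \<in> L. rk x < r}"
proof -
  obtain r where "minimal_elements (dvd) I = {x \<in> L. poset_rank (dvd) L x = r}"
    using I(2) by (auto simp: rank_fixed_def)
  then have r: "minimal_elements (dvd) I = {x \<in> L. rk x = r}"
    using poset_rank_divisor_lattice by (auto simp: L_def)
  have IL: "I \<subseteq> L" and up: "\<And>t s. t \<in> I \<Longrightarrow> s \<in> L \<Longrightarrow> t dvd s \<Longrightarrow> s \<in> I"
    using I(1) by (auto simp: dual_order_ideal_def)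
  have "x \<in> I \<longleftrightarrow> r \<le> rk x" if x: "x \<in> L" for x
  proof
    assume "x \<in> I"
    \<comment> \<open>The numerically least divisor of \<open>x\<close> in \<open>I\<close> is also
      minimal for divisibility.\<close>
    define y where "y = (LEAST y. y \<in> I \<and> y dvd x)"
    have y: "y \<in> I" "y dvd x" unfolding y_def using LeastI[of "\<lambda>y. y \<in> I \<and> y dvd x" x] \<open>x \<in> I\<close> by auto
    have "z = y" if z: "z \<in> I" "z dvd y" for z
    proof -
      have "y \<le> z" unfolding y_def using z y by (intro Least_le) (auto intro: dvd_trans)
      moreover have "y \<noteq> 0" using y IL by (auto simp: L_def divisor_lattice_pt pt_def)
      then have "z \<le> y" using z by (intro dvd_imp_le) auto
      ultimately show ?thesis by simp
    qed
    then have "y \<in> minimal_elements (dvd) I" using y by (auto simp: minimal_elements_def)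
    then have "rk y = r" "y \<in> L" using r by auto
    then show "r \<le> rk x" using rk_strict_mono[of y n m x] y x by (cases "x = y") (auto simp: L_def)
  next
    assume *: "r \<le> rk x"
    obtain a b where ab: "x = pt a b" "a \<le> n" "b \<le> m" using x by (auto simp: L_def divisor_lattice_pt)
    define y where "y = pt (min a r) (r - min a r)"
    have "rk y = r" "y dvd x" "y \<in> L"
      using ab * by (auto simp: y_def rk_pt pt_dvd_iff L_def pt_in_divisor_lattice)
    then have "y \<in> I" using r by (auto simp: minimal_elements_def)
    then show "x \<in> I" using up x \<open>y dvd x\<close> by auto
  qed
  then show ?thesis using IL by (intro exI[of _ r]) auto
qed

section \<open>Order complexes for divisibility\<close>

abbreviation OC :: "nat set \<Rightarrow> nat set set" where
  "OC \<equiv> order_complex (dvd)"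

lemma OC_iff: "F \<in> OC Q \<longleftrightarrow> F \<subseteq> Q \<and> (\<forall>x\<in>F. \<forall>y\<in>F. x dvd y \<or> y dvd x)"
  by (auto simp: order_complex_def Complete_Partial_Order.chain_def)

lemma OC_mono: "F \<in> OC Q \<Longrightarrow> G \<subseteq> F \<Longrightarrow> G \<in> OC Q"
  by (meson OC_iff order_trans subsetD)

lemma OC_insert: "insert y F \<in> OC Q \<longleftrightarrow> y \<in> Q \<and> F \<in> OC Q \<and> (\<forall>z\<in>F. y dvd z \<or> z dvd y)"
  by (auto simp: OC_iff)

lemma OC_Collect: "F \<in> OC {y \<in> Q. R y} \<longleftrightarrow> F \<in> OC Q \<and> (\<forall>z\<in>F. R z)"
proof -
  have "F \<subseteq> {y \<in> Q. R y} \<longleftrightarrow> F \<subseteq> Q \<and> (\<forall>z\<in>F. R z)" by auto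
  then show ?thesis by (simp add: OC_iff conj_ac)
qed

lemma OC_Diff: "F \<in> OC (Q - {x}) \<longleftrightarrow> F \<in> OC Q \<and> x \<notin> F"
proof -
  have "F \<subseteq> Q - {x} \<longleftrightarrow> F \<subseteq> Q \<and> x \<notin> F" by auto
  then show ?thesis by (simp add: OC_iff conj_ac)
qed

lemma abstract_simplicial_complex_OC:
  assumes "finite Q" shows "abstract_simplicial_complex (OC Q)"
proof -
  have sub: "OC Q \<subseteq> Pow Q" by (auto simp: OC_iff)
  have "finite F" if "F \<in> OC Q" for F using that assms finite_subset[of F Q] by (simp add: OC_iff)
  moreover have "finite (OC Q)" using sub assms by (simp add: finite_subset)
  moreover have "{} \<in> OC Q" by (simp add: OC_iff)
  ultimately show ?thesis unfolding abstract_simplicial_complex_def using OC_mono by auto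
qed

lemma Union_OC: "\<Union>(OC Q) = Q"
proof -
  have "{x} \<in> OC Q" if "x \<in> Q" for x using that by (auto simp: OC_iff)
  then show ?thesis by (fastforce simp: OC_iff)
qed

lemma deletion_OC: "deletion (OC Q) x = OC (Q - {x})"
  by (auto simp: deletion_def OC_Diff)

lemma link_OC: "x \<in> Q \<Longrightarrow> link (OC Q) {x} = OC {y \<in> Q - {x}. x dvd y \<or> y dvd x}"
  by (auto simp: link_def OC_insert OC_Collect OC_Diff)

lemma cone_OC:
  assumes "y \<notin> Q" "\<And>x. x \<in> Q \<Longrightarrow> y dvd x \<or> x dvd y"
  shows "OC (insert y Q) = cone y (OC Q)"
proof (intro equalityI subsetI)
  fix F assume F: "F \<in> OC (insert y Q)"
  show "F \<in> cone y (OC Q)"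
  proof (cases "y \<in> F")
    case True
    then obtain G where G: "F = insert y G" "y \<notin> G" by (meson mk_disjoint_insert)
    then have "G \<in> OC Q" using F OC_Diff[of G "insert y Q" y] assms(1) by (simp add: OC_insert)
    then show ?thesis by (simp add: G cone_def)
  qed (use F in \<open>auto simp: OC_iff cone_def\<close>)
next
  fix F assume "F \<in> cone y (OC Q)"
  then consider "F \<in> OC Q" | G where "F = insert y G" "G \<in> OC Q" by (auto simp: cone_def)
  then show "F \<in> OC (insert y Q)"
  proof cases
    case 2
    have "G \<subseteq> Q" using 2(2) by (simp add: OC_iff)
    then show ?thesis using 2 assms(2) by (auto simp: OC_insert) (auto simp: OC_iff)
  qed (auto simp: OC_iff)
qed

lemma vd_rank_OC_insert:
  assumes "vd_rank r (OC Q)" "y \<notin> Q" "\<And>x. x \<in> Q \<Longrightarrow> y dvd x \<or> x dvd y"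
  shows "vd_rank (Suc r) (OC (insert y Q))"
  using cone_OC[OF assms(2,3)] vd_rank_cone[OF assms(1), of y] assms(2) by (simp add: Union_OC)

text \<open>A rectangle truncated after \<open>c\<close> ranks. Its lower corner is a parameter
  because the links of column elements contain translated blocks.\<close>

definition block :: "nat \<Rightarrow> nat \<Rightarrow> nat \<Rightarrow> nat \<Rightarrow> nat \<Rightarrow> nat set" where
  "block a0 b0 n m c = {pt (a0 + a) (b0 + b) |a b. a \<le> n \<and> b \<le> m \<and> a + b < c}"

lemma blockI: "a \<le> n \<Longrightarrow> b \<le> m \<Longrightarrow> a + b < c \<Longrightarrow> pt (a0 + a) (b0 + b) \<in> block a0 b0 n m c"
  unfolding block_def by blast

lemma finite_block: "finite (block a0 b0 n m c)"
proof -
  have "block a0 b0 n m c \<subseteq> (\<lambda>(a, b). pt (a0 + a) (b0 + b)) ` ({..n} \<times> {..m})"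
    by (auto simp: block_def)
  then show ?thesis by (rule finite_subset) simp
qed

text \<open>The column elements up to height \<open>b0 + k\<close> divide each element of the block
  and form a chain, so each of them adds a cone.\<close>

lemma vd_rank_column_block:
  assumes "vd_rank r (OC (block (Suc a0) (b0 + k) n m c))" "j \<le> Suc k"
  shows "vd_rank (j + r) (OC ((\<lambda>i. pt a0 (b0 + i)) ` {..<j} \<union> block (Suc a0) (b0 + k) n m c))"
  using assms(2)
proof (induction j)
  case (Suc j)
  have "vd_rank (Suc (j + r)) (OC (insert (pt a0 (b0 + j)) ((\<lambda>i. pt a0 (b0 + i)) ` {..<j} \<union> block (Suc a0) (b0 + k) n m c)))"
    using Suc by (intro vd_rank_OC_insert) (auto simp: block_def pt_eq_iff pt_dvd_iff)
  then show ?case by (simp add: lessThan_Suc)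
qed (use assms in simp)

text \<open>The elements of the first column are shed from the top down; the link of such an element is
  an iterated cone over a smaller block.\<close>

lemma vd_rank_block: "vd_rank (min c (Suc (n + m))) (OC (block a0 b0 n m c))"
proof (induction n arbitrary: a0 b0 m c)
  case 0
  have eq: "block a0 b0 0 m c = (\<lambda>b. pt a0 (b0 + b)) ` {..<min c (Suc m)}"
    by (auto simp: block_def)
  have "x dvd y \<or> y dvd x" if "x \<in> block a0 b0 0 m c" "y \<in> block a0 b0 0 m c" for x y
    using that unfolding eq by (auto simp: pt_dvd_iff)
  then have "OC (block a0 b0 0 m c) = Pow (block a0 b0 0 m c)"
    unfolding set_eq_iff OC_iff Pow_iff by blast
  moreover have "card (block a0 b0 0 m c) = min c (Suc (0 + m))"
    unfolding eq by (subst card_image) (auto simp: inj_on_def pt_eq_iff)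
  ultimately show ?case using vd_rank_Pow[OF finite_block] by metis
next
  case (Suc n)
  note IH = Suc.IH
  \<comment> \<open>The lowest \<open>k + 1\<close> places of the first column with all later
    columns. The latter start one rank higher, hence \<open>c - 1\<close>.\<close>
  define T where "T k = {pt a0 (b0 + b) |b. b \<le> k \<and> b < c} \<union> block (Suc a0) b0 n m (c - 1)" for k
  have "finite {pt a0 (b0 + b) |b. b \<le> k \<and> b < c}" for k
    by (rule finite_subset[of _ "(\<lambda>b. pt a0 (b0 + b)) ` {..<c}"]) auto
  then have finT: "finite (T k)" for k using finite_block by (simp add: T_def)
  have "vd_rank (min c (Suc (Suc n + m))) (OC (T k))" if "k \<le> m" for k
    using that
  proof (induction k)
    case 0
    show ?case
    proof (cases c)
      \<comment> \<open>With \<open>c = 0\<close> the poset is empty and has no apex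
        \<open>pt a0 b0\<close>.\<close>
      case 0
      have "OC (T 0) = Pow {}" using 0 by (auto simp: T_def block_def OC_iff)
      then show ?thesis using vd_rank_Pow[of "{}"] 0 by simp
    next
      case (Suc c')
      have "T 0 = insert (pt a0 b0) (block (Suc a0) b0 n m c')" using Suc by (auto simp: T_def)
      moreover have "vd_rank (Suc (min c' (Suc (n + m)))) (OC (insert (pt a0 b0) (block (Suc a0) b0 n m c')))"
        by (intro vd_rank_OC_insert IH) (auto simp: block_def pt_dvd_iff pt_eq_iff)
      ultimately show ?thesis using Suc by simp
    qed
  next
    case (Suc k)
    show ?case
    proof (cases "Suc k < c")
      case False
      then have "T (Suc k) = T k" by (auto simp: T_def le_Suc_eq)
      then show ?thesis using Suc by simp
    next
      case True
      define x where "x = pt a0 (b0 + Suc k)"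
      \<comment> \<open>The part of the later columns above \<open>x\<close>; with the column below
        \<open>x\<close> it makes up the link.\<close>
      define R where "R = block (Suc a0) (b0 + Suc k) n (m - Suc k) (c - 1 - Suc k)"
      have x: "x \<in> T (Suc k)" using True by (auto simp: T_def x_def pt_eq_iff)
      have del: "T (Suc k) - {x} = T k"
        using True by (auto simp: T_def x_def block_def pt_eq_iff le_Suc_eq)
      have "{y \<in> T k. x dvd y \<or> y dvd x} = (\<lambda>i. pt a0 (b0 + i)) ` {..<Suc k} \<union> R"
      proof (intro equalityI subsetI)
        fix y assume y: "y \<in> {y \<in> T k. x dvd y \<or> y dvd x}"
        then have "y \<in> T k" by simp
        then consider b where "y = pt a0 (b0 + b)" "b \<le> k"
          | a b where "y = pt (Suc a0 + a) (b0 + b)" "a \<le> n" "b \<le> m" "a + b < c - 1"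
          by (auto simp: T_def block_def)
        then show "y \<in> (\<lambda>i. pt a0 (b0 + i)) ` {..<Suc k} \<union> R"
        proof cases
          case 2
          then have "Suc k \<le> b" using y by (auto simp: x_def pt_dvd_iff)
          then have "y = pt (Suc a0 + a) (b0 + Suc k + (b - Suc k))" "b - Suc k \<le> m - Suc k"
            "a + (b - Suc k) < c - 1 - Suc k" using 2 by auto
          then show ?thesis using 2(2) unfolding R_def block_def by blast
        qed auto
      next
        fix y assume "y \<in> (\<lambda>i. pt a0 (b0 + i)) ` {..<Suc k} \<union> R"
        then show "y \<in> {y \<in> T k. x dvd y \<or> y dvd x}"
        proof
          assume "y \<in> (\<lambda>i. pt a0 (b0 + i)) ` {..<Suc k}"
          then obtain i where "y = pt a0 (b0 + i)" "i < Suc k" by auto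
          then show ?thesis using True by (auto simp: T_def x_def pt_dvd_iff)
        next
          assume "y \<in> R"
          then obtain a b where ab: "y = pt (Suc a0 + a) (b0 + Suc k + b)" "a \<le> n" "b \<le> m - Suc k" "a + b < c - 1 - Suc k"
            by (auto simp: R_def block_def)
          have "Suc k + b \<le> m" "a + (Suc k + b) < c - 1" using ab Suc.prems by auto
          then have "y \<in> block (Suc a0) b0 n m (c - 1)"
            using blockI[of a n "Suc k + b" m "c - 1" "Suc a0" b0] ab(2) by (simp add: ab(1) add.assoc)
          then show ?thesis by (auto simp: T_def x_def pt_dvd_iff ab(1))
        qed
      qed
      then have "{y \<in> T (Suc k) - {x}. x dvd y \<or> y dvd x} = (\<lambda>i. pt a0 (b0 + i)) ` {..<Suc k} \<union> R"
        by (simp only: del)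
      then have lk: "link (OC (T (Suc k))) {x} = OC ((\<lambda>i. pt a0 (b0 + i)) ` {..<Suc k} \<union> R)"
        using link_OC[OF x] by simp
      have "vd_rank (Suc k + min (c - 1 - Suc k) (Suc (n + (m - Suc k)))) (OC ((\<lambda>i. pt a0 (b0 + i)) ` {..<Suc k} \<union> R))"
        unfolding R_def by (rule vd_rank_column_block[OF IH]) simp
      moreover have rank: "Suc k + min (c - 1 - Suc k) (Suc (n + (m - Suc k))) = min (c - 1) (Suc (n + m))"
        using True Suc.prems by linarith
      ultimately have "vd_rank (min (c - 1) (Suc (n + m))) (link (OC (T (Suc k))) {x})"
        unfolding lk using rank by simp
      moreover have rank': "Suc (min (c - 1) (Suc (n + m))) = min c (Suc (Suc n + m))"
        using True by linarith
      ultimately have "vd_rank (min (c - 1) (Suc (n + m))) (link (OC (T (Suc k))) {x})" by simp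
      moreover have "vd_rank (Suc (min (c - 1) (Suc (n + m)))) (deletion (OC (T (Suc k))) x)"
        using Suc unfolding rank' by (simp add: deletion_OC del)
      moreover have "G \<notin> facets (deletion (OC (T (Suc k))) x)" if G: "G \<in> link (OC (T (Suc k))) {x}" for G
      proof
        assume "G \<in> facets (deletion (OC (T (Suc k))) x)"
        then have G': "G \<in> OC (T k)" "\<And>H. H \<in> OC (T k) \<Longrightarrow> G \<subseteq> H \<Longrightarrow> H = G"
          by (auto simp: deletion_OC del facets_def)
        \<comment> \<open>The element one step right of and one step below \<open>x\<close>. It is
          incomparable to \<open>x\<close>, but lies above the column part and below
          \<open>R\<close>, so it extends every face of the link once \<open>x\<close> is
          deleted.\<close>
        define y where "y = pt (Suc a0) (b0 + k)"
        have y: "y \<in> T k" 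
          using blockI[of 0 n k m "c - 1" "Suc a0" b0] True Suc.prems by (simp add: y_def T_def)
        have "G \<subseteq> (\<lambda>i. pt a0 (b0 + i)) ` {..<Suc k} \<union> R" using G lk by (auto simp: OC_iff)
        then have "y dvd z \<or> z dvd y" "z \<noteq> y" if "z \<in> G" for z
          using that by (force simp: R_def block_def y_def pt_dvd_iff pt_eq_iff)+
        then have "insert y G \<in> OC (T k)" "y \<notin> G" using G'(1) y by (auto simp: OC_iff)
        then show False using G'(2)[of "insert y G"] by auto
      qed
      moreover have "{x} \<in> OC (T (Suc k))" using x by (simp add: OC_iff)
      ultimately have "vd_rank (Suc (min (c - 1) (Suc (n + m)))) (OC (T (Suc k)))"
        by (intro vd_rank_shedding[OF abstract_simplicial_complex_OC[OF finT]] ballI)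
      then show ?thesis unfolding rank' .
    qed
  qed
  moreover have "T m = block a0 b0 (Suc n) m c"
  proof (intro equalityI subsetI)
    fix y assume "y \<in> T m"
    then consider b where "y = pt (a0 + 0) (b0 + b)" "b \<le> m" "b < c"
      | a b where "y = pt (a0 + Suc a) (b0 + b)" "Suc a \<le> Suc n" "b \<le> m" "Suc a + b < c"
      by (auto simp: T_def block_def)
    then show "y \<in> block a0 b0 (Suc n) m c"
    proof cases
      case 1
      then show ?thesis using blockI[of 0 "Suc n" b m c a0 b0] by simp
    next
      case (2 a b)
      then show ?thesis using blockI[of "Suc a" "Suc n" b m c a0 b0] by simp
    qed
  next
    fix y assume "y \<in> block a0 b0 (Suc n) m c"
    then obtain a b where ab: "y = pt (a0 + a) (b0 + b)" "a \<le> Suc n" "b \<le> m" "a + b < c"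
      by (auto simp: block_def)
    then show "y \<in> T m"
    proof (cases a)
      case (Suc a')
      then show ?thesis using ab blockI[of a' n b m "c - 1" "Suc a0" b0] by (simp add: T_def)
    qed (auto simp: T_def)
  qed
  ultimately show ?case by (metis order_refl)
qed

section \<open>Corners of staircases\<close>

lemma divisor_lattice_rk_less:
  "{x \<in> divisor_lattice (2 ^ n * 3 ^ m). rk x < r} = {pt a b |a b. a \<le> n \<and> b \<le> m \<and> a + b < r}"
  by (auto simp: divisor_lattice_pt rk_pt pt_eq_iff)

definition staircase :: "nat set \<Rightarrow> bool" where
  "staircase Q \<longleftrightarrow> finite Q \<and> (\<forall>x\<in>Q. \<exists>a b. x = pt a b) \<and>
     (\<forall>a b a' b'. pt a b \<in> Q \<longrightarrow> a' \<le> a \<longrightarrow> b' \<le> b \<longrightarrow> pt a' b' \<in> Q)"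

lemma staircaseD:
  assumes "staircase Q"
  shows "finite Q" "x \<in> Q \<Longrightarrow> \<exists>a b. x = pt a b"
    and "pt a b \<in> Q \<Longrightarrow> a' \<le> a \<Longrightarrow> b' \<le> b \<Longrightarrow> pt a' b' \<in> Q"
  using assms by (auto simp: staircase_def)

lemma staircase_order_ideal:
  assumes "dual_order_ideal (dvd) (divisor_lattice (2 ^ n * 3 ^ m)) I"
  shows "staircase (divisor_lattice (2 ^ n * 3 ^ m) - I)"
  unfolding staircase_def
proof (intro conjI ballI allI impI)
  fix a b a' b' assume ab: "pt a b \<in> divisor_lattice (2 ^ n * 3 ^ m) - I" "a' \<le> a" "b' \<le> b"
  then have "pt a' b' dvd pt a b" by (simp add: pt_dvd_iff)
  then have "pt a' b' \<notin> I" using assms ab(1) by (auto simp: dual_order_ideal_def)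
  then show "pt a' b' \<in> divisor_lattice (2 ^ n * 3 ^ m) - I" using ab by (simp add: pt_in_divisor_lattice)
qed (use finite_divisor_lattice in \<open>auto simp: divisor_lattice_pt\<close>)

text \<open>A saturated chain from \<open>pt 0 0\<close> to \<open>pt a b\<close>; it leaves no room
  below \<open>pt a b\<close> in its link.\<close>

definition hook :: "nat \<Rightarrow> nat \<Rightarrow> nat set" where
  "hook a b = (\<lambda>i. pt i 0) ` {..<a} \<union> pt a ` {..b}"

lemma card_hook: "card (hook a b) = Suc (a + b)"
proof -
  have "card (hook a b) = card ((\<lambda>i. pt i 0) ` {..<a}) + card (pt a ` {..b})"
    unfolding hook_def by (intro card_Un_disjoint) (auto simp: pt_eq_iff)
  also have "\<dots> = a + Suc b"
    by (simp add: card_image inj_on_def pt_eq_iff)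
  finally show ?thesis by simp
qed

lemma hook_in_OC:
  assumes "staircase Q" "pt a b \<in> Q" shows "hook a b \<in> OC Q"
  using staircaseD(3)[OF assms(1), OF assms(2)] by (auto simp: OC_iff hook_def pt_dvd_iff)

text \<open>What is comparable to the hook but outside it lies above \<open>pt a b\<close>. Since
  \<open>pt (Suc a) (Suc b)\<close> is missing, it lies on the row or the column of
  \<open>pt a b\<close>, and elements of the two arms are incomparable.\<close>

lemma link_hook:
  assumes Q: "staircase Q" and ab: "pt a b \<in> Q" "pt (Suc a) (Suc b) \<notin> Q"
  shows "link (OC Q) (hook a b) = Pow ({pt i b |i. i > a} \<inter> Q) \<union> Pow ({pt a j |j. j > b} \<inter> Q)"
    (is "_ = Pow ?A \<union> Pow ?B")
proof (intro equalityI subsetI)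
  fix G assume G: "G \<in> link (OC Q) (hook a b)"
  then have G': "G \<subseteq> Q" "hook a b \<inter> G = {}" "hook a b \<union> G \<in> OC Q" by (auto simp: link_def OC_iff)
  have comp: "x dvd y \<or> y dvd x" if "x \<in> hook a b \<union> G" "y \<in> hook a b \<union> G" for x y
    using G'(3) that unfolding OC_iff by blast
  have corners: "pt a 0 \<in> hook a b" "pt a b \<in> hook a b" by (auto simp: hook_def)
  have "x \<in> ?A \<union> ?B" if x: "x \<in> G" for x
  proof -
    obtain i j where ij: "x = pt i j" using staircaseD(2)[OF Q, of x] G' x by auto
    have "\<not> i < a"
    proof
      assume "i < a"
      then have "j = 0" using comp[of x "pt a 0"] x corners by (auto simp: ij pt_dvd_iff)
      then show False using G'(2) x \<open>i < a\<close> by (auto simp: hook_def ij)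
    qed
    moreover have "\<not> (i = a \<and> j \<le> b)" using G'(2) x by (auto simp: hook_def ij)
    ultimately have "b \<le> j" "i > a \<or> j > b" "a \<le> i"
      using comp[of x "pt a b"] x corners by (auto simp: ij pt_dvd_iff)
    moreover have "\<not> (i > a \<and> j > b)"
      using staircaseD(3)[OF Q, of i j "Suc a" "Suc b"] ab(2) G'(1) x ij by auto
    ultimately show ?thesis using G'(1) x ij by (cases "j = b") auto
  qed
  moreover have "\<not> (pt i b \<in> G \<and> pt a j \<in> G)" if "i > a" "j > b" for i j
    using comp[of "pt i b" "pt a j"] that by (auto simp: pt_dvd_iff)
  ultimately show "G \<in> Pow ?A \<union> Pow ?B" by blast
next
  fix G assume "G \<in> Pow ?A \<union> Pow ?B"
  then have G: "G \<subseteq> Q" "G \<subseteq> {pt i b |i. i > a} \<or> G \<subseteq> {pt a j |j. j > b}" by auto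
  have hook: "hook a b \<in> OC Q" using hook_in_OC[OF Q ab(1)] .
  have chain: "x dvd y \<or> y dvd x" if "x \<in> G" "y \<in> G" for x y
  proof -
    from G(2) that consider i j where "x = pt i b" "y = pt j b" | i j where "x = pt a i" "y = pt a j" by blast
    then show ?thesis by cases (auto simp: pt_dvd_iff)
  qed
  have above: "x dvd y" "x \<noteq> y" if "x \<in> hook a b" "y \<in> G" for x y
  proof -
    from G(2) that(2) consider i where "y = pt i b" "i > a" | j where "y = pt a j" "j > b" by blast
    then show "x dvd y" "x \<noteq> y" using that(1) by (cases; auto simp: pt_dvd_iff hook_def pt_eq_iff)+
  qed
  have "hook a b \<inter> G = {}" using above(2) by blast
  moreover have "G \<in> OC Q" using G(1) chain by (auto simp: OC_iff)
  moreover have "hook a b \<union> G \<in> OC Q" using hook G(1) chain above(1) unfolding OC_iff by blast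
  ultimately show "G \<in> link (OC Q) (hook a b)" by (simp add: link_def)
qed

text \<open>The two arms beyond \<open>pt a b\<close> are the simplices of the link. Each contains
  the element next to \<open>pt a b\<close>, so having at most one vertex excludes the second
  one.\<close>

lemma Cohen_Macaulay_corner:
  assumes Q: "staircase Q" and CM: "Cohen_Macaulay_complex TYPE('k::field) (OC Q)"
    and ab: "pt (Suc a) b \<in> Q" "pt a (Suc b) \<in> Q" "pt (Suc a) (Suc b) \<notin> Q"
  shows "pt (Suc (Suc a)) b \<notin> Q" "pt a (Suc (Suc b)) \<notin> Q"
proof -
  note sc = abstract_simplicial_complex_OC[OF staircaseD(1)[OF Q]]
  define A where "A = {pt i b |i. i > a} \<inter> Q"
  define B where "B = {pt a j |j. j > b} \<inter> Q"
  have pt: "pt a b \<in> Q" using staircaseD(3)[OF Q ab(1), of a b] by simp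
  have hook: "hook a b \<in> OC Q" using hook_in_OC[OF Q pt] .
  have lk: "link (OC Q) (hook a b) = Pow A \<union> Pow B"
    unfolding A_def B_def by (rule link_hook[OF Q pt ab(3)])
  have mem: "pt (Suc a) b \<in> A" "pt a (Suc b) \<in> B" using ab by (auto simp: A_def B_def)
  have disj: "A \<inter> B = {}" by (auto simp: A_def B_def pt_eq_iff)
  have cA: "card A \<le> 1"
    using Cohen_Macaulay_link_disjoint_simplices[OF sc CM hook lk disj] mem by blast
  have cB: "card B \<le> 1"
    using Cohen_Macaulay_link_disjoint_simplices[OF sc CM hook, of B A] lk disj mem by (auto simp: Un_commute Int_commute)
  have fin: "finite A" "finite B" using staircaseD(1)[OF Q] by (auto simp: A_def B_def)
  have one: "x = y" if "x \<in> D" "y \<in> D" "D = A \<or> D = B" for x y D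
    using that fin cA cB by (metis card_le_Suc0_iff_eq One_nat_def)
  show "pt (Suc (Suc a)) b \<notin> Q"
    using one[of "pt (Suc (Suc a)) b" A "pt (Suc a) b"] mem by (auto simp: A_def pt_eq_iff)
  show "pt a (Suc (Suc b)) \<notin> Q"
    using one[of "pt a (Suc (Suc b))" B "pt a (Suc b)"] mem by (auto simp: B_def pt_eq_iff)
qed

text \<open>Without wide corners one can slide along antidiagonals inside the staircase.\<close>

lemma staircase_without_wide_corners:
  assumes Q: "staircase Q" "Q \<noteq> {}"
    and corner: "\<And>a b. pt (Suc a) b \<in> Q \<Longrightarrow> pt a (Suc b) \<in> Q \<Longrightarrow> pt (Suc a) (Suc b) \<notin> Q \<Longrightarrow>
      pt (Suc (Suc a)) b \<notin> Q \<and> pt a (Suc (Suc b)) \<notin> Q"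
  shows "\<exists>n m c. pt n 0 \<in> Q \<and> pt 0 m \<in> Q \<and> Q = {pt a b |a b. a \<le> n \<and> b \<le> m \<and> a + b < c}"
proof -
  note down = staircaseD(3)[OF Q(1)]
  define n where "n = Max {a. pt a 0 \<in> Q}"
  define m where "m = Max {b. pt 0 b \<in> Q}"
  define s where "s = Max (rk ` Q)"
  obtain x where "x \<in> Q" using Q(2) by auto
  then obtain a0 b0 where "pt a0 b0 \<in> Q" using staircaseD(2)[OF Q(1)] by metis
  then have "pt 0 0 \<in> Q" using down by blast
  moreover have "finite {a. pt a 0 \<in> Q}" "finite {b. pt 0 b \<in> Q}"
    using finite_vimageI[OF staircaseD(1)[OF Q(1)], of "\<lambda>a. pt a 0"]
      finite_vimageI[OF staircaseD(1)[OF Q(1)], of "\<lambda>b. pt 0 b"]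
    by (auto simp: vimage_def inj_def pt_eq_iff)
  ultimately have n: "pt n 0 \<in> Q" "\<And>a. pt a 0 \<in> Q \<Longrightarrow> a \<le> n" and m: "pt 0 m \<in> Q" "\<And>b. pt 0 b \<in> Q \<Longrightarrow> b \<le> m"
    using Max_in[of "{a. pt a 0 \<in> Q}"] Max_in[of "{b. pt 0 b \<in> Q}"] by (auto simp: n_def m_def)
  have "s \<in> rk ` Q" unfolding s_def using Q staircaseD(1)[OF Q(1)] by (intro Max_in) auto
  then obtain e g where eg: "pt e g \<in> Q" "e + g = s" using staircaseD(2)[OF Q(1)] by (metis imageE rk_pt)
  have s: "a + b \<le> s" if "pt a b \<in> Q" for a b
    unfolding s_def using staircaseD(1)[OF Q(1)] that rk_pt[of a b] by (metis Max_ge finite_imageI imageI)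
  \<comment> \<open>If column \<open>Suc e\<close> stopped at a height \<open>j < g\<close>, the
    corner there would be wide, since column \<open>e\<close> reaches height
    \<open>Suc g\<close>.\<close>
  have right: "pt (Suc e) g \<in> Q" if "pt e (Suc g) \<in> Q" "e < n" for e g
  proof -
    have "pt (Suc e) j \<in> Q" if "j \<le> g" for j
      using that
    proof (induction j)
      case 0
      show ?case using down[OF n(1)] \<open>e < n\<close> by simp
    next
      case (Suc j)
      have "pt e (Suc (Suc j)) \<in> Q" "pt e (Suc j) \<in> Q" using down[OF \<open>pt e (Suc g) \<in> Q\<close>] Suc.prems by simp_all
      then show ?case using corner[of e j] Suc by auto
    qed
    then show ?thesis by simp
  qed
  have left: "pt e (Suc g) \<in> Q" if "pt (Suc e) g \<in> Q" "g < m" for e g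
  proof -
    have "pt j (Suc g) \<in> Q" if "j \<le> e" for j
      using that
    proof (induction j)
      case 0
      show ?case using down[OF m(1)] \<open>g < m\<close> by simp
    next
      case (Suc j)
      have "pt (Suc (Suc j)) g \<in> Q" "pt (Suc j) g \<in> Q" using down[OF \<open>pt (Suc e) g \<in> Q\<close>] Suc.prems by simp_all
      then show ?case using corner[of j g] Suc by auto
    qed
    then show ?thesis by simp
  qed
  have slide_right: "pt (e + t) (s - (e + t)) \<in> Q" if "e + t \<le> n" "e + t \<le> s" for t
    using that
  proof (induction t)
    case 0
    then show ?case using eg by (metis add_0_right diff_add_inverse)
  next
    case (Suc t)
    have "s - (e + t) = Suc (s - (e + Suc t))" using Suc.prems by simp
    then show ?case using right[of "e + t" "s - (e + Suc t)"] Suc by simp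
  qed
  have slide_left: "pt (s - (g + t)) (g + t) \<in> Q" if "g + t \<le> m" "g + t \<le> s" for t
    using that
  proof (induction t)
    case 0
    then show ?case using eg by (metis add_0_right diff_add_inverse2)
  next
    case (Suc t)
    have "s - (g + t) = Suc (s - (g + Suc t))" using Suc.prems by simp
    then show ?case using left[of "s - (g + Suc t)" "g + t"] Suc by simp
  qed
  \<comment> \<open>Either \<open>(e, g)\<close> dominates \<open>(a, b)\<close>, or sliding along
    the antidiagonal of maximal rank \<open>s\<close> reaches a point above \<open>(a, b)\<close> in
    its column or its row.\<close>
  have "pt a b \<in> Q" if ab: "a \<le> n" "b \<le> m" "a + b \<le> s" for a b
  proof (cases "e \<le> a")
    case True
    then have "pt a (s - a) \<in> Q" using slide_right[of "a - e"] ab by simp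
    then show ?thesis using down[of a "s - a" a b] ab by simp
  next
    case e: False
    show ?thesis
    proof (cases "g \<le> b")
      case True
      then have "pt (s - b) b \<in> Q" using slide_left[of "b - g"] ab by simp
      then show ?thesis using down[of "s - b" b a b] ab by simp
    next
      case False
      then show ?thesis using down[OF eg(1)] e by simp
    qed
  qed
  moreover have "a \<le> n \<and> b \<le> m \<and> a + b < Suc s" if "pt a b \<in> Q" for a b
    using n(2)[of a] m(2)[of b] s[OF that] down[OF that] by auto
  ultimately have "Q = {pt a b |a b. a \<le> n \<and> b \<le> m \<and> a + b < Suc s}"
    using staircaseD(2)[OF Q(1)] by (auto simp: less_Suc_eq_le) (metis less_Suc_eq_le)+
  then show ?thesis using n(1) m(1) by blast
qed

text \<open>The rank is the colouring: it is injective on chains, and it is smaller than the facet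
  size because the hook below an element of rank \<open>k\<close> is a face with
  \<open>k + 1\<close> elements.\<close>

lemma Cohen_Macaulay_staircase:
  assumes Q: "staircase Q" and "shellable (OC Q)"
  shows "Cohen_Macaulay_complex TYPE('k::field) (OC Q)"
proof -
  note sc = abstract_simplicial_complex_OC[OF staircaseD(1)[OF Q]]
  have fin: "finite (OC Q)" "\<And>F. F \<in> OC Q \<Longrightarrow> finite F" "{} \<in> OC Q"
    using sc by (auto simp: abstract_simplicial_complex_def)
  have pure: "pure_complex (OC Q)" using assms(2) by (simp add: shellable_def)
  obtain H where H: "H \<in> facets (OC Q)" using complex_face_in_facet[OF fin(1,3)] by auto
  have card: "card F = card H" if "F \<in> facets (OC Q)" for F
    using pure H that unfolding pure_complex_def by blast
  show ?thesis
  proof (rule Cohen_Macaulay_of_coloured_shellable[OF assms(2) card, where \<kappa> = rk])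
    fix F assume F: "F \<in> OC Q"
    show "inj_on rk F"
    proof (rule inj_onI)
      fix x y assume xy: "x \<in> F" "y \<in> F" "rk x = rk y"
      then have "x \<in> Q" "y \<in> Q" "x dvd y \<or> y dvd x" using F by (auto simp: OC_iff)
      then obtain a b c d where "x = pt a b" "y = pt c d" using staircaseD(2)[OF Q] by metis
      then show "x = y" using xy(3) \<open>x dvd y \<or> y dvd x\<close> by (auto simp: rk_pt pt_dvd_iff pt_eq_iff)
    qed
  next
    fix x assume "x \<in> \<Union>(OC Q)"
    then have x: "x \<in> Q" by (simp add: Union_OC)
    then obtain a b where ab: "x = pt a b" using staircaseD(2)[OF Q] by metis
    obtain G where G: "G \<in> facets (OC Q)" "hook a b \<subseteq> G"
      using complex_face_in_facet[OF fin(1) hook_in_OC[OF Q, of a b]] x ab by blast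
    then have "card (hook a b) \<le> card G" using fin(2) by (intro card_mono) (auto simp: facets_def)
    then show "rk x < card H" using card[OF G(1)] by (simp add: card_hook ab rk_pt)
  qed
qed

theorem theorem4p4:
  fixes n m :: nat and L I :: "nat set"
  assumes "L = divisor_lattice (2 ^ n * 3 ^ m)"
    and "dual_order_ideal (dvd) L I"
  shows "((\<exists>n'\<le>n. \<exists>m'\<le>m. \<exists>I'.
             dual_order_ideal (dvd) (divisor_lattice (2 ^ n' * 3 ^ m')) I' \<and>
             rank_fixed (dvd) (divisor_lattice (2 ^ n' * 3 ^ m')) I' \<and>
             L - I = divisor_lattice (2 ^ n' * 3 ^ m') - I')
           \<longleftrightarrow> vertex_decomposable (order_complex (dvd) (L - I)))
       \<and> (vertex_decomposable (order_complex (dvd) (L - I))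
           \<longleftrightarrow> shellable (order_complex (dvd) (L - I)))
       \<and> (shellable (order_complex (dvd) (L - I))
           \<longleftrightarrow> Cohen_Macaulay_complex TYPE('k::field) (order_complex (dvd) (L - I)))"
    (is "(?i \<longleftrightarrow> ?ii) \<and> (?ii \<longleftrightarrow> ?iii) \<and> (?iii \<longleftrightarrow> ?iv)")
proof -
  have Q: "staircase (L - I)" using staircase_order_ideal assms by blast
  have "?ii" if ?i
  proof -
    obtain n' m' I' where I': "dual_order_ideal (dvd) (divisor_lattice (2 ^ n' * 3 ^ m')) I'"
      "rank_fixed (dvd) (divisor_lattice (2 ^ n' * 3 ^ m')) I'"
      "L - I = divisor_lattice (2 ^ n' * 3 ^ m') - I'" using \<open>?i\<close> by blast
    obtain r where "L - I = {x \<in> divisor_lattice (2 ^ n' * 3 ^ m'). rk x < r}"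
      using rank_fixed_idealD[OF I'(1,2)] I'(3) by auto
    then have "L - I = block 0 0 n' m' r" by (simp add: divisor_lattice_rk_less block_def)
    then show ?thesis using vd_rank_block[of r n' m' 0 0] by (simp add: vd_rank_def)
  qed
  moreover have "?iii" if ?ii using that by (rule shellable_of_vertex_decomposable)
  moreover have "?iv" if ?iii using Cohen_Macaulay_staircase[OF Q that] .
  moreover have "?i" if ?iv
  proof -
    have "\<exists>n' m' r. n' \<le> n \<and> m' \<le> m \<and> L - I = {x \<in> divisor_lattice (2 ^ n' * 3 ^ m'). rk x < r}"
    proof (cases "L - I = {}")
      case True
      \<comment> \<open>Truncation at \<open>r = 0\<close> leaves nothing.\<close>
      then show ?thesis by (intro exI[of _ 0]) simp
    next
      case False
      obtain n' m' c where "pt n' 0 \<in> L - I" "pt 0 m' \<in> L - I"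
        and eq: "L - I = {pt a b |a b. a \<le> n' \<and> b \<le> m' \<and> a + b < c}"
        using staircase_without_wide_corners[OF Q False] Cohen_Macaulay_corner[OF Q \<open>?iv\<close>] by blast
      then have "n' \<le> n" "m' \<le> m" by (auto simp: assms(1) pt_in_divisor_lattice)
      moreover have "L - I = {x \<in> divisor_lattice (2 ^ n' * 3 ^ m'). rk x < c}"
        unfolding eq divisor_lattice_rk_less ..
      ultimately show ?thesis by blast
    qed
    then obtain n' m' r where r: "n' \<le> n" "m' \<le> m" "L - I = {x \<in> divisor_lattice (2 ^ n' * 3 ^ m'). rk x < r}"
      by metis
    have eq: "L - I = divisor_lattice (2 ^ n' * 3 ^ m') - {x \<in> divisor_lattice (2 ^ n' * 3 ^ m'). r \<le> rk x}"
      unfolding r(3) by auto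
    show ?thesis
      by (intro exI[of _ n'] exI[of _ m'] conjI exI[of _ "{x \<in> divisor_lattice (2 ^ n' * 3 ^ m'). r \<le> rk x}"])
        (rule r(1,2) rank_fixed_ideal eq)+
  qed
  ultimately show ?thesis by blast
qed

end
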